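(* Under the same setting and the Lipschitz kernel assumption, there are constants $c,C>0$ such that for all $N\ge1$ and all $\varepsilon>0$, $$P\left[\left|\int\mathcal{W}(\hat\pi^N_{x_1},\hat\pi^N_2)\,\hat\pi^N_1(dx_1)-\int\mathcal{W}(\pi_{x_1},\nu)\,\mu(dx_1)\right|\ge2C\,\mathrm{rate}(N)+\varepsilon\right]\le4\exp(-cN\varepsilon^2).$$
   Context: $\pi$ is a Borel probability measure on $[0,1]^d\times[0,1]^d$ with marginals $\mu,\nu$; $(X_1^n,X_2^n)_{n\ge1}$ i.i.d. with law $\pi$; $[0,1]^d$ carries the Euclidean metric; $\mathcal{W}$ is the $1$-Wasserstein distance. Lipschitz kernel assumption: some version of the disintegration $x_1\mapsto\pi_{x_1}$ is Lipschitz from $([0,1]^d,|\cdot|_2)$ to $(\mathrm{Prob}([0,1]^d),\mathcal{W})$. Grid: $r=1/3$ if $d=1$, $r=1/(2d)$ if $d\ge2$; $[0,1]^d$ is partitioned into $N^{rd}$ cubes of edge length $N^{-r}$ and $\varphi^N$ maps each cube to its center; $\hat\pi^N=\frac1N\sum_{n=1}^N\delta_{(\varphi^N(X_1^n),\varphi^N(X_2^n))}$ with marginals $\hat\pi^N_1,\hat\pi^N_2$ and disintegration $\hat\pi^N_{x_1}$. $\mathrm{rate}(N)=N^{-1/3}$ for $d=1$, $N^{-1/4}\log(N+1)$ for $d=2$, $N^{-1/(2d)}$ for $d\ge3$.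
   Formalization: A partition into N^{rd} cubes of edge length N^{-r} exists only when N^r is an integer; in general the grid here has m = ⌈N^r⌉ cubes per axis, of edge length 1/m, which agrees with the stated grid whenever N^r is an integer. *)

theory Defs
  imports "HOL-Probability.Probability"
begin

definition unit_cube :: "(real ^ 'd) set" where
  "unit_cube = {x. \<forall>i. 0 \<le> x $ i \<and> x $ i \<le> 1}"

definition couplings :: "'a::metric_space measure \<Rightarrow> 'a measure \<Rightarrow> ('a \<times> 'a) measure set" where
  "couplings p q = {\<gamma>. prob_space \<gamma> \<and> sets \<gamma> = sets borel \<and>
       distr \<gamma> borel fst = p \<and> distr \<gamma> borel snd = q}"

definition W1 :: "'a::metric_space measure \<Rightarrow> 'a measure \<Rightarrow> real" where
  "W1 p q = enn2real (INF \<gamma>\<in>couplings p q. \<integral>\<^sup>+ z. ennreal (dist (fst z) (snd z)) \<partial>\<gamma>)"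

definition pmf_to_borel :: "'a::topological_space pmf \<Rightarrow> 'a measure" where
  "pmf_to_borel p = distr (measure_pmf p) borel (\<lambda>x. x)"

definition grid_r :: "nat \<Rightarrow> real" where
  "grid_r d = (if d = 1 then 1/3 else 1 / (2 * real d))"

definition grid_m :: "nat \<Rightarrow> nat \<Rightarrow> nat" where
  "grid_m d N = nat \<lceil>real N powr grid_r d\<rceil>"

text \<open>phi^N: maps each point to the center of its grid cube (cubes of edge 1/m,
  half-open, the last one closed at 1).\<close>
definition phiN :: "nat \<Rightarrow> real ^ 'd \<Rightarrow> real ^ 'd" where
  "phiN N x = (let m = grid_m CARD('d) N in
     (\<chi> i. (real_of_int (min \<lfloor>real m * x $ i\<rfloor> (int m - 1)) + 1/2) / real m))"

definition rate :: "nat \<Rightarrow> nat \<Rightarrow> real" where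
  "rate d N = (if d = 1 then real N powr (-1/3)
               else if d = 2 then real N powr (-1/4) * ln (real N + 1)
               else real N powr (- 1 / (2 * real d)))"

definition emp_pi :: "nat \<Rightarrow> (nat \<Rightarrow> 'w \<Rightarrow> real ^ 'd) \<Rightarrow> (nat \<Rightarrow> 'w \<Rightarrow> real ^ 'd) \<Rightarrow> 'w
     \<Rightarrow> ((real ^ 'd) \<times> (real ^ 'd)) pmf" where
  "emp_pi N X1 X2 w = pmf_of_multiset
     (mset (map (\<lambda>n. (phiN N (X1 n w), phiN N (X2 n w))) [1..<N+1]))"

text \<open>\<open>\<integral> W(\<hat>\<pi>^N_{x1}, \<hat>\<pi>^N_2) \<hat>\<pi>^N_1(dx1)\<close>; the disintegration of a discrete
  measure at an atom x1 is the conditional distribution of the second coordinate.\<close>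
definition emp_AW_int :: "nat \<Rightarrow> (nat \<Rightarrow> 'w \<Rightarrow> real ^ 'd) \<Rightarrow> (nat \<Rightarrow> 'w \<Rightarrow> real ^ 'd) \<Rightarrow> 'w \<Rightarrow> real" where
  "emp_AW_int N X1 X2 w = (let p = emp_pi N X1 X2 w in
     measure_pmf.expectation (map_pmf fst p)
       (\<lambda>a. W1 (pmf_to_borel (map_pmf snd (cond_pmf p {z. fst z = a})))
               (pmf_to_borel (map_pmf snd p))))"

end

theory Submission
  imports Defs
begin

text \<open>
  Rounding both coordinates to the grid moves the adapted functional of \<open>\<pi>\<close> by a multiple of the mesh:
  the kernel is Lipschitz, and \<open>W1\<close> is convex in the conditional law over a cell. On the grid, optimal
  transport cost is bounded by a multiscale sum over dyadic cells, so the difference between empirical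
  and true functional is at most a sum of \<open>2 ^ (-j)\<close> times absolute deviations of cell frequencies.
  The expectation of that sum is of the order of the rate by Cauchy-Schwarz, and a single observation
  changes it by \<open>O(1/N)\<close>, so McDiarmid's inequality yields the tail bound.
\<close>

text \<open>The conditional laws of the empirical measure are normalised by random cell counts,
  which may be tiny, so they do not concentrate atom by atom. Weighting each atom by its mass
  cancels the normalisation: what remains are deviations of joint frequencies of pairs (grid point,
  dyadic cell), which add up over the atoms. With m grid cubes per axis there are at most m^d 2^(jd)
  pairs at level j, so Cauchy-Schwarz bounds their expected total by sqrt (m^d 2^(jd) / N).
  Balancing against the mesh 1/m explains m = N^r: for d = 1 the coarsest level dominates and sqrt
  (m / N) = 1/m; for d >= 3 the finest level 2^j = m dominates and m^(d-1) / sqrt N = 1/m; for d = 2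
  all levels weigh the same, whence the logarithm.

  A second obstacle is that \<open>W1\<close> is real-valued and reads an infinite cost as 0, while
  the kernel may take values with infinite first moment on a \<mu>-null set. Hence costs are handled
  in \<open>ennreal\<close>, and the real triangle inequality is used only where the costs are
  finite.\<close>

section \<open>Couplings, the extended transport cost and its triangle inequality\<close>

definition transport_cost :: "('a::metric_space \<times> 'a) measure \<Rightarrow> ennreal" where
  "transport_cost g = (\<integral>\<^sup>+ z. ennreal (dist (fst z) (snd z)) \<partial>g)"

text \<open>If there is no coupling, or none of finite cost, the value is \<infinity>, whereas
  \<open>W1\<close> returns 0. The triangle inequality holds unconditionally only for this
  version.\<close>

definition W1e :: "'a::metric_space measure \<Rightarrow> 'a measure \<Rightarrow> ennreal" where
  "W1e p q = (INF g\<in>couplings p q. transport_cost g)"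

lemma W1_conv_W1e: "W1 p q = enn2real (W1e p q)"
  by (simp add: W1_def W1e_def transport_cost_def)

lemma W1_nonneg: "W1 p q \<ge> 0"
  by (simp add: W1_conv_W1e)

lemma borel_measurable_fst_prod: "fst \<in> borel_measurable borel"
  and borel_measurable_snd_prod: "snd \<in> borel_measurable borel"
  by (intro borel_measurable_continuous_onI continuous_on_fst continuous_on_snd continuous_on_id)+

lemma borel_measurable_dist_prod:
  "(\<lambda>z::'a::{second_countable_topology,metric_space} \<times> 'a. dist (fst z) (snd z)) \<in> borel_measurable borel"
  by (intro borel_measurable_continuous_onI continuous_intros)

lemma couplings_swap:
  fixes p q :: "'a::{second_countable_topology,metric_space} measure"
  assumes "g \<in> couplings p q"
  shows "distr g borel prod.swap \<in> couplings q p"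
    and "transport_cost (distr g borel prod.swap) = transport_cost g"
proof -
  have s[measurable_cong]: "sets g = sets borel" and pr: "prob_space g"
    and d: "distr g borel fst = p" "distr g borel snd = q"
    using assms by (auto simp: couplings_def)
  have sw[measurable]: "prod.swap \<in> borel_measurable g"
    by (subst measurable_cong_sets[OF s refl], intro borel_measurable_continuous_onI)
       (auto intro!: continuous_intros simp: prod.swap_def)
  show "distr g borel prod.swap \<in> couplings q p"
    using prob_space.prob_space_distr[OF pr sw] d
    by (simp add: couplings_def distr_distr[OF _ sw] comp_def borel_measurable_fst_prod borel_measurable_snd_prod)
  show "transport_cost (distr g borel prod.swap) = transport_cost g"
    unfolding transport_cost_def
    by (subst nn_integral_distr) (auto simp: dist_commute borel_measurable_dist_prod)
qed

lemma W1e_commute: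
  fixes p q :: "'a::{second_countable_topology,metric_space} measure"
  shows "W1e p q = W1e q p"
proof -
  have "W1e q p \<le> W1e p q" for p q :: "'a measure"
    unfolding W1e_def
    by (rule INF_greatest) (metis couplings_swap INF_lower)
  then show ?thesis by (simp add: antisym)
qed

lemma W1_commute:
  fixes p q :: "'a::{second_countable_topology,metric_space} measure"
  shows "W1 p q = W1 q p"
  by (simp add: W1_conv_W1e W1e_commute)

text \<open>Each point is labelled by the first member of a dense sequence closer than \<delta>/2.
  The least index makes the cells disjoint and measurable, and two points with the same label are
  within \<delta> of each other through that member.\<close>

lemma small_cells_exist:
  fixes \<delta> :: real assumes "\<delta> > 0"
  obtains k :: "'a::{second_countable_topology,metric_space} \<Rightarrow> nat"
  where "k \<in> borel \<rightarrow>\<^sub>M count_space UNIV" "\<And>x y. k x = k y \<Longrightarrow> dist x y \<le> \<delta>"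
proof -
  obtain D :: "'a set" where D: "countable D" "\<And>X. open X \<Longrightarrow> X \<noteq> {} \<Longrightarrow> \<exists>d\<in>D. d \<in> X"
    by (metis countable_dense_setE)
  define e where "e = from_nat_into D"
  have ex: "\<exists>n. dist x (e n) < \<delta>/2" for x
  proof -
    obtain d where "d \<in> D" "d \<in> ball x (\<delta>/2)"
      using D(2)[of "ball x (\<delta>/2)"] assms by auto
    then show ?thesis
      unfolding e_def by (metis D(1) from_nat_into_to_nat_on mem_ball)
  qed
  define k where "k x = (LEAST n. dist x (e n) < \<delta>/2)" for x
  have 1: "dist x (e (k x)) < \<delta>/2" for x
    unfolding k_def by (rule LeastI_ex) (rule ex)
  have 2: "k \<in> borel \<rightarrow>\<^sub>M count_space UNIV"
    unfolding k_def by measurable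
  have 3: "dist x y \<le> \<delta>" if "k x = k y" for x y
    using 1[of x] 1[of y] that dist_triangle2[of x y "e (k x)"] by auto
  show ?thesis using that[OF 2 3] .
qed

text \<open>Gluing without disintegration: the middle marginal is only matched up to cells of small
  diameter, and on countably many cells conditioning is elementary.\<close>

lemma couplings_glue:
  fixes p q r :: "'a::{second_countable_topology,metric_space} measure"
  assumes g1: "g1 \<in> couplings p q" and g2: "g2 \<in> couplings q r" and \<delta>: "\<delta> > 0"
  shows "\<exists>g\<in>couplings p r. transport_cost g \<le> transport_cost g1 + ennreal \<delta> + transport_cost g2"
proof -
  have s1[measurable_cong]: "sets g1 = sets (borel \<Otimes>\<^sub>M borel)" and p1: "prob_space g1"
    and d1: "distr g1 borel fst = p" "distr g1 borel snd = q"
    using g1 unfolding couplings_def borel_prod by blast+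
  have s2[measurable_cong]: "sets g2 = sets (borel \<Otimes>\<^sub>M borel)" and p2: "prob_space g2"
    and d2: "distr g2 borel fst = q" "distr g2 borel snd = r"
    using g2 unfolding couplings_def borel_prod by blast+
  interpret g1: prob_space g1 by fact
  interpret g2: prob_space g2 by fact
  interpret pp: pair_prob_space g1 g2 ..
  interpret q: prob_space q
    unfolding d1(2)[symmetric] by (rule g1.prob_space_distr) measurable
  have sq[measurable_cong]: "sets q = sets borel" using d1(2) by auto
  obtain k :: "'a \<Rightarrow> nat" where k[measurable]: "k \<in> borel \<rightarrow>\<^sub>M count_space UNIV"
    and kd: "\<And>x y. k x = k y \<Longrightarrow> dist x y \<le> \<delta>"
    using small_cells_exist[OF \<delta>] by blast
  define e where "e n = emeasure q {y. k y = n}" for n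
  have sp1: "space g1 = UNIV" and sp2: "space g2 = UNIV"
    by (auto simp: sets_eq_imp_space_eq[OF s1] sets_eq_imp_space_eq[OF s2] space_pair_measure)
  have cell_mass: "e n = (\<integral>\<^sup>+ z. indicator {z. k (f z) = n} z \<partial>g)"
    if d: "distr g borel f = q" and f[measurable]: "f \<in> g \<rightarrow>\<^sub>M borel" and sp: "space g = UNIV"
    for n g and f :: "'a \<times> 'a \<Rightarrow> 'a"
  proof -
    have "e n = emeasure g {z. k (f z) = n}"
      unfolding e_def d[symmetric] by (subst emeasure_distr) (auto simp: sp vimage_def)
    moreover have "{z. k (f z) = n} \<in> sets g"
      using measurable_sets[of "\<lambda>z. k (f z)" g "count_space UNIV" "{n}"] sp by (simp add: vimage_def)
    ultimately show ?thesis by simp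
  qed
  have e1: "e n = (\<integral>\<^sup>+ z. indicator {z. k (snd z) = n} z \<partial>g1)" for n
    by (rule cell_mass[OF d1(2) _ sp1]) measurable
  have e2: "e n = (\<integral>\<^sup>+ z. indicator {z. k (fst z) = n} z \<partial>g2)" for n
    by (rule cell_mass[OF d2(1) _ sp2]) measurable
  have efin: "e n < top" for n by (simp add: e_def q.emeasure_eq_measure)
  \<comment> \<open>Cells without mass must be discarded: in \<open>ennreal\<close>, 0 times
    \<open>inverse 0\<close> is 0 and not 1, so the cancellation below fails on them. Being
    countably many, they form a null set.\<close>
  have "AE y in q. e (k y) \<noteq> 0"
  proof -
    have "AE y in q. \<forall>n. e n = 0 \<longrightarrow> k y \<noteq> n"
      unfolding AE_all_countable
    proof
      fix n show "AE y in q. e n = 0 \<longrightarrow> k y \<noteq> n"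
      proof (cases "e n = 0")
        case True
        then show ?thesis
          by (intro AE_I[of _ _ "{y. k y = n}"]) (auto simp: e_def sq)
      qed auto
    qed
    then show ?thesis by eventually_elim auto
  qed
  then have "AE y in distr g1 borel snd. e (k y) \<noteq> 0" "AE y in distr g2 borel fst. e (k y) \<noteq> 0"
    unfolding d1(2) d2(1) by auto
  then have AE1: "AE z in g1. e (k (snd z)) \<noteq> 0" and AE2: "AE z in g2. e (k (fst z)) \<noteq> 0"
    by (auto dest: AE_distrD[rotated])
  \<comment> \<open>With this density, the product of \<open>g1\<close> and \<open>g2\<close>
    becomes the coupling in which both are independent given that their middle points lie in a
    common cell. Integrating out either factor yields the mass of the cell times its
    inverse.\<close>
  define h :: "('a \<times> 'a) \<times> ('a \<times> 'a) \<Rightarrow> ennreal" where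
    "h w = (if k (snd (fst w)) = k (fst (snd w)) then inverse (e (k (snd (fst w)))) else 0)" for w
  have [measurable]: "(\<lambda>x. inverse (e (k x))) \<in> borel_measurable borel" "(\<lambda>x. real (k x)) \<in> borel_measurable borel"
    by (rule measurable_compose[OF k], simp)+
  \<comment> \<open>Cell labels are compared as reals, so that the equality test is a Borel
    condition.\<close>
  have h[measurable]: "h \<in> borel_measurable (g1 \<Otimes>\<^sub>M g2)"
    unfolding h_def of_nat_eq_iff[where 'a=real, symmetric] by measurable
  have int1: "(\<integral>\<^sup>+ w. h w * f (fst w) \<partial>(g1 \<Otimes>\<^sub>M g2)) = (\<integral>\<^sup>+ z. f z \<partial>g1)"
    if [measurable]: "f \<in> borel_measurable g1" for f
  proof -
    have "(\<integral>\<^sup>+ w. h w * f (fst w) \<partial>(g1 \<Otimes>\<^sub>M g2)) = (\<integral>\<^sup>+ z. (\<integral>\<^sup>+ z'. h (z, z') * f z \<partial>g2) \<partial>g1)"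
      by (subst g2.nn_integral_fst[symmetric]) auto
    also have "\<dots> = (\<integral>\<^sup>+ z. f z \<partial>g1)"
    proof (rule nn_integral_cong_AE)
      show "AE z in g1. (\<integral>\<^sup>+ z'. h (z, z') * f z \<partial>g2) = f z"
        using AE1
      proof eventually_elim
        case (elim z)
        have "(\<integral>\<^sup>+ z'. h (z, z') * f z \<partial>g2)
           = (\<integral>\<^sup>+ z'. (inverse (e (k (snd z))) * f z) * indicator {z'. k (fst z') = k (snd z)} z' \<partial>g2)"
          by (intro nn_integral_cong) (auto simp: h_def indicator_def)
        also have "\<dots> = (inverse (e (k (snd z))) * f z) * e (k (snd z))"
          by (subst nn_integral_cmult) (auto simp: e2)
        also have "\<dots> = (e (k (snd z)) * inverse (e (k (snd z)))) * f z"
          by (simp add: mult_ac)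
        also have "\<dots> = f z"
          using elim efin[of "k (snd z)"] by (simp add: ennreal_divide_self divide_ennreal_def[symmetric])
        finally show ?case .
      qed
    qed
    finally show ?thesis .
  qed
  have int2: "(\<integral>\<^sup>+ w. h w * f (snd w) \<partial>(g1 \<Otimes>\<^sub>M g2)) = (\<integral>\<^sup>+ z. f z \<partial>g2)"
    if [measurable]: "f \<in> borel_measurable g2" for f
  proof -
    have "(\<integral>\<^sup>+ w. h w * f (snd w) \<partial>(g1 \<Otimes>\<^sub>M g2)) = (\<integral>\<^sup>+ z'. (\<integral>\<^sup>+ z. h (z, z') * f z' \<partial>g1) \<partial>g2)"
      by (subst pp.nn_integral_snd[symmetric]) auto
    also have "\<dots> = (\<integral>\<^sup>+ z. f z \<partial>g2)"
    proof (rule nn_integral_cong_AE)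
      show "AE z' in g2. (\<integral>\<^sup>+ z. h (z, z') * f z' \<partial>g1) = f z'"
        using AE2
      proof eventually_elim
        case (elim z')
        have "(\<integral>\<^sup>+ z. h (z, z') * f z' \<partial>g1)
           = (\<integral>\<^sup>+ z. (inverse (e (k (fst z'))) * f z') * indicator {z. k (snd z) = k (fst z')} z \<partial>g1)"
          by (intro nn_integral_cong) (auto simp: h_def indicator_def)
        also have "\<dots> = (inverse (e (k (fst z'))) * f z') * e (k (fst z'))"
          by (subst nn_integral_cmult) (auto simp: e1)
        also have "\<dots> = (e (k (fst z')) * inverse (e (k (fst z')))) * f z'"
          by (simp add: mult_ac)
        also have "\<dots> = f z'"
          using elim efin[of "k (fst z')"] by (simp add: ennreal_divide_self divide_ennreal_def[symmetric])
        finally show ?case .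
      qed
    qed
    finally show ?thesis .
  qed
  define \<Theta> where "\<Theta> = density (g1 \<Otimes>\<^sub>M g2) h"
  have s\<Theta>[measurable_cong]: "sets \<Theta> = sets ((borel \<Otimes>\<^sub>M borel) \<Otimes>\<^sub>M (borel \<Otimes>\<^sub>M borel))"
    unfolding \<Theta>_def sets_density by (intro sets_pair_measure_cong s1 s2)
  define pr where "pr w = (fst (fst w), snd (snd w))" for w :: "('a \<times> 'a) \<times> ('a \<times> 'a)"
  have [measurable]: "pr \<in> \<Theta> \<rightarrow>\<^sub>M borel"
    unfolding pr_def borel_prod[symmetric] by measurable
  define g where "g = distr \<Theta> borel pr"
  have prm[measurable]: "pr \<in> g1 \<Otimes>\<^sub>M g2 \<rightarrow>\<^sub>M borel"
    unfolding pr_def borel_prod[symmetric] by measurable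
  have int_g: "(\<integral>\<^sup>+ z. f z \<partial>g) = (\<integral>\<^sup>+ w. h w * f (pr w) \<partial>(g1 \<Otimes>\<^sub>M g2))"
    if f: "f \<in> borel_measurable borel" for f
    unfolding g_def using f measurable_compose[OF prm f]
    by (subst nn_integral_distr) (auto simp: \<Theta>_def nn_integral_density h)
  have sg: "sets g = sets borel" by (simp add: g_def)
  have fg: "fst \<in> g \<rightarrow>\<^sub>M borel" "snd \<in> g \<rightarrow>\<^sub>M borel"
    using borel_measurable_fst_prod borel_measurable_snd_prod measurable_cong_sets[OF sg refl] by blast+
  have em_distr: "emeasure (distr N borel f) A = (\<integral>\<^sup>+ z. indicator A (f z) \<partial>N)"
    if "A \<in> sets borel" "f \<in> N \<rightarrow>\<^sub>M borel" for A and f :: "'a \<times> 'a \<Rightarrow> 'a" and N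
    using that by (subst nn_integral_indicator[symmetric], simp) (subst nn_integral_distr, auto)
  have ind: "(\<lambda>z. indicator A (fst z)) \<in> borel_measurable borel" "(\<lambda>z. indicator A (snd z)) \<in> borel_measurable borel"
    if "A \<in> sets borel" for A :: "'a set"
    using that by (auto intro!: measurable_compose[OF borel_measurable_fst_prod] measurable_compose[OF borel_measurable_snd_prod])
  have gfst: "distr g borel fst = p"
  proof (rule measure_eqI)
    fix A assume "A \<in> sets (distr g borel fst)"
    then have A[measurable]: "A \<in> sets borel" by simp
    have "emeasure (distr g borel fst) A = (\<integral>\<^sup>+ w. h w * indicator A (fst (fst w)) \<partial>(g1 \<Otimes>\<^sub>M g2))"
      by (simp add: em_distr fg int_g ind pr_def)
    also have "\<dots> = (\<integral>\<^sup>+ z. indicator A (fst z) \<partial>g1)"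
      by (rule int1) measurable
    also have "\<dots> = emeasure p A"
      unfolding d1(1)[symmetric] by (rule em_distr[symmetric]) measurable
    finally show "emeasure (distr g borel fst) A = emeasure p A" .
  qed (use d1 in auto)
  have gsnd: "distr g borel snd = r"
  proof (rule measure_eqI)
    fix A assume "A \<in> sets (distr g borel snd)"
    then have A[measurable]: "A \<in> sets borel" by simp
    have "emeasure (distr g borel snd) A = (\<integral>\<^sup>+ w. h w * indicator A (snd (snd w)) \<partial>(g1 \<Otimes>\<^sub>M g2))"
      by (simp add: em_distr fg int_g ind pr_def)
    also have "\<dots> = (\<integral>\<^sup>+ z. indicator A (snd z) \<partial>g2)"
      by (rule int2) measurable
    also have "\<dots> = emeasure r A"
      unfolding d2(2)[symmetric] by (rule em_distr[symmetric]) measurable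
    finally show "emeasure (distr g borel snd) A = emeasure r A" .
  qed (use d2 in auto)
  have "prob_space p" unfolding d1(1)[symmetric] by (rule g1.prob_space_distr) measurable
  then have "prob_space g"
    using gfst prob_space_distrD[OF fg(1)] by simp
  then have "g \<in> couplings p r"
    using gfst gsnd by (simp add: couplings_def g_def)
  moreover have "transport_cost g \<le> transport_cost g1 + ennreal \<delta> + transport_cost g2"
  proof -
    let ?d = "\<lambda>z::'a\<times>'a. ennreal (dist (fst z) (snd z))"
    have "transport_cost g = (\<integral>\<^sup>+ w. h w * ennreal (dist (fst (fst w)) (snd (snd w))) \<partial>(g1 \<Otimes>\<^sub>M g2))"
      unfolding transport_cost_def by (subst int_g) (auto simp: pr_def borel_measurable_dist_prod)
    \<comment> \<open>Where \<open>h\<close> does not vanish, the two middle points share a cell, so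
      bridging the gap between them costs at most \<delta>.\<close>
    also have "\<dots> \<le> (\<integral>\<^sup>+ w. h w * (?d (fst w) + ennreal \<delta>) + h w * ?d (snd w) \<partial>(g1 \<Otimes>\<^sub>M g2))"
    proof (rule nn_integral_mono)
      fix w
      show "h w * ennreal (dist (fst (fst w)) (snd (snd w)))
          \<le> h w * (?d (fst w) + ennreal \<delta>) + h w * ?d (snd w)"
      proof (cases "k (snd (fst w)) = k (fst (snd w))")
        case True
        have "dist (fst (fst w)) (snd (snd w)) \<le>
          dist (fst (fst w)) (snd (fst w)) + dist (snd (fst w)) (fst (snd w)) + dist (fst (snd w)) (snd (snd w))"
          by metric
        also have "\<dots> \<le> dist (fst (fst w)) (snd (fst w)) + \<delta> + dist (fst (snd w)) (snd (snd w))"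
          using kd[OF True] by simp
        finally have "ennreal (dist (fst (fst w)) (snd (snd w)))
             \<le> ?d (fst w) + ennreal \<delta> + ?d (snd w)"
          using \<delta> by (simp add: ennreal_plus[symmetric] del: ennreal_plus)
        then show ?thesis
          unfolding distrib_left[symmetric] by (rule mult_left_mono) simp
      qed (simp add: h_def)
    qed
    also have "\<dots> = (\<integral>\<^sup>+ z. ?d z + ennreal \<delta> \<partial>g1) + (\<integral>\<^sup>+ z. ?d z \<partial>g2)"
      by (subst nn_integral_add) (auto intro!: arg_cong2[where f="(+)"] int1[of "\<lambda>z. ?d z + ennreal \<delta>"] int2[of ?d])
    also have "(\<integral>\<^sup>+ z. ?d z + ennreal \<delta> \<partial>g1) = (\<integral>\<^sup>+ z. ?d z \<partial>g1) + ennreal \<delta>"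
      by (subst nn_integral_add) (simp_all add: g1.emeasure_space_1)
    finally show ?thesis unfolding transport_cost_def .
  qed
  ultimately show ?thesis by blast
qed

text \<open>The slack e splits into thirds: one for each nearly optimal coupling, and one for the
  cells of \<open>couplings_glue\<close>.\<close>

lemma W1e_triangle:
  fixes p q r :: "'a::{second_countable_topology,metric_space} measure"
  shows "W1e p r \<le> W1e p q + W1e q r"
proof (rule ennreal_le_epsilon)
  fix e :: real assume fin: "W1e p q + W1e q r < top" and e: "0 < e"
  have "W1e p q < W1e p q + ennreal (e/3)" "W1e q r < W1e q r + ennreal (e/3)"
    using fin e by (auto simp: less_top[symmetric] ennreal_add_eq_top intro!: ennreal_add_left_cancel_less[of _ 0, THEN iffD2, simplified])
  then obtain g1 g2 where g: "g1 \<in> couplings p q" "transport_cost g1 < W1e p q + ennreal (e/3)"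
    "g2 \<in> couplings q r" "transport_cost g2 < W1e q r + ennreal (e/3)"
    unfolding W1e_def INF_less_iff by blast
  obtain g where g': "g \<in> couplings p r" "transport_cost g \<le> transport_cost g1 + ennreal (e/3) + transport_cost g2"
    using couplings_glue[OF g(1,3), of "e/3"] e by auto
  have "W1e p r \<le> transport_cost g" unfolding W1e_def by (rule INF_lower) fact
  also note g'(2)
  also have "transport_cost g1 + ennreal (e/3) + transport_cost g2
     \<le> (W1e p q + ennreal (e/3)) + ennreal (e/3) + (W1e q r + ennreal (e/3))"
    using g by (intro add_mono) auto
  also have "\<dots> = W1e p q + W1e q r + (ennreal (e/3) + ennreal (e/3) + ennreal (e/3))"
    by (simp add: ac_simps)
  also have "ennreal (e/3) + ennreal (e/3) + ennreal (e/3) = ennreal e"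
    using e by (simp add: ennreal_plus[symmetric] del: ennreal_plus)
  finally show "W1e p r \<le> W1e p q + W1e q r + ennreal e" .
qed

lemma W1_triangle:
  fixes p q r :: "'a::{second_countable_topology,metric_space} measure"
  assumes "W1e p q < \<infinity>" "W1e q r < \<infinity>"
  shows "W1 p r \<le> W1 p q + W1 q r"
  using W1e_triangle[of p r q] assms
  unfolding W1_conv_W1e
  by (subst enn2real_plus[symmetric]) (auto intro!: enn2real_mono)

lemma W1_le_of_coupling:
  assumes "g \<in> couplings p q" "transport_cost g \<le> ennreal c" "c \<ge> 0"
  shows "W1e p q \<le> ennreal c" "W1 p q \<le> c"
proof -
  show *: "W1e p q \<le> ennreal c"
    unfolding W1e_def using assms by (meson INF_lower2)
  show "W1 p q \<le> c"
    unfolding W1_conv_W1e using enn2real_mono[OF *] assms by simp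
qed

text \<open>The law of (x, T x) is a coupling with exactly this cost.\<close>

lemma W1e_distr_le_nn_integral:
  fixes p :: "'a::{second_countable_topology,metric_space} measure"
  assumes "prob_space p" and s[measurable_cong]: "sets p = sets borel"
    and T[measurable]: "T \<in> borel_measurable borel"
  shows "W1e p (distr p borel T) \<le> (\<integral>\<^sup>+x. ennreal (dist x (T x)) \<partial>p)"
proof -
  interpret prob_space p by fact
  have [measurable]: "(\<lambda>x. (x, T x)) \<in> p \<rightarrow>\<^sub>M borel"
    unfolding borel_prod[symmetric] by measurable
  define g where "g = distr p borel (\<lambda>x. (x, T x))"
  have "distr p borel (\<lambda>x. x) = p"
    by (rule distr_id2) (simp add: s)
  then have g: "g \<in> couplings p (distr p borel T)"
    unfolding g_def couplings_def
    by (auto simp: distr_distr comp_def borel_measurable_fst_prod borel_measurable_snd_prod intro!: prob_space_distr)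
  have "transport_cost g = (\<integral>\<^sup>+x. ennreal (dist x (T x)) \<partial>p)"
    unfolding g_def transport_cost_def
    by (subst nn_integral_distr) (auto simp: borel_measurable_dist_prod)
  then show ?thesis
    unfolding W1e_def using g by (metis INF_lower)
qed

lemma W1_distr_le:
  fixes p :: "'a::{second_countable_topology,metric_space} measure"
  assumes "prob_space p" "sets p = sets borel" "T \<in> borel_measurable borel"
    and "AE x in p. dist x (T x) \<le> c" "c \<ge> 0"
  shows "W1 p (distr p borel T) \<le> c"
proof -
  interpret prob_space p by fact
  have "W1e p (distr p borel T) \<le> (\<integral>\<^sup>+x. ennreal (dist x (T x)) \<partial>p)"
    by (rule W1e_distr_le_nn_integral[OF assms(1-3)])
  also have "\<dots> \<le> (\<integral>\<^sup>+x. ennreal c \<partial>p)"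
    using assms(4) by (intro nn_integral_mono_AE) (auto intro: ennreal_leI)
  also have "\<dots> = ennreal c" by (simp add: emeasure_space_1)
  finally show ?thesis
    unfolding W1_conv_W1e using enn2real_mono[of "W1e p (distr p borel T)" "ennreal c"] \<open>c \<ge> 0\<close> by simp
qed

section \<open>Greedy multiscale transport on a finite set\<close>

lemma sum_fiber_sum:
  assumes "finite G"
  shows "(\<Sum>Q\<in>c ` G. \<Sum>x\<in>{x\<in>G. c x = Q}. f x) = (\<Sum>x\<in>G. f x)"
  using sum.image_gen[OF assms, of f c] by simp

text \<open>Mass is matched greedily from the finest level upwards: inside each class of level
  \<open>J\<close> as much as possible is coupled, at cost \<open>D J\<close> per unit, and the rest
  is left to the coarser levels by induction. The total mass is arbitrary because the leftovers are
  not probability vectors.\<close>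

lemma multiscale_coupling:
  fixes cls :: "nat \<Rightarrow> 'a::metric_space \<Rightarrow> 'c" and u v :: "'a \<Rightarrow> real"
  assumes "finite G" "\<And>x. x \<in> G \<Longrightarrow> 0 \<le> u x" "\<And>x. x \<in> G \<Longrightarrow> 0 \<le> v x" "sum u G = sum v G"
    and one: "\<And>x y. x \<in> G \<Longrightarrow> y \<in> G \<Longrightarrow> cls 0 x = cls 0 y"
    and refine: "\<And>j x y. x \<in> G \<Longrightarrow> y \<in> G \<Longrightarrow> cls (Suc j) x = cls (Suc j) y \<Longrightarrow> cls j x = cls j y"
    and diam: "\<And>j x y. x \<in> G \<Longrightarrow> y \<in> G \<Longrightarrow> cls j x = cls j y \<Longrightarrow> dist x y \<le> D j"
    and D: "\<And>j. D j \<ge> 0"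
  shows "\<exists>\<gamma>. (\<forall>x\<in>G. \<forall>y\<in>G. (0::real) \<le> \<gamma> x y) \<and> (\<forall>x\<in>G. (\<Sum>y\<in>G. \<gamma> x y) = u x) \<and>
     (\<forall>y\<in>G. (\<Sum>x\<in>G. \<gamma> x y) = v y) \<and>
     (\<Sum>x\<in>G. \<Sum>y\<in>G. \<gamma> x y * dist x y) \<le> D J * sum u G
       + (\<Sum>j<J. D j * (\<Sum>Q\<in>cls (Suc j) ` G. \<bar>\<Sum>x\<in>{x\<in>G. cls (Suc j) x = Q}. (u x - v x)\<bar>))"
  using assms(2,3,4)
proof (induction J arbitrary: u v)
  case 0
  note G = \<open>finite G\<close>
  show ?case
  proof (cases "sum u G = 0")
    case True
    then have "\<forall>x\<in>G. u x = 0" "\<forall>x\<in>G. v x = 0"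
      using 0 G by (simp_all add: sum_nonneg_eq_0_iff)
    then show ?thesis
      by (intro exI[of _ "\<lambda>_ _. 0"]) (auto simp: True)
  next
    case False
    \<comment> \<open>There is a single class at level 0, so the normalised product coupling never
      moves mass further than \<open>D 0\<close>.\<close>
    let ?\<gamma> = "\<lambda>x y. u x * v y / sum u G"
    have pos: "sum u G > 0" using False 0 by (simp add: sum_nonneg less_le)
    have "(\<Sum>y\<in>G. ?\<gamma> x y) = u x" for x
      using False 0 by (simp add: sum_divide_distrib[symmetric] sum_distrib_left[symmetric])
    moreover have m2: "(\<Sum>x\<in>G. ?\<gamma> x y) = v y" for y
      using False by (simp add: sum_divide_distrib[symmetric] sum_distrib_right[symmetric])
    moreover have "(\<Sum>x\<in>G. \<Sum>y\<in>G. ?\<gamma> x y * dist x y) \<le> (\<Sum>x\<in>G. \<Sum>y\<in>G. ?\<gamma> x y * D 0)"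
      using 0 pos by (intro sum_mono mult_left_mono divide_nonneg_pos mult_nonneg_nonneg diam one) simp_all
    moreover have "(\<Sum>x\<in>G. \<Sum>y\<in>G. ?\<gamma> x y * D 0) = D 0 * sum u G"
      by (simp only: sum_distrib_right[symmetric] calculation(1)) (simp only: mult.commute)
    ultimately show ?thesis
      using 0 pos by (intro exI[of _ ?\<gamma>]) (auto intro!: divide_nonneg_pos mult_nonneg_nonneg)
  qed
next
  case (Suc J)
  note G = \<open>finite G\<close>
  define c where "c = cls (Suc J)"
  define F where "F Q = {x\<in>G. c x = Q}" for Q
  have F: "finite (F Q)" for Q using G by (simp add: F_def)
  define U where "U Q = sum u (F Q)" for Q
  define V where "V Q = sum v (F Q)" for Q
  have U0: "U Q \<ge> 0" and V0: "V Q \<ge> 0" for Q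
    using Suc.prems by (auto simp: U_def V_def F_def intro!: sum_nonneg)
  have uU: "u x \<le> U (c x)" and vV: "v x \<le> V (c x)" if "x \<in> G" for x
    using that Suc.prems G
    by (auto simp: U_def V_def F_def intro!: member_le_sum)
  \<comment> \<open>Dividing u x * v y by the larger of the two class masses leaves matched mass U V
    / max U V = min U V, the most that can stay inside the class. In a class with U = V = 0,
    division by zero gives 0, which is the right value.\<close>
  define X where "X Q = max (U Q) (V Q)" for Q
  have X0: "X Q \<ge> 0" for Q using U0 by (simp add: X_def le_max_iff_disj)
  define g0 where "g0 x y = (if c x = c y then u x * v y / X (c x) else 0)" for x y
  define u0 where "u0 x = u x * V (c x) / X (c x)" for x
  define v0 where "v0 y = v y * U (c y) / X (c y)" for y
  have g00: "g0 x y \<ge> 0" if "x \<in> G" "y \<in> G" for x y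
    using that Suc.prems X0 by (auto simp: g0_def)
  have m1: "(\<Sum>y\<in>G. g0 x y) = u0 x" for x
  proof -
    have "(\<Sum>y\<in>G. g0 x y) = (\<Sum>y\<in>F (c x). u x * v y / X (c x))"
      unfolding g0_def F_def using G by (intro sum.mono_neutral_cong_right) auto
    then show ?thesis by (simp add: u0_def V_def sum_distrib_left sum_divide_distrib)
  qed
  have m2: "(\<Sum>x\<in>G. g0 x y) = v0 y" for y
  proof -
    have "(\<Sum>x\<in>G. g0 x y) = (\<Sum>x\<in>F (c y). u x * v y / X (c y))"
      unfolding g0_def F_def using G by (intro sum.mono_neutral_cong_right) auto
    then show ?thesis by (simp add: v0_def U_def sum_distrib_left sum_divide_distrib mult.commute)
  qed
  have u0: "u0 x \<ge> 0" "u0 x \<le> u x" if "x \<in> G" for x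
  proof -
    show "u0 x \<ge> 0" using that Suc.prems V0 X0 by (simp add: u0_def)
    have "V (c x) / X (c x) \<le> 1"
      using X0[of "c x"] V0[of "c x"] by (auto simp: X_def divide_le_eq_1)
    then show "u0 x \<le> u x"
      using mult_left_mono[of "V (c x) / X (c x)" 1 "u x"] that Suc.prems by (simp add: u0_def)
  qed
  have v0: "v0 x \<ge> 0" "v0 x \<le> v x" if "x \<in> G" for x
  proof -
    show "v0 x \<ge> 0" using that Suc.prems U0 X0 by (simp add: v0_def)
    have "U (c x) / X (c x) \<le> 1"
      using X0[of "c x"] U0[of "c x"] by (auto simp: X_def divide_le_eq_1)
    then show "v0 x \<le> v x"
      using mult_left_mono[of "U (c x) / X (c x)" 1 "v x"] that Suc.prems by (simp add: v0_def)
  qed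
  have fu: "sum u0 (F Q) = min (U Q) (V Q)" for Q
  proof -
    have "sum u0 (F Q) = (\<Sum>x\<in>F Q. u x * (V Q / X Q))"
      by (intro sum.cong) (auto simp: u0_def F_def)
    also have "\<dots> = U Q * V Q / X Q" by (simp only: U_def sum_distrib_right[symmetric]) simp
    also have "\<dots> = min (U Q) (V Q)"
      using U0[of Q] V0[of Q] by (auto simp: X_def max_def min_def)
    finally show ?thesis .
  qed
  have fv: "sum v0 (F Q) = min (U Q) (V Q)" for Q
  proof -
    have "sum v0 (F Q) = (\<Sum>x\<in>F Q. v x * (U Q / X Q))"
      by (intro sum.cong) (auto simp: v0_def F_def)
    also have "\<dots> = U Q * V Q / X Q" by (simp only: V_def sum_distrib_right[symmetric]) simp
    also have "\<dots> = min (U Q) (V Q)"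
      using U0[of Q] V0[of Q] by (auto simp: X_def max_def min_def)
    finally show ?thesis .
  qed
  have refine': "cls j x = cls j y" if "j \<le> Suc J" "c x = c y" "x \<in> G" "y \<in> G" for j x y
    using that(1)
  proof (induction rule: inc_induct)
    case base then show ?case using that by (simp add: c_def)
  next
    case (step n) then show ?case using refine that by blast
  qed
  \<comment> \<open>Both marginals of \<open>g0\<close> have mass min U V in every finest class, and
    a class of a coarser level is a union of finest ones. So the leftovers have the same deviations
    as \<open>u\<close> and \<open>v\<close> at every level that occurs in the induction
    hypothesis.\<close>
  have coarse: "(\<Sum>x\<in>{x\<in>G. cls j x = R}. u0 x - v0 x) = 0" if "j \<le> Suc J" for j R
  proof -
    define H where "H = {x\<in>G. cls j x = R}"
    have "finite H" using G by (simp add: H_def)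
    then have "(\<Sum>x\<in>H. u0 x - v0 x) = (\<Sum>Q\<in>c`H. \<Sum>x\<in>{x\<in>H. c x = Q}. u0 x - v0 x)"
      by (simp add: sum_fiber_sum)
    also have "\<dots> = (\<Sum>Q\<in>c`H. \<Sum>x\<in>F Q. u0 x - v0 x)"
    proof (intro sum.cong refl)
      fix Q assume "Q \<in> c ` H"
      then obtain y where y: "y \<in> G" "cls j y = R" "c y = Q" by (auto simp: H_def)
      show "{x \<in> H. c x = Q} = F Q"
        using y refine'[OF that] by (auto simp: H_def F_def)
    qed
    also have "\<dots> = 0" by (simp add: sum_subtractf fu fv)
    finally show ?thesis by (simp add: H_def)
  qed
  have tot: "sum u0 G = sum v0 G"
    using sum_fiber_sum[OF G, of u0 c] sum_fiber_sum[OF G, of v0 c] fu fv by (simp add: F_def)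
  define u1 where "u1 x = u x - u0 x" for x
  define v1 where "v1 x = v x - v0 x" for x
  have "sum u1 G = sum v1 G"
    using tot Suc.prems by (simp add: u1_def v1_def sum_subtractf)
  with u0 v0 obtain g1 where g1: "\<forall>x\<in>G. \<forall>y\<in>G. 0 \<le> g1 x y" "\<forall>x\<in>G. (\<Sum>y\<in>G. g1 x y) = u1 x"
     "\<forall>y\<in>G. (\<Sum>x\<in>G. g1 x y) = v1 y"
     "(\<Sum>x\<in>G. \<Sum>y\<in>G. g1 x y * dist x y) \<le> D J * sum u1 G
       + (\<Sum>j<J. D j * (\<Sum>Q\<in>cls (Suc j) ` G. \<bar>\<Sum>x\<in>{x\<in>G. cls (Suc j) x = Q}. (u1 x - v1 x)\<bar>))"
    using Suc.IH[of u1 v1] by (auto simp: u1_def v1_def)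
  have same: "(\<Sum>x\<in>{x\<in>G. cls (Suc j) x = Q}. (u1 x - v1 x)) = (\<Sum>x\<in>{x\<in>G. cls (Suc j) x = Q}. (u x - v x))"
    if "j < J" for j Q
    using coarse[of "Suc j" Q] that by (simp add: u1_def v1_def sum_subtractf)
  \<comment> \<open>The leftover of a class is U - min U V, which is at most |U - V|. It is charged
    at the next coarser diameter \<open>D J\<close>, and this creates the summand with index
    \<open>J\<close>.\<close>
  have mass: "sum u1 G \<le> (\<Sum>Q\<in>c ` G. \<bar>\<Sum>x\<in>{x\<in>G. c x = Q}. (u x - v x)\<bar>)"
  proof -
    have "sum u1 G = (\<Sum>Q\<in>c ` G. \<Sum>x\<in>F Q. u1 x)"
      unfolding F_def using sum_fiber_sum[OF G, of u1 c] by simp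
    also have "\<dots> = (\<Sum>Q\<in>c ` G. U Q - min (U Q) (V Q))"
      by (simp add: u1_def sum_subtractf fu U_def)
    also have "\<dots> \<le> (\<Sum>Q\<in>c ` G. \<bar>U Q - V Q\<bar>)"
      by (intro sum_mono) auto
    finally show ?thesis by (simp add: U_def V_def F_def sum_subtractf)
  qed
  have c0: "(\<Sum>x\<in>G. \<Sum>y\<in>G. g0 x y * dist x y) \<le> D (Suc J) * sum u G"
  proof -
    have "(\<Sum>x\<in>G. \<Sum>y\<in>G. g0 x y * dist x y) \<le> (\<Sum>x\<in>G. \<Sum>y\<in>G. g0 x y * D (Suc J))"
    proof (intro sum_mono)
      fix x y assume "x \<in> G" "y \<in> G"
      then show "g0 x y * dist x y \<le> g0 x y * D (Suc J)"
        using g00[of x y] diam[of x y "Suc J"]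
        by (cases "c x = c y") (simp add: c_def mult_left_mono, simp add: g0_def)
    qed
    also have "\<dots> = D (Suc J) * sum u0 G"
      by (simp only: sum_distrib_right[symmetric] m1) (simp only: mult.commute)
    also have "\<dots> \<le> D (Suc J) * sum u G"
      using u0 D by (intro mult_left_mono sum_mono) auto
    finally show ?thesis .
  qed
  have "(\<Sum>x\<in>G. \<Sum>y\<in>G. (g0 x y + g1 x y) * dist x y)
     \<le> D (Suc J) * sum u G + (D J * sum u1 G
       + (\<Sum>j<J. D j * (\<Sum>Q\<in>cls (Suc j) ` G. \<bar>\<Sum>x\<in>{x\<in>G. cls (Suc j) x = Q}. (u x - v x)\<bar>)))"
    using c0 g1(4) same by (simp add: distrib_right sum.distrib)
  also have "\<dots> \<le> D (Suc J) * sum u G 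
       + (\<Sum>j<Suc J. D j * (\<Sum>Q\<in>cls (Suc j) ` G. \<bar>\<Sum>x\<in>{x\<in>G. cls (Suc j) x = Q}. (u x - v x)\<bar>))"
    using mult_left_mono[OF mass D[of J]] by (simp add: c_def)
  finally show ?case
    using g00 g1 m1 m2
    by (intro exI[of _ "\<lambda>x y. g0 x y + g1 x y"]) (auto simp: sum.distrib u1_def v1_def)
qed

section \<open>Finitely supported measures and finite transport problems\<close>

text \<open>\<open>point_measure\<close> carries the power set of \<open>G\<close> as its
  sigma-algebra; the push-forward to \<open>borel\<close> puts it among the measures that
  \<open>couplings\<close> speaks of. Negative values of \<open>u\<close> are cut off at 0 by
  \<open>ennreal\<close>.\<close>

definition atomic_measure :: "'a set \<Rightarrow> ('a \<Rightarrow> real) \<Rightarrow> 'a::topological_space measure" where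
  "atomic_measure G u = distr (point_measure G (\<lambda>x. ennreal (u x))) borel (\<lambda>x. x)"

lemma sets_atomic_measure [measurable_cong, simp]: "sets (atomic_measure G u) = sets borel"
  and space_atomic_measure [simp]: "space (atomic_measure G u) = UNIV"
  by (simp_all add: atomic_measure_def)

lemma measurable_atomic_measure [simp]: "measurable (atomic_measure G u) N = measurable borel N"
  by (rule measurable_cong_sets) simp_all

lemma nn_integral_atomic_measure:
  assumes "finite G" "f \<in> borel_measurable borel"
  shows "(\<integral>\<^sup>+x. f x \<partial>atomic_measure G u) = (\<Sum>a\<in>G. ennreal (u a) * f a)"
  using assms unfolding atomic_measure_def
  by (subst nn_integral_distr) (auto simp: nn_integral_point_measure_finite)

lemma emeasure_atomic_measure:
  assumes "finite G" "A \<in> sets borel" "\<And>a. a \<in> G \<Longrightarrow> u a \<ge> 0"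
  shows "emeasure (atomic_measure G u) A = ennreal (\<Sum>a\<in>{a\<in>G. a \<in> A}. u a)"
proof -
  have "emeasure (atomic_measure G u) A = (\<integral>\<^sup>+x. indicator A x \<partial>atomic_measure G u)"
    using assms by simp
  also have "\<dots> = (\<Sum>a\<in>G. ennreal (u a) * indicator A a)"
    using assms by (intro nn_integral_atomic_measure) auto
  also have "\<dots> = (\<Sum>a\<in>{a\<in>G. a \<in> A}. ennreal (u a))"
    using assms by (intro sum.mono_neutral_cong_right) (auto simp: indicator_def)
  also have "\<dots> = ennreal (\<Sum>a\<in>{a\<in>G. a \<in> A}. u a)"
    using assms by (intro sum_ennreal) auto
  finally show ?thesis .
qed

lemma measure_atomic_measure:
  assumes "finite G" "A \<in> sets borel" "\<And>a. a \<in> G \<Longrightarrow> u a \<ge> 0"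
  shows "measure (atomic_measure G u) A = (\<Sum>a\<in>{a\<in>G. a \<in> A}. u a)"
proof -
  have "(\<Sum>a\<in>{a\<in>G. a \<in> A}. u a) \<ge> 0" using assms by (intro sum_nonneg) auto
  then show ?thesis
    using emeasure_atomic_measure[where u=u, OF assms(1,2)] assms(3) by (simp add: measure_def)
qed

lemma prob_space_atomic_measure:
  assumes "finite G" "\<And>a. a \<in> G \<Longrightarrow> u a \<ge> 0" "sum u G = 1"
  shows "prob_space (atomic_measure G u)"
  using emeasure_atomic_measure[OF assms(1) _ assms(2), of UNIV] assms(3)
  by (intro prob_spaceI) simp

lemma atomic_measure_cong:
  assumes "finite G" "\<And>a. a \<in> G \<Longrightarrow> u a = v a"
  shows "atomic_measure G u = atomic_measure G v"
proof -
  have "point_measure G (\<lambda>x. ennreal (u x)) = point_measure G (\<lambda>x. ennreal (v x))"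
    unfolding point_measure_def using assms by (intro density_cong) auto
  then show ?thesis by (simp add: atomic_measure_def)
qed

lemma eq_atomic_measureI:
  fixes M :: "'a::t1_space measure"
  assumes "prob_space M" "sets M = sets borel" "finite G" "measure M G = 1"
    and u: "\<And>a. a \<in> G \<Longrightarrow> measure M {a} = u a"
  shows "M = atomic_measure G u"
proof (rule measure_eqI)
  interpret prob_space M by fact
  have u0: "u a \<ge> 0" if "a \<in> G" for a using u[OF that, symmetric] by simp
  have fin: "F \<in> sets M" if "finite F" for F
    using that assms(2) by (simp add: finite_imp_closed borel_closed)
  fix A assume A: "A \<in> sets M"
  have "AE x in M. x \<in> G"
    using assms fin by (subst prob_eq_1[symmetric]) auto
  then have "emeasure M A = emeasure M {a\<in>G. a \<in> A}"
    using A fin assms(3) by (intro emeasure_eq_AE) auto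
  also have "\<dots> = ennreal (\<Sum>a\<in>{a\<in>G. a \<in> A}. u a)"
  proof -
    have "measure M {a\<in>G. a \<in> A} = (\<Sum>a\<in>{a\<in>G. a \<in> A}. measure M {a})"
      using assms(3) fin by (intro measure_eq_sum_singleton) (auto simp: emeasure_eq_measure)
    then show ?thesis using u by (simp add: emeasure_eq_measure)
  qed
  also have "\<dots> = emeasure (atomic_measure G u) A"
    using A assms u0 by (subst emeasure_atomic_measure) auto
  finally show "emeasure M A = emeasure (atomic_measure G u) A" .
qed (use assms in auto)

text \<open>A matrix with row sums \<open>u\<close> and column sums \<open>v\<close> is itself a
  coupling, placed on the points of \<open>G\<close> x \<open>G\<close>. Together with
  \<open>W1_atomic_coupling\<close> this reduces \<open>W1\<close> on a finite set to transport
  matrices.\<close>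

lemma W1_atomic_le:
  fixes G :: "'a::{second_countable_topology,metric_space} set"
  assumes G: "finite G" and \<gamma>: "\<And>x y. x \<in> G \<Longrightarrow> y \<in> G \<Longrightarrow> (0::real) \<le> \<gamma> x y"
    and u: "\<And>x. x \<in> G \<Longrightarrow> (\<Sum>y\<in>G. \<gamma> x y) = u x" and v: "\<And>y. y \<in> G \<Longrightarrow> (\<Sum>x\<in>G. \<gamma> x y) = v y"
    and u1: "sum u G = 1"
  defines "c \<equiv> (\<Sum>x\<in>G. \<Sum>y\<in>G. \<gamma> x y * dist x y)"
  shows "W1e (atomic_measure G u) (atomic_measure G v) \<le> ennreal c"
    and "W1 (atomic_measure G u) (atomic_measure G v) \<le> c"
proof -
  define g where "g = atomic_measure (G \<times> G) (\<lambda>(x, y). \<gamma> x y)"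
  have f: "finite (G \<times> G)" using G by simp
  have u0: "u x \<ge> 0" if "x \<in> G" for x using that u[OF that, symmetric] \<gamma> by (simp add: sum_nonneg)
  have v0: "v x \<ge> 0" if "x \<in> G" for x using that v[OF that, symmetric] \<gamma> by (simp add: sum_nonneg)
  have "(\<Sum>z\<in>G\<times>G. case z of (x, y) \<Rightarrow> \<gamma> x y) = 1"
    using u u1 by (simp add: sum.cartesian_product[symmetric])
  then have pg: "prob_space g"
    unfolding g_def using \<gamma> f by (intro prob_space_atomic_measure) auto
  have d1: "distr g borel fst = atomic_measure G u"
  proof (rule measure_eqI)
    fix A assume "A \<in> sets (distr g borel fst)"
    then have A: "A \<in> sets borel" by simp
    have "emeasure (distr g borel fst) A = emeasure g (fst -` A)"
      unfolding g_def using A borel_measurable_fst_prod by (subst emeasure_distr) auto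
    also have "\<dots> = ennreal (\<Sum>z\<in>{z\<in>G\<times>G. z \<in> fst -` A}. case z of (x, y) \<Rightarrow> \<gamma> x y)"
      unfolding g_def using \<gamma> f measurable_sets[OF borel_measurable_fst_prod A] by (subst emeasure_atomic_measure) auto
    also have "{z\<in>G\<times>G. z \<in> fst -` A} = {x\<in>G. x \<in> A} \<times> G" by auto
    also have "(\<Sum>z\<in>{x\<in>G. x \<in> A} \<times> G. case z of (x, y) \<Rightarrow> \<gamma> x y) = (\<Sum>x\<in>{x\<in>G. x \<in> A}. u x)"
      by (simp add: sum.cartesian_product[symmetric] u)
    also have "ennreal \<dots> = emeasure (atomic_measure G u) A"
      using G A u0 by (subst emeasure_atomic_measure) auto
    finally show "emeasure (distr g borel fst) A = emeasure (atomic_measure G u) A" .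
  qed simp
  have d2: "distr g borel snd = atomic_measure G v"
  proof (rule measure_eqI)
    fix A assume "A \<in> sets (distr g borel snd)"
    then have A: "A \<in> sets borel" by simp
    have "emeasure (distr g borel snd) A = emeasure g (snd -` A)"
      unfolding g_def using A borel_measurable_snd_prod by (subst emeasure_distr) auto
    also have "\<dots> = ennreal (\<Sum>z\<in>{z\<in>G\<times>G. z \<in> snd -` A}. case z of (x, y) \<Rightarrow> \<gamma> x y)"
      unfolding g_def using \<gamma> f measurable_sets[OF borel_measurable_snd_prod A] by (subst emeasure_atomic_measure) auto
    also have "{z\<in>G\<times>G. z \<in> snd -` A} = G \<times> {x\<in>G. x \<in> A}" by auto
    also have "(\<Sum>z\<in>G \<times> {x\<in>G. x \<in> A}. case z of (x, y) \<Rightarrow> \<gamma> x y) = (\<Sum>x\<in>{x\<in>G. x \<in> A}. v x)"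
      by (subst sum.cartesian_product[symmetric], subst sum.swap) (simp add: v)
    also have "ennreal \<dots> = emeasure (atomic_measure G v) A"
      using G A v0 by (subst emeasure_atomic_measure) auto
    finally show "emeasure (distr g borel snd) A = emeasure (atomic_measure G v) A" .
  qed simp
  have gc: "g \<in> couplings (atomic_measure G u) (atomic_measure G v)"
    using pg d1 d2 by (simp add: couplings_def g_def)
  have "transport_cost g = (\<Sum>z\<in>G\<times>G. ennreal (case z of (x, y) \<Rightarrow> \<gamma> x y) * ennreal (dist (fst z) (snd z)))"
    unfolding transport_cost_def g_def using f borel_measurable_dist_prod
    by (intro nn_integral_atomic_measure) auto
  also have "\<dots> = (\<Sum>z\<in>G\<times>G. ennreal (case z of (x, y) \<Rightarrow> \<gamma> x y * dist x y))"
    using \<gamma> by (intro sum.cong) (auto simp: ennreal_mult)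
  also have "\<dots> = ennreal c"
    unfolding c_def using \<gamma> by (subst sum_ennreal) (auto simp: sum.cartesian_product)
  finally have cost: "transport_cost g \<le> ennreal c" by simp
  have "c \<ge> 0" unfolding c_def using \<gamma> by (intro sum_nonneg mult_nonneg_nonneg) auto
  from W1_le_of_coupling[OF gc cost this]
  show "W1e (atomic_measure G u) (atomic_measure G v) \<le> ennreal c"
    and "W1 (atomic_measure G u) (atomic_measure G v) \<le> c" by auto
qed

lemma W1e_atomic_finite:
  fixes G :: "'a::{second_countable_topology,metric_space} set"
  assumes G: "finite G" and u: "\<And>x. x \<in> G \<Longrightarrow> u x \<ge> 0" "sum u G = 1"
    and v: "\<And>x. x \<in> G \<Longrightarrow> v x \<ge> 0" "sum v G = 1"
  shows "W1e (atomic_measure G u) (atomic_measure G v) < \<infinity>"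
proof -
  have "W1e (atomic_measure G u) (atomic_measure G v)
      \<le> ennreal (\<Sum>x\<in>G. \<Sum>y\<in>G. (u x * v y) * dist x y)"
    using assms by (intro W1_atomic_le) (auto simp: sum_distrib_left[symmetric] sum_distrib_right[symmetric])
  then show ?thesis by (rule order.strict_trans1) simp
qed

text \<open>A coupling of two measures carried by \<open>G\<close> is carried by \<open>G\<close> x
  \<open>G\<close>, so its point masses form the required matrix. The strict bound \<open>r\<close>
  yields a coupling directly from the infimum, attained or not.\<close>

lemma W1_atomic_coupling:
  fixes G :: "'a::{second_countable_topology,metric_space} set"
  assumes G: "finite G" and u: "\<And>x. x \<in> G \<Longrightarrow> u x \<ge> 0" "sum u G = 1"
    and v: "\<And>x. x \<in> G \<Longrightarrow> v x \<ge> 0" "sum v G = 1"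
    and r: "W1 (atomic_measure G u) (atomic_measure G v) < r"
  shows "\<exists>\<gamma>. (\<forall>x\<in>G. \<forall>y\<in>G. (0::real) \<le> \<gamma> x y) \<and> (\<forall>x\<in>G. (\<Sum>y\<in>G. \<gamma> x y) = u x) \<and>
     (\<forall>y\<in>G. (\<Sum>x\<in>G. \<gamma> x y) = v y) \<and> (\<Sum>x\<in>G. \<Sum>y\<in>G. \<gamma> x y * dist x y) \<le> r"
proof -
  have fin: "W1e (atomic_measure G u) (atomic_measure G v) < \<infinity>"
    by (rule W1e_atomic_finite[OF assms(1-5)])
  have r0: "r > 0" using W1_nonneg r by (rule order.strict_trans1)
  have "W1e (atomic_measure G u) (atomic_measure G v) < ennreal r"
    using r fin r0 unfolding W1_conv_W1e
    by (metis enn2real_nonneg ennreal_enn2real ennreal_lessI infinity_ennreal_def)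
  then obtain g where g: "g \<in> couplings (atomic_measure G u) (atomic_measure G v)" "transport_cost g < ennreal r"
    unfolding W1e_def INF_less_iff by blast
  then have pg: "prob_space g" and sg: "sets g = sets borel"
    and d1: "distr g borel fst = atomic_measure G u" and d2: "distr g borel snd = atomic_measure G v"
    unfolding couplings_def by blast+
  interpret g: prob_space g by fact
  have spg: "space g = UNIV" using sets_eq_imp_space_eq[OF sg] by simp
  have m: "fst \<in> g \<rightarrow>\<^sub>M borel" "snd \<in> g \<rightarrow>\<^sub>M borel"
    using borel_measurable_fst_prod borel_measurable_snd_prod measurable_cong_sets[OF sg refl] by blast+
  have fin_sets: "S \<in> sets g" if "finite S" for S
    using that unfolding sg by (simp add: finite_imp_closed borel_closed)
  have finb: "S \<in> sets borel" if "finite S" for S :: "'a set"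
    using that by (simp add: finite_imp_closed borel_closed)
  have f1: "measure g (fst -` A) = (\<Sum>a\<in>{a\<in>G. a \<in> A}. u a)" if "A \<in> sets borel" for A
    using measure_distr[OF m(1) that] G that u unfolding d1 by (simp add: spg measure_atomic_measure)
  have f2: "measure g (snd -` A) = (\<Sum>a\<in>{a\<in>G. a \<in> A}. v a)" if "A \<in> sets borel" for A
    using measure_distr[OF m(2) that] G that v unfolding d2 by (simp add: spg measure_atomic_measure)
  have s1: "fst -` A \<in> sets g" "snd -` A \<in> sets g" if "A \<in> sets borel" for A
    using measurable_sets[OF m(1) that] measurable_sets[OF m(2) that] by (auto simp: spg)
  have AE1: "AE z in g. fst z \<in> G"
  proof -
    have "measure g (fst -` G) = 1" using f1[OF finb[OF G]] u by simp
    then show ?thesis using g.prob_eq_1[OF s1(1)[OF finb[OF G]]] by simp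
  qed
  have AE2: "AE z in g. snd z \<in> G"
  proof -
    have "measure g (snd -` G) = 1" using f2[OF finb[OF G]] v by simp
    then show ?thesis using g.prob_eq_1[OF s1(2)[OF finb[OF G]]] by simp
  qed
  define \<gamma> where "\<gamma> x y = measure g {(x, y)}" for x y
  have mu: "(\<Sum>y\<in>G. \<gamma> x y) = u x" if "x \<in> G" for x
  proof -
    have "(\<Sum>y\<in>G. \<gamma> x y) = (\<Sum>z\<in>{x}\<times>G. measure g {z})"
      unfolding \<gamma>_def by (rule sum.reindex_bij_witness[of _ snd "\<lambda>y. (x, y)"]) auto
    also have "\<dots> = measure g ({x} \<times> G)"
      using G fin_sets by (intro g.finite_measure_eq_sum_singleton[symmetric]) auto
    also have "\<dots> = measure g (fst -` {x})"
      using AE2 G fin_sets s1(1)[of "{x}"] by (intro g.finite_measure_eq_AE) auto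
    also have "\<dots> = u x"
      using that by (subst f1) (auto intro!: sum.cong arg_cong2[where f=sum] simp: Collect_conv_if)
    finally show ?thesis .
  qed
  have mv: "(\<Sum>x\<in>G. \<gamma> x y) = v y" if "y \<in> G" for y
  proof -
    have "(\<Sum>x\<in>G. \<gamma> x y) = (\<Sum>z\<in>G\<times>{y}. measure g {z})"
      unfolding \<gamma>_def by (rule sum.reindex_bij_witness[of _ fst "\<lambda>x. (x, y)"]) auto
    also have "\<dots> = measure g (G \<times> {y})"
      using G fin_sets by (intro g.finite_measure_eq_sum_singleton[symmetric]) auto
    also have "\<dots> = measure g (snd -` {y})"
      using AE1 G fin_sets s1(2)[of "{y}"] by (intro g.finite_measure_eq_AE) auto
    also have "\<dots> = v y"
      using that by (subst f2) (auto intro!: sum.cong arg_cong2[where f=sum] simp: Collect_conv_if)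
    finally show ?thesis .
  qed
  have "ennreal (\<Sum>x\<in>G. \<Sum>y\<in>G. \<gamma> x y * dist x y) = (\<Sum>z\<in>G\<times>G. ennreal (dist (fst z) (snd z)) * emeasure g {z})"
    unfolding \<gamma>_def sum.cartesian_product
    by (subst sum_ennreal[symmetric]) (auto intro!: sum.cong simp: g.emeasure_eq_measure ennreal_mult mult.commute)
  also have "\<dots> = (\<integral>\<^sup>+ w. (\<Sum>z\<in>G\<times>G. ennreal (dist (fst z) (snd z)) * indicator {z} w) \<partial>g)"
    using fin_sets by (subst nn_integral_sum) (auto simp: nn_integral_cmult_indicator)
  also have "\<dots> \<le> transport_cost g"
    unfolding transport_cost_def
  proof (rule nn_integral_mono)
    fix w
    have "(\<Sum>z\<in>G\<times>G. ennreal (dist (fst z) (snd z)) * indicator {z} w)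
       = (\<Sum>z\<in>{z\<in>G\<times>G. z = w}. ennreal (dist (fst w) (snd w)))"
      using G by (intro sum.mono_neutral_cong_right) (auto simp: indicator_def)
    also have "\<dots> \<le> ennreal (dist (fst w) (snd w))"
      by (cases "w \<in> G \<times> G") (auto simp: Collect_conv_if simp del: mem_Times_iff)
    finally show "(\<Sum>z\<in>G\<times>G. ennreal (dist (fst z) (snd z)) * indicator {z} w) \<le> ennreal (dist (fst w) (snd w))" .
  qed
  also have "\<dots> \<le> ennreal r" using g by simp
  finally have "(\<Sum>x\<in>G. \<Sum>y\<in>G. \<gamma> x y * dist x y) \<le> r" using r0 by simp
  then show ?thesis using mu mv by (intro exI[of _ \<gamma>]) (auto simp: \<gamma>_def)
qed

text \<open>Nearly optimal matrices for the individual \<open>v k\<close> are averaged with the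
  weights \<open>c k\<close>. All of them have row sums \<open>u\<close>, hence so does the average,
  and the cost is linear in the matrix.\<close>

lemma W1_atomic_convex:
  fixes G :: "'a::{second_countable_topology,metric_space} set"
  assumes G: "finite G" and K: "finite K" and u: "\<And>x. x \<in> G \<Longrightarrow> u x \<ge> 0" "sum u G = 1"
    and v: "\<And>k x. k \<in> K \<Longrightarrow> x \<in> G \<Longrightarrow> v k x \<ge> 0" "\<And>k. k \<in> K \<Longrightarrow> sum (v k) G = 1"
    and c: "\<And>k. k \<in> K \<Longrightarrow> c k \<ge> 0" "sum c K = 1"
    and r: "\<And>k. k \<in> K \<Longrightarrow> W1 (atomic_measure G u) (atomic_measure G (v k)) \<le> r"
  shows "W1 (atomic_measure G u) (atomic_measure G (\<lambda>x. \<Sum>k\<in>K. c k * v k x)) \<le> r"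
proof (rule field_le_epsilon)
  fix e :: real assume e: "e > 0"
  have lt: "W1 (atomic_measure G u) (atomic_measure G (v k)) < r + e" if "k \<in> K" for k
    using r[OF that] e by linarith
  have "\<forall>k\<in>K. \<exists>\<gamma>. (\<forall>x\<in>G. \<forall>y\<in>G. (0::real) \<le> \<gamma> x y) \<and> (\<forall>x\<in>G. (\<Sum>y\<in>G. \<gamma> x y) = u x) \<and>
     (\<forall>y\<in>G. (\<Sum>x\<in>G. \<gamma> x y) = v k y) \<and> (\<Sum>x\<in>G. \<Sum>y\<in>G. \<gamma> x y * dist x y) \<le> r + e"
    using u v lt by (intro ballI W1_atomic_coupling G) auto
  from bchoice[OF this] obtain \<gamma> where \<gamma>0: "\<forall>k\<in>K. (\<forall>x\<in>G. \<forall>y\<in>G. (0::real) \<le> \<gamma> k x y) \<and>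
     (\<forall>x\<in>G. (\<Sum>y\<in>G. \<gamma> k x y) = u x) \<and>
     (\<forall>y\<in>G. (\<Sum>x\<in>G. \<gamma> k x y) = v k y) \<and> (\<Sum>x\<in>G. \<Sum>y\<in>G. \<gamma> k x y * dist x y) \<le> r + e" ..
  then have \<gamma>: "\<And>k x y. k \<in> K \<Longrightarrow> x \<in> G \<Longrightarrow> y \<in> G \<Longrightarrow> (0::real) \<le> \<gamma> k x y"
     "\<And>k x. k \<in> K \<Longrightarrow> x \<in> G \<Longrightarrow> (\<Sum>y\<in>G. \<gamma> k x y) = u x"
     "\<And>k y. k \<in> K \<Longrightarrow> y \<in> G \<Longrightarrow> (\<Sum>x\<in>G. \<gamma> k x y) = v k y"
     "\<And>k. k \<in> K \<Longrightarrow> (\<Sum>x\<in>G. \<Sum>y\<in>G. \<gamma> k x y * dist x y) \<le> r + e"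
    by blast+
  have sw: "(\<Sum>y\<in>G. \<Sum>k\<in>K. c k * f k y) = (\<Sum>k\<in>K. c k * (\<Sum>y\<in>G. f k y))" for f :: "_ \<Rightarrow> 'a \<Rightarrow> real"
    by (subst sum.swap) (simp add: sum_distrib_left)
  have "W1 (atomic_measure G u) (atomic_measure G (\<lambda>x. \<Sum>k\<in>K. c k * v k x))
      \<le> (\<Sum>x\<in>G. \<Sum>y\<in>G. (\<Sum>k\<in>K. c k * \<gamma> k x y) * dist x y)"
  proof (rule W1_atomic_le(2)[OF G])
    show "(\<Sum>y\<in>G. \<Sum>k\<in>K. c k * \<gamma> k x y) = u x" if "x \<in> G" for x
      using that \<gamma>(2) c(2) by (simp add: sw sum_distrib_right[symmetric])
    show "(\<Sum>x\<in>G. \<Sum>k\<in>K. c k * \<gamma> k x y) = (\<Sum>k\<in>K. c k * v k y)" if "y \<in> G" for y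
      using that \<gamma>(3) by (simp add: sw)
  qed (use \<gamma> c u in \<open>auto intro!: sum_nonneg\<close>)
  also have "\<dots> = (\<Sum>x\<in>G. \<Sum>k\<in>K. c k * (\<Sum>y\<in>G. \<gamma> k x y * dist x y))"
    by (simp add: sum_distrib_right mult.assoc sw)
  also have "\<dots> = (\<Sum>k\<in>K. c k * (\<Sum>x\<in>G. \<Sum>y\<in>G. \<gamma> k x y * dist x y))" by (rule sw)
  also have "\<dots> \<le> (\<Sum>k\<in>K. c k * (r + e))"
    using \<gamma>(4) c by (intro sum_mono mult_left_mono) auto
  also have "\<dots> = r + e" using c by (simp add: sum_distrib_right[symmetric])
  finally show "W1 (atomic_measure G u) (atomic_measure G (\<lambda>x. \<Sum>k\<in>K. c k * v k x)) \<le> r + e" .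
qed

lemma W1_atomic_multiscale:
  fixes cls :: "nat \<Rightarrow> 'a::{second_countable_topology,metric_space} \<Rightarrow> 'c" and u v :: "'a \<Rightarrow> real"
  assumes "finite G" "\<And>x. x \<in> G \<Longrightarrow> 0 \<le> u x" "\<And>x. x \<in> G \<Longrightarrow> 0 \<le> v x" "sum u G = 1" "sum v G = 1"
    and one: "\<And>x y. x \<in> G \<Longrightarrow> y \<in> G \<Longrightarrow> cls 0 x = cls 0 y"
    and refine: "\<And>j x y. x \<in> G \<Longrightarrow> y \<in> G \<Longrightarrow> cls (Suc j) x = cls (Suc j) y \<Longrightarrow> cls j x = cls j y"
    and diam: "\<And>j x y. x \<in> G \<Longrightarrow> y \<in> G \<Longrightarrow> cls j x = cls j y \<Longrightarrow> dist x y \<le> D j"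
    and D: "\<And>j. D j \<ge> 0"
  shows "W1 (atomic_measure G u) (atomic_measure G v) \<le> D J
       + (\<Sum>j<J. D j * (\<Sum>Q\<in>cls (Suc j) ` G. \<bar>\<Sum>x\<in>{x\<in>G. cls (Suc j) x = Q}. (u x - v x)\<bar>))"
proof -
  have "sum u G = sum v G" using assms(4,5) by simp
  from multiscale_coupling[where cls=cls and D=D and J=J, OF assms(1-3) this one refine diam D]
  obtain \<gamma> where \<gamma>: "\<forall>x\<in>G. \<forall>y\<in>G. (0::real) \<le> \<gamma> x y" "\<forall>x\<in>G. (\<Sum>y\<in>G. \<gamma> x y) = u x"
     "\<forall>y\<in>G. (\<Sum>x\<in>G. \<gamma> x y) = v y"
     "(\<Sum>x\<in>G. \<Sum>y\<in>G. \<gamma> x y * dist x y) \<le> D J * sum u G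
       + (\<Sum>j<J. D j * (\<Sum>Q\<in>cls (Suc j) ` G. \<bar>\<Sum>x\<in>{x\<in>G. cls (Suc j) x = Q}. (u x - v x)\<bar>))"
    by blast
  have "W1 (atomic_measure G u) (atomic_measure G v) \<le> (\<Sum>x\<in>G. \<Sum>y\<in>G. \<gamma> x y * dist x y)"
    using \<gamma> assms(1-5) by (intro W1_atomic_le(2)) auto
  with \<gamma>(4) show ?thesis by (simp add: assms(4))
qed

text \<open>Two levels of the multiscale bound suffice: a single class of diameter \<open>D\<close>,
  and below it the singletons, of diameter 0. With J = 1 only the L1 distance is left.\<close>

lemma W1_atomic_le_L1:
  fixes G :: "'a::{second_countable_topology,metric_space} set"
  assumes "finite G" "\<And>x. x \<in> G \<Longrightarrow> 0 \<le> u x" "\<And>x. x \<in> G \<Longrightarrow> 0 \<le> v x" "sum u G = 1" "sum v G = 1"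
    and diam: "\<And>x y. x \<in> G \<Longrightarrow> y \<in> G \<Longrightarrow> dist x y \<le> D" and D: "D \<ge> 0"
  shows "W1 (atomic_measure G u) (atomic_measure G v) \<le> D * (\<Sum>x\<in>G. \<bar>u x - v x\<bar>)"
proof -
  have "W1 (atomic_measure G u) (atomic_measure G v) \<le> (\<lambda>j. if j = 0 then D else 0) (1::nat)
     + (\<Sum>j<1. (\<lambda>j. if j = 0 then D else 0) j * (\<Sum>Q\<in>(\<lambda>j x. if j = 0 then undefined else x) (Suc j) ` G.
          \<bar>\<Sum>x\<in>{x\<in>G. (\<lambda>j x. if j = 0 then undefined else x) (Suc j) x = Q}. (u x - v x)\<bar>))"
    using assms by (intro W1_atomic_multiscale) (auto split: if_splits)
  also have "\<dots> = D * (\<Sum>x\<in>G. \<bar>u x - v x\<bar>)"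
    by (auto simp: Collect_conv_if conj_commute intro!: sum.cong)
  finally show ?thesis .
qed

section \<open>McDiarmid's bounded difference inequality\<close>

text \<open>Induction on the coordinates takes the place of a martingale: integrating out one
  coordinate gives a function \<open>h\<close> with the same bound, the same difference constant and
  the same mean, while Hoeffding's lemma for the fluctuation of \<open>f\<close> around
  \<open>h\<close> contributes one factor exp (s^2 c^2 / 8).\<close>

lemma McDiarmid_exp_bound:
  fixes p :: "'a measure" and f :: "('i \<Rightarrow> 'a) \<Rightarrow> real" and c s :: real
  assumes p: "prob_space p" and "finite I" and s: "s > 0"
    and "f \<in> borel_measurable (PiM I (\<lambda>_. p))"
    and "\<And>x. x \<in> space (PiM I (\<lambda>_. p)) \<Longrightarrow> \<bar>f x\<bar> \<le> B"
    and "\<And>x i y z. x \<in> space (PiM I (\<lambda>_. p)) \<Longrightarrow> i \<in> I \<Longrightarrow> y \<in> space p \<Longrightarrow> z \<in> space p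
          \<Longrightarrow> f (x(i:=y)) - f (x(i:=z)) \<le> c"
  shows "(\<integral>\<^sup>+ x. ennreal (exp (s * (f x - (\<integral>x. f x \<partial>PiM I (\<lambda>_. p))))) \<partial>PiM I (\<lambda>_. p))
         \<le> ennreal (exp (s\<^sup>2 * (real (card I) * c\<^sup>2) / 8))"
  using assms(2,4-)
proof (induction I arbitrary: f rule: finite_induct)
  case empty
  interpret prob_space "PiM {} (\<lambda>_. p)" by (intro prob_space_PiM p)
  have "(\<integral>x. f x \<partial>PiM {} (\<lambda>_. p)) = f (\<lambda>_. undefined)"
    by (simp add: PiM_empty lebesgue_integral_count_space_finite)
  then show ?case
    by (simp add: PiM_empty nn_integral_count_space_finite)
next
  case (insert i I)
  interpret p: prob_space p by fact
  interpret P: product_prob_space "\<lambda>_. p" by standard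
  interpret PI: prob_space "PiM I (\<lambda>_. p)" by (intro prob_space_PiM p)
  interpret PiI: prob_space "PiM (insert i I) (\<lambda>_. p)" by (intro prob_space_PiM p)
  note [measurable] = insert.prems(1)
  have upd: "x(i:=y) \<in> space (PiM (insert i I) (\<lambda>_. p))"
    if "x \<in> space (PiM I (\<lambda>_. p))" "y \<in> space p" for x y
    using that by (auto simp: space_PiM PiE_def extensional_def)
  have updm[measurable]: "(\<lambda>(x, y). f (x(i:=y))) \<in> borel_measurable (PiM I (\<lambda>_. p) \<Otimes>\<^sub>M p)"
    by measurable
  define h where "h x = (\<integral>y. f (x(i:=y)) \<partial>p)" for x
  have hm[measurable]: "h \<in> borel_measurable (PiM I (\<lambda>_. p))"
    unfolding h_def by measurable
  have fm: "(\<lambda>y. f (x(i:=y))) \<in> borel_measurable p" if "x \<in> space (PiM I (\<lambda>_. p))" for x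
    using measurable_compose_Pair1[OF that updm] by simp
  have fi: "integrable p (\<lambda>y. f (x(i:=y)))" if "x \<in> space (PiM I (\<lambda>_. p))" for x
    using fm[OF that] upd[OF that] insert.prems(2) that
    by (intro p.integrable_const_bound[of _ B]) (auto intro!: AE_I2)
  have hB: "\<bar>h x\<bar> \<le> B" if "x \<in> space (PiM I (\<lambda>_. p))" for x
  proof -
    have "\<bar>h x\<bar> \<le> (\<integral>y. \<bar>f (x(i:=y))\<bar> \<partial>p)" unfolding h_def by (rule integral_abs_bound)
    also have "\<dots> \<le> (\<integral>y. B \<partial>p)"
      using fi[OF that] upd[OF that] insert.prems(2) by (intro integral_mono) auto
    finally show ?thesis by (simp add: p.prob_space)
  qed
  have hc: "h (x(j:=y)) - h (x(j:=z)) \<le> c"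
    if "x \<in> space (PiM I (\<lambda>_. p))" "j \<in> I" "y \<in> space p" "z \<in> space p" for x j y z
  proof -
    have ij: "i \<noteq> j" using that insert by auto
    have xj: "x(j:=y) \<in> space (PiM I (\<lambda>_. p))" "x(j:=z) \<in> space (PiM I (\<lambda>_. p))"
      using that by (auto simp: space_PiM PiE_def extensional_def)
    have "h (x(j:=y)) - h (x(j:=z)) = (\<integral>t. f (x(j:=y,i:=t)) - f (x(j:=z,i:=t)) \<partial>p)"
      unfolding h_def using fi[OF xj(1)] fi[OF xj(2)] by simp
    also have "\<dots> \<le> (\<integral>t. c \<partial>p)"
    proof (intro integral_mono)
      fix t assume t: "t \<in> space p"
      have "x(j:=v,i:=t) = x(i:=t,j:=v)" for v
        using ij by (rule fun_upd_twist[symmetric])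
      then show "f (x(j:=y,i:=t)) - f (x(j:=z,i:=t)) \<le> c"
        using insert.prems(3)[OF upd[OF that(1) t] _ that(3,4), of j] that(2) by (metis insertCI)
    qed (use fi xj in auto)
    finally show ?thesis by (simp add: p.prob_space)
  qed
  have f_int: "integrable (PiM (insert i I) (\<lambda>_. p)) f"
    using insert.prems(2) by (intro PiI.integrable_const_bound[of _ B]) (auto intro!: AE_I2)
  have Ef: "(\<integral>x. f x \<partial>PiM (insert i I) (\<lambda>_. p)) = (\<integral>x. h x \<partial>PiM I (\<lambda>_. p))"
    unfolding h_def using insert by (intro P.product_integral_insert f_int) auto
  define E where "E = (\<integral>x. h x \<partial>PiM I (\<lambda>_. p))"
  have inner: "(\<integral>\<^sup>+ y. ennreal (exp (s * (f (x(i:=y)) - h x))) \<partial>p) \<le> ennreal (exp (s\<^sup>2 * c\<^sup>2 / 8))"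
    if x: "x \<in> space (PiM I (\<lambda>_. p))" for x
  proof -
    let ?S = "(\<lambda>y. f (x(i:=y))) ` space p"
    \<comment> \<open>The difference condition bounds the oscillation in coordinate \<open>i\<close>
      by \<open>c\<close>, so the values lie in [a, a + c] for their infimum \<open>a\<close>. The
      interval may move with \<open>x\<close>; only its length enters Hoeffding's lemma.\<close>
    define a where "a = Inf ?S"
    have ne: "?S \<noteq> {}" using p.not_empty by simp
    have bb: "bdd_below ?S"
      using upd[OF x] insert.prems(2) by (intro bdd_belowI[of _ "-B"]) (force simp: abs_le_iff)
    have 1: "a \<le> f (x(i:=y))" if "y \<in> space p" for y
      unfolding a_def using that bb by (intro cInf_lower) auto
    have 2: "f (x(i:=y)) \<le> a + c" if y: "y \<in> space p" for y
    proof -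
      have "f (x(i:=y)) - c \<le> a" unfolding a_def
      proof (rule cInf_greatest[OF ne])
        fix v assume "v \<in> ?S"
        then obtain z where z: "z \<in> space p" "v = f (x(i:=z))" by auto
        then show "f (x(i:=y)) - c \<le> v"
          using insert.prems(3)[OF upd[OF x y] _ y z(1), of i] unfolding fun_upd_upd by fastforce
      qed
      then show ?thesis by simp
    qed
    interpret H: interval_bounded_random_variable p "\<lambda>y. f (x(i:=y))" a "a + c"
      by unfold_locales (use 1 2 fm[OF x] in auto)
    show ?thesis
      using H.Hoeffdings_lemma_nn_integral[OF s] by (simp add: h_def)
  qed
  have "(\<integral>\<^sup>+ x. ennreal (exp (s * (f x - E))) \<partial>PiM (insert i I) (\<lambda>_. p))
      = (\<integral>\<^sup>+ x. (\<integral>\<^sup>+ y. ennreal (exp (s * (f (x(i:=y)) - E))) \<partial>p) \<partial>PiM I (\<lambda>_. p))"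
    using insert by (intro P.product_nn_integral_insert) auto
  also have "\<dots> \<le> (\<integral>\<^sup>+ x. ennreal (exp (s * (h x - E))) * ennreal (exp (s\<^sup>2 * c\<^sup>2 / 8)) \<partial>PiM I (\<lambda>_. p))"
  proof (rule nn_integral_mono)
    fix x assume x: "x \<in> space (PiM I (\<lambda>_. p))"
    have m: "(\<lambda>y. ennreal (exp (s * (f (x(i := y)) - t)))) \<in> borel_measurable p" for t
      using fm[OF x] by measurable
    have "(\<integral>\<^sup>+ y. ennreal (exp (s * (f (x(i:=y)) - E))) \<partial>p)
       = (\<integral>\<^sup>+ y. ennreal (exp (s * (h x - E))) * ennreal (exp (s * (f (x(i:=y)) - h x))) \<partial>p)"
      by (intro nn_integral_cong) (simp add: ennreal_mult[symmetric] exp_add[symmetric] algebra_simps)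
    also have "\<dots> = ennreal (exp (s * (h x - E))) * (\<integral>\<^sup>+ y. ennreal (exp (s * (f (x(i:=y)) - h x))) \<partial>p)"
      by (intro nn_integral_cmult m)
    also have "\<dots> \<le> ennreal (exp (s * (h x - E))) * ennreal (exp (s\<^sup>2 * c\<^sup>2 / 8))"
      by (intro mult_left_mono inner x) simp
    finally show "(\<integral>\<^sup>+ y. ennreal (exp (s * (f (x(i:=y)) - E))) \<partial>p)
        \<le> ennreal (exp (s * (h x - E))) * ennreal (exp (s\<^sup>2 * c\<^sup>2 / 8))" .
  qed
  also have "\<dots> = (\<integral>\<^sup>+ x. ennreal (exp (s * (h x - E))) \<partial>PiM I (\<lambda>_. p)) * ennreal (exp (s\<^sup>2 * c\<^sup>2 / 8))"
    by (intro nn_integral_multc) measurable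
  also have "\<dots> \<le> ennreal (exp (s\<^sup>2 * (real (card I) * c\<^sup>2) / 8)) * ennreal (exp (s\<^sup>2 * c\<^sup>2 / 8))"
    unfolding E_def by (intro mult_right_mono insert.IH hm hB hc) auto
  also have "\<dots> = ennreal (exp (s\<^sup>2 * (real (card (insert i I)) * c\<^sup>2) / 8))"
    using insert by (simp add: ennreal_mult[symmetric] exp_add[symmetric] field_simps)
  finally show ?case unfolding Ef E_def .
qed

theorem McDiarmid_ineq_ge:
  fixes p :: "'a measure" and f :: "('i \<Rightarrow> 'a) \<Rightarrow> real"
  assumes p: "prob_space p" and I: "finite I" "I \<noteq> {}" and c: "c > 0" and \<epsilon>: "\<epsilon> > 0"
    and f[measurable]: "f \<in> borel_measurable (PiM I (\<lambda>_. p))"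
    and B: "\<And>x. x \<in> space (PiM I (\<lambda>_. p)) \<Longrightarrow> \<bar>f x\<bar> \<le> B"
    and diff: "\<And>x i y z. x \<in> space (PiM I (\<lambda>_. p)) \<Longrightarrow> i \<in> I \<Longrightarrow> y \<in> space p \<Longrightarrow> z \<in> space p
          \<Longrightarrow> f (x(i:=y)) - f (x(i:=z)) \<le> c"
  shows "measure (PiM I (\<lambda>_. p)) {x\<in>space (PiM I (\<lambda>_. p)). f x \<ge> (\<integral>x. f x \<partial>PiM I (\<lambda>_. p)) + \<epsilon>}
          \<le> exp (- 2 * \<epsilon>\<^sup>2 / (real (card I) * c\<^sup>2))"
proof -
  let ?P = "PiM I (\<lambda>_. p)"
  interpret P: prob_space ?P by (intro prob_space_PiM p)
  define d where "d = real (card I) * c\<^sup>2"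
  have d: "d > 0" using I c by (simp add: d_def card_gt_0_iff)
  \<comment> \<open>This is the minimiser of s^2 d / 8 - s \<epsilon>, the exponent of the Chernoff
    bound; the minimum is -2 \<epsilon>^2 / d.\<close>
  define s where "s = 4 * \<epsilon> / d"
  have s: "s > 0" using \<epsilon> d by (simp add: s_def)
  define E where "E = (\<integral>x. f x \<partial>?P)"
  have "{x\<in>space ?P. f x \<ge> E + \<epsilon>} = {x\<in>space ?P. f x - E \<ge> \<epsilon>}"
    by (simp add: algebra_simps)
  then have "ennreal (P.prob {x\<in>space ?P. f x \<ge> E + \<epsilon>}) = emeasure ?P {x\<in>space ?P. f x - E \<ge> \<epsilon>}"
    by (simp add: P.emeasure_eq_measure)
  also have "\<dots> \<le> ennreal (exp (-s*\<epsilon>)) * (\<integral>\<^sup>+x\<in>space ?P. exp (s * (f x - E)) \<partial>?P)"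
    by (intro Chernoff_ineq_nn_integral_ge s) auto
  also have "(\<integral>\<^sup>+x\<in>space ?P. exp (s * (f x - E)) \<partial>?P) = (\<integral>\<^sup>+x. exp (s * (f x - E)) \<partial>?P)"
    by (intro nn_integral_cong) auto
  also have "ennreal (exp (-s*\<epsilon>)) * \<dots> \<le> ennreal (exp (-s*\<epsilon>)) * ennreal (exp (s\<^sup>2 * (real (card I) * c\<^sup>2) / 8))"
    unfolding E_def using B diff by (intro mult_left_mono McDiarmid_exp_bound p I s f) auto
  also have "\<dots> = ennreal (exp (s\<^sup>2 * d / 8 - s * \<epsilon>))"
    by (simp add: ennreal_mult[symmetric] exp_add[symmetric] d_def)
  also have "s\<^sup>2 * d / 8 - s * \<epsilon> = - 2 * \<epsilon>\<^sup>2 / d"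
    using d by (simp add: s_def field_simps power2_eq_square)
  finally show ?thesis
    by (subst (asm) ennreal_le_iff) (simp_all add: d_def E_def)
qed


section \<open>Mean and tail of weighted deviations of empirical frequencies\<close>

lemma PiM_second_moment_sum:
  fixes p :: "'a measure" and \<phi> :: "'a \<Rightarrow> real"
  assumes p: "prob_space p" and "finite I" and \<phi>[measurable]: "\<phi> \<in> borel_measurable p"
    and B: "\<And>y. y \<in> space p \<Longrightarrow> \<bar>\<phi> y\<bar> \<le> B" and mean: "(\<integral>y. \<phi> y \<partial>p) = 0"
  shows "integrable (PiM I (\<lambda>_. p)) (\<lambda>x. (\<Sum>i\<in>I. \<phi> (x i))\<^sup>2)" (is ?int)
    and "(\<integral>x. (\<Sum>i\<in>I. \<phi> (x i))\<^sup>2 \<partial>PiM I (\<lambda>_. p)) = card I * (\<integral>y. (\<phi> y)\<^sup>2 \<partial>p)"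
proof -
  interpret p: prob_space p by fact
  interpret P: product_prob_space "\<lambda>_. p" by standard
  have B0: "0 \<le> B" using p.not_empty B by fastforce
  have int: "integrable (PiM J (\<lambda>_. p)) (\<lambda>x. (\<Sum>i\<in>J. \<phi> (x i))\<^sup>2)" if "finite J" for J :: "'b set"
  proof -
    interpret PJ: prob_space "PiM J (\<lambda>_. p)" by (intro prob_space_PiM p)
    show ?thesis
    proof (rule PJ.integrable_const_bound)
      show "AE x in PiM J (\<lambda>_. p). norm ((\<Sum>i\<in>J. \<phi> (x i))\<^sup>2) \<le> (card J * B)\<^sup>2"
      proof (rule AE_I2)
        fix x assume x: "x \<in> space (PiM J (\<lambda>_. p))"
        have "\<bar>\<Sum>i\<in>J. \<phi> (x i)\<bar> \<le> (\<Sum>i\<in>J. \<bar>\<phi> (x i)\<bar>)" by (rule sum_abs)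
        also have "\<dots> \<le> (\<Sum>i\<in>J. B)" using x B by (intro sum_mono) (auto simp: space_PiM)
        finally show "norm ((\<Sum>i\<in>J. \<phi> (x i))\<^sup>2) \<le> (card J * B)\<^sup>2"
          using B0 by (simp add: abs_le_square_iff[symmetric] abs_mult)
      qed
    qed measurable
  qed
  show ?int by (rule int) fact
  have \<phi>_int: "integrable p \<phi>" by (rule p.integrable_const_bound[of _ B]) (use B in auto)
  have "(\<phi> y)\<^sup>2 \<le> B\<^sup>2" if "y \<in> space p" for y
    using B[OF that] B0 by (simp add: abs_le_square_iff[symmetric])
  then have \<phi>2_int: "integrable p (\<lambda>y. (\<phi> y)\<^sup>2)"
    by (intro p.integrable_const_bound[of _ "B\<^sup>2"]) auto
  show "(\<integral>x. (\<Sum>i\<in>I. \<phi> (x i))\<^sup>2 \<partial>PiM I (\<lambda>_. p)) = card I * (\<integral>y. (\<phi> y)\<^sup>2 \<partial>p)"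
    using \<open>finite I\<close>
  proof (induction I rule: finite_induct)
    case empty then show ?case by simp
  next
    case (insert i I)
    interpret PI: prob_space "PiM I (\<lambda>_. p)" by (intro prob_space_PiM p)
    have "(\<integral>x. (\<Sum>j\<in>insert i I. \<phi> (x j))\<^sup>2 \<partial>PiM (insert i I) (\<lambda>_. p))
       = (\<integral>x. (\<integral>y. (\<Sum>j\<in>insert i I. \<phi> ((x(i:=y)) j))\<^sup>2 \<partial>p) \<partial>PiM I (\<lambda>_. p))"
      using insert by (intro P.product_integral_insert int) auto
    also have "\<dots> = (\<integral>x. (\<Sum>j\<in>I. \<phi> (x j))\<^sup>2 + (\<integral>y. (\<phi> y)\<^sup>2 \<partial>p) \<partial>PiM I (\<lambda>_. p))"
    proof (intro Bochner_Integration.integral_cong refl)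
      fix x
      define s where "s = (\<Sum>j\<in>I. \<phi> (x j))"
      have "(\<Sum>j\<in>insert i I. \<phi> ((x(i:=y)) j)) = \<phi> y + s" for y
      proof -
        have "(\<Sum>j\<in>I. \<phi> ((x(i:=y)) j)) = s"
          unfolding s_def using insert by (intro sum.cong) auto
        then show ?thesis using insert by simp
      qed
      \<comment> \<open>The new coordinate is integrated with the others held fixed, so the cross
        term 2 s (\<phi> y) vanishes by \<open>mean\<close>.\<close>
      then have "(\<integral>y. (\<Sum>j\<in>insert i I. \<phi> ((x(i:=y)) j))\<^sup>2 \<partial>p) = (\<integral>y. (\<phi> y)\<^sup>2 + (2 * s * \<phi> y + s\<^sup>2) \<partial>p)"
        by (simp add: power2_sum algebra_simps)
      also have "\<dots> = (\<integral>y. (\<phi> y)\<^sup>2 \<partial>p) + s\<^sup>2"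
        using \<phi>_int \<phi>2_int by (simp add: mean p.prob_space)
      finally show "(\<integral>y. (\<Sum>j\<in>insert i I. \<phi> ((x(i:=y)) j))\<^sup>2 \<partial>p) = s\<^sup>2 + (\<integral>y. (\<phi> y)\<^sup>2 \<partial>p)"
        by simp
    qed
    also have "\<dots> = card I * (\<integral>y. (\<phi> y)\<^sup>2 \<partial>p) + (\<integral>y. (\<phi> y)\<^sup>2 \<partial>p)"
      using int[OF insert(1)] insert by (simp add: PI.prob_space)
    finally show ?case using insert by (simp add: algebra_simps)
  qed
qed

text \<open>The first absolute moment is at most the root of the second, and an indicator has
  variance at most \<open>measure p A\<close>. Keeping this mass under the root is what makes
  Cauchy-Schwarz over disjoint events effective later.\<close>

lemma PiM_expected_deviation:
  fixes p :: "'a measure"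
  assumes p: "prob_space p" and I: "finite I" "I \<noteq> {}" and A[measurable]: "A \<in> sets p"
  shows "(\<integral>x. \<bar>(\<Sum>i\<in>I. indicator A (x i)) / card I - measure p A\<bar> \<partial>PiM I (\<lambda>_. p))
     \<le> sqrt (measure p A / card I)"
proof -
  interpret p: prob_space p by fact
  let ?P = "PiM I (\<lambda>_. p)"
  interpret P: prob_space ?P by (intro prob_space_PiM p)
  define \<phi> where "\<phi> y = indicator A y - measure p A" for y
  define n where "n = real (card I)"
  have n: "n > 0" using I by (simp add: n_def card_gt_0_iff)
  have [measurable]: "\<phi> \<in> borel_measurable p" unfolding \<phi>_def by measurable
  have B: "\<bar>\<phi> y\<bar> \<le> 1" for y
    using p.prob_le_1[of A] by (auto simp: \<phi>_def indicator_def)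
  have iA: "integrable p (indicator A :: 'a \<Rightarrow> real)"
    by (rule p.integrable_const_bound[of _ 1]) auto
  have mean: "(\<integral>y. \<phi> y \<partial>p) = 0"
    using iA by (simp add: \<phi>_def p.prob_space)
  have "(\<integral>y. (\<phi> y)\<^sup>2 \<partial>p) \<le> measure p A"
  proof -
    have "(\<phi> y)\<^sup>2 = indicator A y - 2 * measure p A * indicator A y + (measure p A)\<^sup>2" for y
      by (auto simp: \<phi>_def indicator_def power2_diff)
    then have "(\<integral>y. (\<phi> y)\<^sup>2 \<partial>p) = measure p A - 2 * measure p A * measure p A + (measure p A)\<^sup>2"
      using iA by (simp add: p.prob_space)
    then show ?thesis by (simp add: power2_eq_square)
  qed
  note var = PiM_second_moment_sum[OF p I(1) _ B mean]
  let ?X = "\<lambda>x. \<bar>(\<Sum>i\<in>I. \<phi> (x i)) / n\<bar>"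
  have X2: "integrable ?P (\<lambda>x. (?X x)\<^sup>2)"
    using var(1) by (simp add: power_divide)
  have X2v: "(\<integral>x. (?X x)\<^sup>2 \<partial>?P) \<le> measure p A / n"
  proof -
    have "(\<integral>x. (?X x)\<^sup>2 \<partial>?P) = n * (\<integral>y. (\<phi> y)\<^sup>2 \<partial>p) / n\<^sup>2"
      using var(2) by (simp add: power_divide n_def)
    also have "\<dots> = (\<integral>y. (\<phi> y)\<^sup>2 \<partial>p) / n" using n by (simp add: power2_eq_square)
    also have "\<dots> \<le> measure p A / n" using n \<open>(\<integral>y. (\<phi> y)\<^sup>2 \<partial>p) \<le> measure p A\<close> by (intro divide_right_mono) auto
    finally show ?thesis .
  qed
  have X1: "integrable ?P ?X"
  proof (rule P.integrable_const_bound[of _ 1])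
    have "?X x \<le> 1" for x
    proof -
      have "\<bar>\<Sum>i\<in>I. \<phi> (x i)\<bar> \<le> (\<Sum>i\<in>I. \<bar>\<phi> (x i)\<bar>)" by (rule sum_abs)
      also have "\<dots> \<le> (\<Sum>i\<in>I. 1)" using B by (intro sum_mono) auto
      finally show ?thesis using n by (simp add: n_def)
    qed
    then show "AE x in ?P. norm (?X x) \<le> 1" by simp
  qed measurable
  have "(\<integral>x. ?X x \<partial>?P)\<^sup>2 \<le> (\<integral>x. (?X x)\<^sup>2 \<partial>?P)"
    using P.variance_positive[of ?X] P.variance_eq[OF X1 X2] by linarith
  then have "(\<integral>x. ?X x \<partial>?P) \<le> sqrt (measure p A / n)"
    using X2v by (intro real_le_rsqrt) linarith
  also have "?X = (\<lambda>x. \<bar>(\<Sum>i\<in>I. indicator A (x i)) / card I - measure p A\<bar>)"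
    using n by (auto simp: \<phi>_def sum_subtractf n_def diff_divide_distrib)
  finally show ?thesis by (simp add: n_def)
qed

text \<open>Replacing the observation z by y affects only the events containing y or z, each by at
  most b k / n. As \<beta> bounds the total weight of the events through one point, the difference
  constant is 2 \<beta> / n, however many events there are. The threshold is an upper bound for the
  mean of \<open>S\<close>.\<close>

lemma empirical_deviation_tail:
  fixes p :: "'a measure" and B :: "'k \<Rightarrow> 'a set" and b :: "'k \<Rightarrow> real"
  assumes p: "prob_space p" and I: "finite I" "I \<noteq> {}" and K: "finite K"
    and b: "\<And>k. k \<in> K \<Longrightarrow> b k \<ge> 0" and B[measurable]: "\<And>k. k \<in> K \<Longrightarrow> B k \<in> sets p"
    and \<beta>: "\<And>y. y \<in> space p \<Longrightarrow> (\<Sum>k\<in>K. b k * indicator (B k) y) \<le> \<beta>" "\<beta> > 0" and \<epsilon>: "\<epsilon> > 0"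
  defines "S \<equiv> \<lambda>x. \<Sum>k\<in>K. b k * \<bar>(\<Sum>i\<in>I. indicator (B k) (x i)) / card I - measure p (B k)\<bar>"
  shows "S \<in> borel_measurable (PiM I (\<lambda>_. p))"
    and "measure (PiM I (\<lambda>_. p)) {x\<in>space (PiM I (\<lambda>_. p)).
            S x \<ge> (\<Sum>k\<in>K. b k * sqrt (measure p (B k) / card I)) + \<epsilon>}
         \<le> exp (- real (card I) * \<epsilon>\<^sup>2 / (2 * \<beta>\<^sup>2))"
proof -
  interpret p: prob_space p by fact
  let ?P = "PiM I (\<lambda>_. p)"
  interpret P: prob_space ?P by (intro prob_space_PiM p)
  define n where "n = real (card I)"
  have n: "n > 0" using I by (simp add: n_def card_gt_0_iff)
  have m: "(\<lambda>x. (\<Sum>i\<in>I. indicator (B k) (x i)) :: real) \<in> borel_measurable ?P" if "k \<in> K" for k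
    using B[OF that] by measurable
  show S[measurable]: "S \<in> borel_measurable ?P"
    unfolding S_def using m by (intro borel_measurable_sum) measurable
  have D1: "\<bar>(\<Sum>i\<in>I. indicator (B k) (x i)) / card I - measure p (B k)\<bar> \<le> 1" for k x
  proof -
    have "(\<Sum>i\<in>I. indicator (B k) (x i)) \<le> (\<Sum>i\<in>I. 1::real)" by (intro sum_mono) (auto simp: indicator_def)
    then have "(\<Sum>i\<in>I. indicator (B k) (x i)) / real (card I) \<le> 1" using n by (simp add: n_def)
    moreover have "0 \<le> (\<Sum>i\<in>I. indicator (B k) (x i)) / real (card I)"
      by (intro divide_nonneg_nonneg sum_nonneg) auto
    ultimately show ?thesis using p.prob_le_1[of "B k"] measure_nonneg[of p "B k"] by linarith
  qed
  have SB: "\<bar>S x\<bar> \<le> sum b K" for x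
  proof -
    have "\<bar>S x\<bar> = S x" unfolding S_def using b by (intro abs_of_nonneg sum_nonneg) auto
    also have "\<dots> \<le> sum b K"
      unfolding S_def using b mult_left_mono[OF D1 b] by (intro sum_mono) auto
    finally show ?thesis .
  qed
  have diff: "S (x(i:=y)) - S (x(i:=z)) \<le> 2 * \<beta> / n"
    if "i \<in> I" "y \<in> space p" "z \<in> space p" for x i y z
  proof -
    have "S (x(i:=y)) - S (x(i:=z)) \<le> (\<Sum>k\<in>K. b k * ((indicator (B k) y + indicator (B k) z) / n))"
      unfolding S_def sum_subtractf[symmetric]
    proof (intro sum_mono)
      fix k assume k: "k \<in> K"
      have eq: "(\<Sum>j\<in>I. indicator (B k) ((x(i:=v)) j)) = indicator (B k) v + (\<Sum>j\<in>I-{i}. indicator (B k) (x j) :: real)" for v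
        using I that(1) by (subst sum.remove[of I i]) (auto intro!: sum.cong)
      have "\<bar>(\<Sum>j\<in>I. indicator (B k) ((x(i:=y)) j)) / card I - measure p (B k)\<bar>
         - \<bar>(\<Sum>j\<in>I. indicator (B k) ((x(i:=z)) j)) / card I - measure p (B k)\<bar>
        \<le> \<bar>(indicator (B k) y - indicator (B k) z) / n\<bar>"
        unfolding eq n_def add_divide_distrib diff_divide_distrib by linarith
      also have "\<dots> \<le> (indicator (B k) y + indicator (B k) z) / n"
        using n by (auto simp: indicator_def)
      finally show "b k * \<bar>(\<Sum>j\<in>I. indicator (B k) ((x(i:=y)) j)) / card I - measure p (B k)\<bar>
         - b k * \<bar>(\<Sum>j\<in>I. indicator (B k) ((x(i:=z)) j)) / card I - measure p (B k)\<bar>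
        \<le> b k * ((indicator (B k) y + indicator (B k) z) / n)"
        using b[OF k] by (simp only: right_diff_distrib[symmetric] mult_left_mono)
    qed
    also have "\<dots> = ((\<Sum>k\<in>K. b k * indicator (B k) y) + (\<Sum>k\<in>K. b k * indicator (B k) z)) / n"
      by (simp add: sum.distrib[symmetric] sum_divide_distrib distrib_left)
    also have "\<dots> \<le> (\<beta> + \<beta>) / n"
      using \<beta> that n by (intro divide_right_mono add_mono) auto
    finally show ?thesis by simp
  qed
  have int: "integrable ?P (\<lambda>x. \<bar>(\<Sum>i\<in>I. indicator (B k) (x i)) / card I - measure p (B k)\<bar>)" if "k \<in> K" for k
    using m[OF that] D1 by (intro P.integrable_const_bound[of _ 1]) auto
  have "(\<integral>x. S x \<partial>?P) = (\<Sum>k\<in>K. b k * (\<integral>x. \<bar>(\<Sum>i\<in>I. indicator (B k) (x i)) / card I - measure p (B k)\<bar> \<partial>?P))"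
    unfolding S_def using int by (subst Bochner_Integration.integral_sum) auto
  also have "\<dots> \<le> (\<Sum>k\<in>K. b k * sqrt (measure p (B k) / card I))"
    using b B by (intro sum_mono mult_left_mono PiM_expected_deviation p I) auto
  finally have E: "(\<integral>x. S x \<partial>?P) \<le> (\<Sum>k\<in>K. b k * sqrt (measure p (B k) / card I))" .
  have "P.prob {x\<in>space ?P. S x \<ge> (\<Sum>k\<in>K. b k * sqrt (measure p (B k) / card I)) + \<epsilon>}
     \<le> P.prob {x\<in>space ?P. S x \<ge> (\<integral>x. S x \<partial>?P) + \<epsilon>}"
    using E by (intro P.finite_measure_mono) auto
  also have "\<dots> \<le> exp (- 2 * \<epsilon>\<^sup>2 / (real (card I) * (2 * \<beta> / n)\<^sup>2))"
    using SB diff \<beta> \<epsilon> n by (intro McDiarmid_ineq_ge p I) auto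
  also have "- 2 * \<epsilon>\<^sup>2 / (real (card I) * (2 * \<beta> / n)\<^sup>2) = - real (card I) * \<epsilon>\<^sup>2 / (2 * \<beta>\<^sup>2)"
    using n \<beta> by (simp add: n_def[symmetric] field_simps power2_eq_square)
  finally show "P.prob {x\<in>space ?P. S x \<ge> (\<Sum>k\<in>K. b k * sqrt (measure p (B k) / card I)) + \<epsilon>}
     \<le> exp (- real (card I) * \<epsilon>\<^sup>2 / (2 * \<beta>\<^sup>2))" .
qed

text \<open>Independence with a common law says that the vector of observations has the product law,
  so the tail bound on the product space carries over to \<open>M\<close>.\<close>

lemma (in prob_space) iid_empirical_deviation_tail:
  fixes p :: "'b::topological_space measure" and Y :: "nat \<Rightarrow> 'a \<Rightarrow> 'b"
    and B :: "'k \<Rightarrow> 'b set" and b :: "'k \<Rightarrow> real"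
  assumes indep: "indep_vars (\<lambda>_. borel) Y {1..N}" and law: "\<And>n. n \<in> {1..N} \<Longrightarrow> distr M borel (Y n) = p"
    and N: "N \<ge> 1" and K: "finite K"
    and b: "\<And>k. k \<in> K \<Longrightarrow> b k \<ge> 0" and B: "\<And>k. k \<in> K \<Longrightarrow> B k \<in> sets p"
    and \<beta>: "\<And>y. y \<in> space p \<Longrightarrow> (\<Sum>k\<in>K. b k * indicator (B k) y) \<le> \<beta>" "\<beta> > 0" and \<epsilon>: "\<epsilon> > 0"
  defines "E \<equiv> {w\<in>space M. (\<Sum>k\<in>K. b k * \<bar>(\<Sum>n\<in>{1..N}. indicator (B k) (Y n w)) / N - measure p (B k)\<bar>)
         \<ge> (\<Sum>k\<in>K. b k * sqrt (measure p (B k) / N)) + \<epsilon>}"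
  shows "E \<in> events" "prob E \<le> exp (- real N * \<epsilon>\<^sup>2 / (2 * \<beta>\<^sup>2))"
proof -
  let ?I = "{1..N}"
  have rv: "Y n \<in> M \<rightarrow>\<^sub>M borel" if "n \<in> ?I" for n
    using indep that unfolding indep_vars_def by auto
  have ne: "?I \<noteq> {}" using N by auto
  have sp: "sets p = sets borel" using law[of 1] N by auto
  have pp: "prob_space p" using prob_space_distr[OF rv, of 1] law[of 1] N by auto
  define T where "T w = (\<lambda>n\<in>?I. Y n w)" for w
  have T[measurable]: "T \<in> M \<rightarrow>\<^sub>M PiM ?I (\<lambda>_. p)"
    unfolding T_def using rv measurable_cong_sets[OF refl sp]
    by (intro measurable_restrict) auto
  have "distr M (PiM ?I (\<lambda>_. borel)) T = PiM ?I (\<lambda>n. distr M borel (Y n))"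
    using indep_vars_iff_distr_eq_PiM'[OF ne, where M'="\<lambda>_. borel" and X=Y] rv indep by (auto simp: T_def[abs_def])
  also have "PiM ?I (\<lambda>n. distr M borel (Y n)) = PiM ?I (\<lambda>_. p)"
    using law by (intro PiM_cong) auto
  also have "distr M (PiM ?I (\<lambda>_. borel)) T = distr M (PiM ?I (\<lambda>_. p)) T"
    using sp by (intro distr_cong sets_PiM_cong) auto
  finally have d: "distr M (PiM ?I (\<lambda>_. p)) T = PiM ?I (\<lambda>_. p)" .
  define S where "S x = (\<Sum>k\<in>K. b k * \<bar>(\<Sum>i\<in>?I. indicator (B k) (x i)) / card ?I - measure p (B k)\<bar>)" for x
  define t where "t = (\<Sum>k\<in>K. b k * sqrt (measure p (B k) / card ?I)) + \<epsilon>"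
  note tail = empirical_deviation_tail[where p=p and I="?I" and K=K and b=b and B=B and \<beta>=\<beta> and \<epsilon>=\<epsilon>, OF pp _ ne K b B \<beta> \<epsilon>]
  have S[measurable]: "S \<in> borel_measurable (PiM ?I (\<lambda>_. p))"
    unfolding S_def by (rule tail(1)) auto
  have "E = {w\<in>space M. S (T w) \<ge> t}"
    unfolding E_def S_def T_def t_def by simp
  also have "\<dots> = T -` {x\<in>space (PiM ?I (\<lambda>_. p)). S x \<ge> t} \<inter> space M"
    using measurable_space[OF T] by auto
  finally have E: "E = T -` {x\<in>space (PiM ?I (\<lambda>_. p)). S x \<ge> t} \<inter> space M" .
  have ev: "{x\<in>space (PiM ?I (\<lambda>_. p)). S x \<ge> t} \<in> sets (PiM ?I (\<lambda>_. p))" by measurable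
  show "E \<in> events" unfolding E using ev by (rule measurable_sets[OF T])
  have "prob E = measure (PiM ?I (\<lambda>_. p)) {x\<in>space (PiM ?I (\<lambda>_. p)). S x \<ge> t}"
    unfolding E using measure_distr[OF T ev] d by simp
  also have "\<dots> \<le> exp (- real (card ?I) * \<epsilon>\<^sup>2 / (2 * \<beta>\<^sup>2))"
    unfolding S_def t_def by (rule tail(2)) auto
  finally show "prob E \<le> exp (- real N * \<epsilon>\<^sup>2 / (2 * \<beta>\<^sup>2))" by simp
qed

section \<open>Stability of the conditional functional under a change of the joint masses\<close>

text \<open>Atoms \<open>a\<close> without mass contribute \<open>0\<close>, whatever the value of \<open>W1\<close> at the junk
  measure obtained from \<open>x / 0 = 0\<close>.\<close>

definition conditional_W1 :: "'k set \<Rightarrow> 'a::metric_space set \<Rightarrow> ('k \<Rightarrow> 'a \<Rightarrow> real) \<Rightarrow> real" where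
  "conditional_W1 A G e = (\<Sum>a\<in>A. sum (e a) G *
     W1 (atomic_measure G (\<lambda>b. e a b / sum (e a) G)) (atomic_measure G (\<lambda>b. \<Sum>a\<in>A. e a b)))"

text \<open>For f = u - v this is the L1 distance between the images of \<open>u\<close> and
  \<open>v\<close> under \<open>c\<close>: the quantity that appears at each level of
  \<open>W1_atomic_multiscale\<close>.\<close>

definition class_deviation :: "('a \<Rightarrow> 'c) \<Rightarrow> 'a set \<Rightarrow> ('a \<Rightarrow> real) \<Rightarrow> real" where
  "class_deviation c G f = (\<Sum>Q\<in>c ` G. \<bar>\<Sum>x\<in>{x\<in>G. c x = Q}. f x\<bar>)"

lemma abs_sum_le_class_deviation: "finite G \<Longrightarrow> \<bar>sum f G\<bar> \<le> class_deviation c G f"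
  unfolding class_deviation_def
  by (subst sum_fiber_sum[symmetric, where c=c]) (auto intro: sum_abs)

lemma class_deviation_sum_le: "class_deviation c G (\<lambda>b. \<Sum>a\<in>A. f a b) \<le> (\<Sum>a\<in>A. class_deviation c G (f a))"
proof -
  have "class_deviation c G (\<lambda>b. \<Sum>a\<in>A. f a b) = (\<Sum>Q\<in>c ` G. \<bar>\<Sum>a\<in>A. \<Sum>x\<in>{x\<in>G. c x = Q}. f a x\<bar>)"
    unfolding class_deviation_def by (subst sum.swap) simp
  also have "\<dots> \<le> (\<Sum>Q\<in>c ` G. \<Sum>a\<in>A. \<bar>\<Sum>x\<in>{x\<in>G. c x = Q}. f a x\<bar>)"
    by (intro sum_mono sum_abs)
  also have "\<dots> = (\<Sum>a\<in>A. class_deviation c G (f a))"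
    unfolding class_deviation_def by (rule sum.swap)
  finally show ?thesis .
qed

text \<open>Write u - s v = (u - v) + (1 - s) v with s the quotient of the total masses. The second
  term has total |sum u - sum v|, which is again at most the deviation; hence the factor 2. This
  allows conditional laws to be compared through unnormalised masses.\<close>

lemma class_deviation_rescale_le:
  assumes G: "finite G" and v: "\<And>x. x \<in> G \<Longrightarrow> v x \<ge> 0" and s: "sum v G > 0"
  shows "class_deviation c G (\<lambda>x. u x - sum u G * v x / sum v G) \<le> 2 * class_deviation c G (\<lambda>x. u x - v x)"
proof -
  let ?t = "1 - sum u G / sum v G"
  have "class_deviation c G (\<lambda>x. u x - sum u G * v x / sum v G)
     \<le> (\<Sum>Q\<in>c ` G. \<bar>\<Sum>x\<in>{x\<in>G. c x = Q}. (u x - v x)\<bar> + \<bar>?t\<bar> * (\<Sum>x\<in>{x\<in>G. c x = Q}. v x))"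
    unfolding class_deviation_def
  proof (rule sum_mono)
    fix Q assume "Q \<in> c ` G"
    have "(\<Sum>x\<in>{x\<in>G. c x = Q}. u x - sum u G * v x / sum v G)
        = (\<Sum>x\<in>{x\<in>G. c x = Q}. (u x - v x) + ?t * v x)"
      by (intro sum.cong) (auto simp: algebra_simps)
    also have "\<dots> = (\<Sum>x\<in>{x\<in>G. c x = Q}. u x - v x) + ?t * (\<Sum>x\<in>{x\<in>G. c x = Q}. v x)"
      by (simp add: sum.distrib sum_distrib_left)
    also have "\<bar>\<dots>\<bar> \<le> \<bar>\<Sum>x\<in>{x\<in>G. c x = Q}. (u x - v x)\<bar> + \<bar>?t\<bar> * (\<Sum>x\<in>{x\<in>G. c x = Q}. v x)"
      using sum_nonneg[of "{x\<in>G. c x = Q}" v] v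
      by (intro order.trans[OF abs_triangle_ineq]) (simp add: abs_mult)
    finally show "\<bar>\<Sum>x\<in>{x\<in>G. c x = Q}. u x - sum u G * v x / sum v G\<bar> \<le> \<dots>" .
  qed
  also have "\<dots> = class_deviation c G (\<lambda>x. u x - v x) + \<bar>?t\<bar> * sum v G"
    unfolding class_deviation_def by (simp add: sum.distrib sum_distrib_left[symmetric] sum_fiber_sum[OF G])
  also have "\<bar>?t\<bar> * sum v G = \<bar>sum (\<lambda>x. u x - v x) G\<bar>"
    using s by (simp add: abs_if field_simps sum_subtractf)
  also have "\<dots> \<le> class_deviation c G (\<lambda>x. u x - v x)" by (rule abs_sum_le_class_deviation[OF G])
  finally show ?thesis by simp
qed

text \<open>For each atom, the two conditional laws and the two second marginals are exchanged by
  the triangle inequality. Of the factor 3, two parts come from the conditional laws through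
  \<open>class_deviation_rescale_le\<close> and one from the second marginals; likewise each of the
  two comparisons costs one \<open>D J\<close>. The term with \<Delta> 0 pays for the different
  weights of the atoms.\<close>

lemma conditional_W1_stability:
  fixes cls :: "nat \<Rightarrow> 'a::{second_countable_topology,metric_space} \<Rightarrow> 'c" and e \<rho> :: "'k \<Rightarrow> 'a \<Rightarrow> real"
  assumes G: "finite G" and A: "finite A"
    and e: "\<And>a x. a \<in> A \<Longrightarrow> x \<in> G \<Longrightarrow> 0 \<le> e a x" "(\<Sum>a\<in>A. sum (e a) G) = 1"
    and \<rho>: "\<And>a x. a \<in> A \<Longrightarrow> x \<in> G \<Longrightarrow> 0 \<le> \<rho> a x" "(\<Sum>a\<in>A. sum (\<rho> a) G) = 1"
    and one: "\<And>x y. x \<in> G \<Longrightarrow> y \<in> G \<Longrightarrow> cls 0 x = cls 0 y"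
    and refine: "\<And>j x y. x \<in> G \<Longrightarrow> y \<in> G \<Longrightarrow> cls (Suc j) x = cls (Suc j) y \<Longrightarrow> cls j x = cls j y"
    and diam: "\<And>j x y. x \<in> G \<Longrightarrow> y \<in> G \<Longrightarrow> cls j x = cls j y \<Longrightarrow> dist x y \<le> D j"
    and D: "\<And>j. D j \<ge> 0"
  defines "\<Delta> \<equiv> \<lambda>j. \<Sum>a\<in>A. class_deviation (cls j) G (\<lambda>x. e a x - \<rho> a x)"
  shows "\<bar>conditional_W1 A G e - conditional_W1 A G \<rho>\<bar>
     \<le> 2 * D J + D 0 * \<Delta> 0 + 3 * (\<Sum>j<J. D j * \<Delta> (Suc j))"
proof -
  let ?am = "atomic_measure G"
  have ms: "W1 (?am u) (?am v) \<le> D n + (\<Sum>j<n. D j * class_deviation (cls (Suc j)) G (\<lambda>x. u x - v x))"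
    if "\<And>x. x \<in> G \<Longrightarrow> 0 \<le> u x" "\<And>x. x \<in> G \<Longrightarrow> 0 \<le> v x" "sum u G = 1" "sum v G = 1" for u v n
    unfolding class_deviation_def
    by (rule W1_atomic_multiscale[where cls=cls and D=D, OF G that one refine diam D])
  have WD: "W1 (?am u) (?am v) \<le> D 0"
    if "\<And>x. x \<in> G \<Longrightarrow> 0 \<le> u x" "\<And>x. x \<in> G \<Longrightarrow> 0 \<le> v x" "sum u G = 1" "sum v G = 1" for u v
    using ms[OF that, where n=0] by simp
  define e2 where "e2 b = (\<Sum>a\<in>A. e a b)" for b
  define \<rho>2 where "\<rho>2 b = (\<Sum>a\<in>A. \<rho> a b)" for b
  have e2: "0 \<le> e2 x" if "x \<in> G" for x using that e by (auto simp: e2_def intro: sum_nonneg)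
  have e2s: "sum e2 G = 1" using e(2) unfolding e2_def by (subst sum.swap)
  have \<rho>2: "0 \<le> \<rho>2 x" if "x \<in> G" for x using that \<rho> by (auto simp: \<rho>2_def intro: sum_nonneg)
  have \<rho>2s: "sum \<rho>2 G = 1" using \<rho>(2) unfolding \<rho>2_def by (subst sum.swap)
  define e1 where "e1 a = sum (e a) G" for a
  define \<rho>1 where "\<rho>1 a = sum (\<rho> a) G" for a
  have e1: "0 \<le> e1 a" if "a \<in> A" for a using that e by (auto simp: e1_def intro: sum_nonneg)
  have \<rho>1: "0 \<le> \<rho>1 a" if "a \<in> A" for a using that \<rho> by (auto simp: \<rho>1_def intro: sum_nonneg)
  define cd where "cd j a = class_deviation (cls j) G (\<lambda>x. e a x - \<rho> a x)" for j a
  have cd0: "0 \<le> cd j a" for j a by (auto simp: cd_def class_deviation_def intro: sum_nonneg)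
  have d1: "\<bar>e1 a - \<rho>1 a\<bar> \<le> cd j a" for j a
    using abs_sum_le_class_deviation[OF G, of "\<lambda>x. e a x - \<rho> a x"] by (simp add: cd_def e1_def \<rho>1_def sum_subtractf)
  have ec: "0 \<le> e a x / e1 a" "sum (\<lambda>x. e a x / e1 a) G = 1" if "a \<in> A" "x \<in> G" "e1 a \<noteq> 0" for a x
    using that e e1 by (auto simp: sum_divide_distrib[symmetric] e1_def[symmetric])
  have \<rho>c: "0 \<le> \<rho> a x / \<rho>1 a" "sum (\<lambda>x. \<rho> a x / \<rho>1 a) G = 1" if "a \<in> A" "x \<in> G" "\<rho>1 a \<noteq> 0" for a x
    using that \<rho> \<rho>1 by (auto simp: sum_divide_distrib[symmetric] \<rho>1_def[symmetric])
  obtain x0 where x0: "x0 \<in> G" using e2s by (cases "G = {}") auto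
  define w where "w = W1 (?am e2) (?am \<rho>2)"
  define We where "We a = W1 (?am (\<lambda>b. e a b / e1 a)) (?am e2)" for a
  define Wr where "Wr a = W1 (?am (\<lambda>b. \<rho> a b / \<rho>1 a)) (?am \<rho>2)" for a
  have We: "We a \<le> D 0" if "a \<in> A" "e1 a \<noteq> 0" for a
    unfolding We_def using that x0 ec e2 e2s by (intro WD) auto
  have Wr: "Wr a \<le> D 0" if "a \<in> A" "\<rho>1 a \<noteq> 0" for a
    unfolding Wr_def using that x0 \<rho>c \<rho>2 \<rho>2s by (intro WD) auto
  have W0: "0 \<le> We a" "0 \<le> Wr a" "0 \<le> w" for a by (simp_all add: We_def Wr_def w_def W1_nonneg)
  have atom: "\<bar>e1 a * We a - \<rho>1 a * Wr a\<bar>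
      \<le> D 0 * cd 0 a + e1 a * D J + 2 * (\<Sum>j<J. D j * cd (Suc j) a) + e1 a * w" if a: "a \<in> A" for a
  proof -
    have rest: "0 \<le> e1 a * D J + 2 * (\<Sum>j<J. D j * cd (Suc j) a) + e1 a * w"
      using D cd0 W0 e1[OF a] by (intro add_nonneg_nonneg mult_nonneg_nonneg sum_nonneg) auto
    \<comment> \<open>If one of the masses is zero, the corresponding conditional law is junk, but
      its weight is 0. The other summand is at most its mass times \<open>D 0\<close>, and that mass
      equals the difference of the two.\<close>
    consider "\<rho>1 a = 0" | "e1 a = 0" | "\<rho>1 a > 0" "e1 a > 0"
      using e1[OF a] \<rho>1[OF a] by linarith
    then show ?thesis
    proof cases
      case 1
      have "e1 a * We a \<le> e1 a * D 0"
        using We[OF a] e1[OF a] by (cases "e1 a = 0") (simp_all add: mult_left_mono)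
      also have "\<dots> \<le> cd 0 a * D 0"
        using d1[of a 0] 1 by (intro mult_right_mono D) simp
      finally have "\<bar>e1 a * We a - \<rho>1 a * Wr a\<bar> \<le> D 0 * cd 0 a"
        using 1 W0(1)[of a] e1[OF a] by (simp add: mult.commute)
      with rest show ?thesis by linarith
    next
      case 2
      have "\<rho>1 a * Wr a \<le> \<rho>1 a * D 0"
        using Wr[OF a] \<rho>1[OF a] by (cases "\<rho>1 a = 0") (simp_all add: mult_left_mono)
      also have "\<dots> \<le> cd 0 a * D 0"
        using d1[of a 0] 2 by (intro mult_right_mono D) simp
      finally have "\<bar>e1 a * We a - \<rho>1 a * Wr a\<bar> \<le> D 0 * cd 0 a"
        using 2 W0(2)[of a] \<rho>1[OF a] by (simp add: mult.commute)
      with rest show ?thesis by linarith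
    next
      case 3
      let ?E = "\<lambda>x. e a x / e1 a" and ?R = "\<lambda>x. \<rho> a x / \<rho>1 a"
      note p = ec[OF a _ less_imp_neq[OF 3(2), symmetric]] \<rho>c[OF a _ less_imp_neq[OF 3(1), symmetric]]
      have fin: "W1e (?am u) (?am v) < \<infinity>"
        if "\<forall>x\<in>G. 0 \<le> u x" "sum u G = 1" "\<forall>x\<in>G. 0 \<le> v x" "sum v G = 1" for u v
        using that by (intro W1e_atomic_finite[OF G]) blast+
      have tri: "W1 (?am u) (?am v) \<le> W1 (?am u) (?am x) + W1 (?am x) (?am v)"
        if "\<forall>x\<in>G. 0 \<le> u x" "sum u G = 1" "\<forall>x\<in>G. 0 \<le> v x" "sum v G = 1" "\<forall>y\<in>G. 0 \<le> x y" "sum x G = 1"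
        for u v x using that by (intro W1_triangle fin)
      have q: "\<forall>x\<in>G. 0 \<le> ?E x" "\<forall>x\<in>G. 0 \<le> ?R x" "\<forall>x\<in>G. 0 \<le> e2 x" "\<forall>x\<in>G. 0 \<le> \<rho>2 x"
          "sum ?E G = 1" "sum ?R G = 1"
        using p e2 \<rho>2 x0 by blast+
      have c1: "We a \<le> W1 (?am ?E) (?am ?R) + (Wr a + w)"
        unfolding We_def Wr_def w_def
        using tri[OF q(1,5) q(3) e2s q(2,6)] tri[OF q(2,6) q(3) e2s q(4) \<rho>2s]
        by (simp only: W1_commute[of "?am \<rho>2" "?am e2"])
      have c2: "Wr a \<le> W1 (?am ?E) (?am ?R) + (We a + w)"
        unfolding We_def Wr_def w_def
        using tri[OF q(2,6) q(4) \<rho>2s q(1,5)] tri[OF q(1,5) q(4) \<rho>2s q(3) e2s]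
        by (simp only: W1_commute[of "?am ?R" "?am ?E"])
      have "e1 a * W1 (?am ?E) (?am ?R)
        \<le> e1 a * (D J + (\<Sum>j<J. D j * class_deviation (cls (Suc j)) G (\<lambda>x. ?E x - ?R x)))"
        using q less_imp_le[OF 3(2)] by (intro mult_left_mono ms) blast+
      also have "\<dots> = e1 a * D J + (\<Sum>j<J. D j * (e1 a * class_deviation (cls (Suc j)) G (\<lambda>x. ?E x - ?R x)))"
        by (simp add: distrib_left sum_distrib_left mult_ac)
      also have "\<dots> \<le> e1 a * D J + (\<Sum>j<J. D j * (2 * cd (Suc j) a))"
      proof (intro add_left_mono sum_mono mult_left_mono D)
        fix j
        \<comment> \<open>The weight \<open>e1 a\<close> is drawn into the deviation, where it
          cancels the normalisation of \<open>?E\<close> and rescales \<rho> to the mass of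
          e.\<close>
        have "e1 a * class_deviation (cls j) G (\<lambda>x. ?E x - ?R x)
            = class_deviation (cls j) G (\<lambda>x. e1 a * (?E x - ?R x))"
          using 3 by (simp add: class_deviation_def sum_distrib_left[symmetric] abs_mult)
        also have "(\<lambda>x. e1 a * (?E x - ?R x)) = (\<lambda>x. e a x - sum (e a) G * \<rho> a x / sum (\<rho> a) G)"
          using 3 by (auto simp: e1_def[symmetric] \<rho>1_def[symmetric] field_simps)
        also have "class_deviation (cls j) G \<dots> \<le> 2 * cd j a"
          unfolding cd_def using \<rho>(1)[OF a] 3 by (intro class_deviation_rescale_le G) (auto simp: \<rho>1_def)
        finally show "e1 a * class_deviation (cls j) G (\<lambda>x. ?E x - ?R x) \<le> 2 * cd j a" .
      qed
      also have "\<dots> = e1 a * D J + 2 * (\<Sum>j<J. D j * cd (Suc j) a)"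
        by (simp add: sum_distrib_left mult_ac)
      finally have b: "e1 a * W1 (?am ?E) (?am ?R) \<le> e1 a * D J + 2 * (\<Sum>j<J. D j * cd (Suc j) a)" .
      \<comment> \<open>This splits a difference of products into a change of the distance at fixed
        weight and a change of the weight at fixed distance.\<close>
      have "e1 a * We a - \<rho>1 a * Wr a = e1 a * (We a - Wr a) + (e1 a - \<rho>1 a) * Wr a"
        by (simp add: algebra_simps)
      also have "\<bar>\<dots>\<bar> \<le> e1 a * \<bar>We a - Wr a\<bar> + \<bar>e1 a - \<rho>1 a\<bar> * Wr a"
        using 3 W0(2)[of a] by (intro order.trans[OF abs_triangle_ineq]) (simp add: abs_mult)
      also have "\<dots> \<le> e1 a * (W1 (?am ?E) (?am ?R) + w) + cd 0 a * D 0"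
        using c1 c2 Wr[OF a] 3 d1 W0(2)[of a] cd0 by (intro add_mono mult_mono mult_left_mono) auto
      finally show ?thesis using b by (simp add: algebra_simps)
    qed
  qed
  have wle: "w \<le> D J + (\<Sum>j<J. D j * \<Delta> (Suc j))"
  proof -
    have "w \<le> D J + (\<Sum>j<J. D j * class_deviation (cls (Suc j)) G (\<lambda>x. e2 x - \<rho>2 x))"
      unfolding w_def using e2 e2s \<rho>2 \<rho>2s by (intro ms) auto
    also have "\<dots> \<le> D J + (\<Sum>j<J. D j * \<Delta> (Suc j))"
      unfolding e2_def \<rho>2_def \<Delta>_def sum_subtractf[symmetric]
      by (intro add_left_mono sum_mono mult_left_mono class_deviation_sum_le D)
    finally show ?thesis .
  qed
  have "\<bar>conditional_W1 A G e - conditional_W1 A G \<rho>\<bar> = \<bar>\<Sum>a\<in>A. e1 a * We a - \<rho>1 a * Wr a\<bar>"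
    by (simp add: conditional_W1_def e1_def \<rho>1_def We_def Wr_def e2_def[abs_def] \<rho>2_def[abs_def] sum_subtractf)
  also have "\<dots> \<le> (\<Sum>a\<in>A. D 0 * cd 0 a + e1 a * D J + 2 * (\<Sum>j<J. D j * cd (Suc j) a) + e1 a * w)"
    using atom by (intro order.trans[OF sum_abs] sum_mono)
  also have "\<dots> = D 0 * \<Delta> 0 + D J + 2 * (\<Sum>j<J. D j * \<Delta> (Suc j)) + w"
  proof -
    have "(\<Sum>a\<in>A. \<Sum>j<J. D j * cd (Suc j) a) = (\<Sum>j<J. D j * \<Delta> (Suc j))"
      by (subst sum.swap) (simp add: \<Delta>_def cd_def sum_distrib_left)
    then show ?thesis
      using e(2) by (simp add: sum.distrib sum_distrib_left[symmetric] sum_distrib_right[symmetric] \<Delta>_def cd_def e1_def)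
  qed
  also have "\<dots> \<le> 2 * D J + D 0 * \<Delta> 0 + 3 * (\<Sum>j<J. D j * \<Delta> (Suc j))"
    using wle by linarith
  finally show ?thesis .
qed

section \<open>Measures with finite first moment\<close>

definition finite_first_moment :: "'a::real_normed_vector measure \<Rightarrow> bool" where
  "finite_first_moment p \<longleftrightarrow> prob_space p \<and> sets p = sets borel \<and> (\<integral>\<^sup>+y. ennreal (norm y) \<partial>p) < \<infinity>"

text \<open>Transport both measures to the Dirac measure at 0, at the cost of their first
  moments.\<close>

lemma W1e_le_first_moments:
  fixes p q :: "'a::{second_countable_topology,real_normed_vector} measure"
  assumes p: "prob_space p" "sets p = sets borel" and q: "prob_space q" "sets q = sets borel"
  shows "W1e p q \<le> (\<integral>\<^sup>+y. ennreal (norm y) \<partial>p) + (\<integral>\<^sup>+y. ennreal (norm y) \<partial>q)"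
proof -
  have to0: "W1e r (return borel 0) \<le> (\<integral>\<^sup>+y. ennreal (norm y) \<partial>r)"
    if r: "prob_space r" "sets r = sets borel" for r :: "'a measure"
  proof -
    interpret prob_space r by fact
    have "distr r borel (\<lambda>_. 0) = return borel (0::'a)"
      using r by (intro measure_eqI) (auto simp: emeasure_distr emeasure_space_1 indicator_def sets_eq_imp_space_eq)
    then show ?thesis
      using W1e_distr_le_nn_integral[OF r, of "\<lambda>_. 0"] by simp
  qed
  have "W1e p q \<le> W1e p (return borel 0) + W1e (return borel 0) q" by (rule W1e_triangle)
  also have "\<dots> \<le> (\<integral>\<^sup>+y. ennreal (norm y) \<partial>p) + (\<integral>\<^sup>+y. ennreal (norm y) \<partial>q)"
    using to0[OF p] to0[OF q] by (intro add_mono) (simp_all add: W1e_commute)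
  finally show ?thesis .
qed

lemma W1e_finite:
  fixes p q :: "'a::{second_countable_topology,real_normed_vector} measure"
  assumes "finite_first_moment p" "finite_first_moment q"
  shows "W1e p q < \<infinity>"
  using W1e_le_first_moments[of p q] assms unfolding finite_first_moment_def
  by (auto intro: order.strict_trans1)

text \<open>Integrate norm x \<le> dist x y + norm y over a coupling; as a difference, the bound
  passes to the infimum. Its use is the converse direction: an infinite first moment of
  \<open>p\<close> makes the cost infinite.\<close>

lemma first_moment_le:
  fixes p q :: "'a::{second_countable_topology,real_normed_vector} measure"
  assumes q: "(\<integral>\<^sup>+y. ennreal (norm y) \<partial>q) \<noteq> \<infinity>"
  shows "(\<integral>\<^sup>+y. ennreal (norm y) \<partial>p) \<le> W1e p q + (\<integral>\<^sup>+y. ennreal (norm y) \<partial>q)"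
proof -
  have "(\<integral>\<^sup>+y. ennreal (norm y) \<partial>p) - (\<integral>\<^sup>+y. ennreal (norm y) \<partial>q) \<le> transport_cost g"
    if g: "g \<in> couplings p q" for g
  proof -
    have s[measurable_cong]: "sets g = sets (borel \<Otimes>\<^sub>M borel)" and d: "distr g borel fst = p" "distr g borel snd = q"
      using g unfolding couplings_def borel_prod by blast+
    have "(\<integral>\<^sup>+y. ennreal (norm y) \<partial>p) = (\<integral>\<^sup>+z. ennreal (norm (fst z)) \<partial>g)"
      unfolding d(1)[symmetric] by (subst nn_integral_distr) auto
    also have "\<dots> \<le> (\<integral>\<^sup>+z. ennreal (dist (fst z) (snd z)) + ennreal (norm (snd z)) \<partial>g)"
      by (intro nn_integral_mono)
         (auto simp: ennreal_plus[symmetric] dist_norm norm_triangle_sub add.commute simp del: ennreal_plus intro!: ennreal_leI)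
    also have "\<dots> = transport_cost g + (\<integral>\<^sup>+z. ennreal (norm (snd z)) \<partial>g)"
      unfolding transport_cost_def by (subst nn_integral_add) auto
    also have "(\<integral>\<^sup>+z. ennreal (norm (snd z)) \<partial>g) = (\<integral>\<^sup>+y. ennreal (norm y) \<partial>q)"
      unfolding d(2)[symmetric] by (subst nn_integral_distr) auto
    finally show ?thesis using q by (simp add: ennreal_minus_le_iff add.commute)
  qed
  then have "(\<integral>\<^sup>+y. ennreal (norm y) \<partial>p) - (\<integral>\<^sup>+y. ennreal (norm y) \<partial>q) \<le> W1e p q"
    unfolding W1e_def by (rule INF_greatest)
  then show ?thesis using q by (simp add: ennreal_minus_le_iff add.commute)
qed

lemma W1_triangle_first_moment:
  fixes p q r :: "'a::{second_countable_topology,real_normed_vector} measure"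
  assumes "finite_first_moment p" "finite_first_moment q" "finite_first_moment r"
  shows "W1 p r \<le> W1 p q + W1 q r"
  by (intro W1_triangle W1e_finite assms)

lemma finite_first_moment_bounded:
  fixes p :: "'a::{second_countable_topology,real_normed_vector} measure"
  assumes "prob_space p" "sets p = sets borel" "AE y in p. norm y \<le> c"
  shows "finite_first_moment p"
proof -
  interpret prob_space p by fact
  have "(\<integral>\<^sup>+y. ennreal (norm y) \<partial>p) \<le> (\<integral>\<^sup>+y. ennreal c \<partial>p)"
    using assms(3) by (intro nn_integral_mono_AE) (auto intro: ennreal_leI)
  also have "\<dots> < \<infinity>" by (simp add: emeasure_space_1)
  finally show ?thesis using assms by (simp add: finite_first_moment_def)
qed

lemma W1_eq_0_of_infinite_first_moment:
  fixes p q :: "'a::{second_countable_topology,real_normed_vector} measure"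
  assumes "(\<integral>\<^sup>+y. ennreal (norm y) \<partial>p) = \<infinity>" "finite_first_moment q"
  shows "W1 p q = 0"
proof -
  have q: "(\<integral>\<^sup>+y. ennreal (norm y) \<partial>q) \<noteq> \<infinity>"
    using assms(2) by (auto simp: finite_first_moment_def)
  have "W1e p q = \<infinity>"
    using first_moment_le[OF q, of p] q assms(1) by (auto simp: top_unique ennreal_add_eq_top)
  then show ?thesis by (simp add: W1_conv_W1e)
qed

lemma closed_unit_cube: "closed (unit_cube :: (real ^ 'd) set)"
  unfolding unit_cube_def
  by (intro closed_Collect_all closed_Collect_conj closed_Collect_le continuous_intros)

lemma unit_cube_borel [measurable]: "unit_cube \<in> sets borel"
  by (intro borel_closed closed_unit_cube)

lemma norm_le_unit_cube:
  fixes x :: "real ^ 'd" assumes "x \<in> unit_cube" shows "norm x \<le> CARD('d)"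
proof -
  have "norm x \<le> (\<Sum>i\<in>UNIV. \<bar>x $ i\<bar>)" by (rule norm_le_l1_cart)
  also have "\<dots> \<le> (\<Sum>i\<in>(UNIV :: 'd set). 1)"
    using assms by (intro sum_mono) (auto simp: unit_cube_def)
  finally show ?thesis by simp
qed

section \<open>The Lipschitz kernel and its exceptional points\<close>

text \<open>Nothing forces \<open>\<kappa> x\<close> to live on the cube for every x. Hence two sets
  of good points: on \<open>moment_set\<close> the distances are finite, and on
  \<open>cube_kernel_set\<close>, which has full \<mu>-measure, the conditional law is carried by
  the cube.\<close>

locale lipschitz_kernel =
  fixes \<pi> :: "((real ^ 'd) \<times> (real ^ 'd)) measure" and \<kappa> :: "real ^ 'd \<Rightarrow> (real ^ 'd) measure" and L :: real
  assumes pi_prob: "prob_space \<pi>" and pi_sets: "sets \<pi> = sets borel"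
    and pi_cube: "emeasure \<pi> (unit_cube \<times> unit_cube) = 1"
    and kernel_prob: "\<And>x. x \<in> unit_cube \<Longrightarrow> prob_space (\<kappa> x) \<and> sets (\<kappa> x) = sets borel"
    and kernel_meas: "\<And>B. B \<in> sets borel \<Longrightarrow>
           (\<lambda>x. emeasure (\<kappa> x) B) \<in> borel_measurable (restrict_space borel unit_cube)"
    and disint: "\<And>A B. A \<in> sets borel \<Longrightarrow> B \<in> sets borel \<Longrightarrow>
           emeasure \<pi> (A \<times> B) =
             (\<integral>\<^sup>+ x. indicator (A \<inter> unit_cube) x * emeasure (\<kappa> x) B \<partial>(distr \<pi> borel fst))"
    and lipschitz: "\<And>x y. x \<in> unit_cube \<Longrightarrow> y \<in> unit_cube \<Longrightarrow> W1 (\<kappa> x) (\<kappa> y) \<le> L * dist x y"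
    and L: "L \<ge> 0"
begin

abbreviation "\<mu> \<equiv> distr \<pi> borel fst"
abbreviation "\<nu> \<equiv> distr \<pi> borel snd"

sublocale pi: prob_space \<pi> by (rule pi_prob)

lemma space_pi: "space \<pi> = UNIV"
  using sets_eq_imp_space_eq[OF pi_sets] by simp

lemma fst_pi [measurable]: "fst \<in> \<pi> \<rightarrow>\<^sub>M borel" and snd_pi [measurable]: "snd \<in> \<pi> \<rightarrow>\<^sub>M borel"
  using borel_measurable_fst_prod borel_measurable_snd_prod measurable_cong_sets[OF pi_sets refl] by blast+

sublocale mu: prob_space \<mu> by (rule pi.prob_space_distr[OF fst_pi])
sublocale nu: prob_space \<nu> by (rule pi.prob_space_distr[OF snd_pi])

lemma AE_pi_cube: "AE z in \<pi>. fst z \<in> unit_cube \<and> snd z \<in> unit_cube"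
proof -
  have "unit_cube \<times> unit_cube \<in> sets \<pi>"
    unfolding pi_sets by (intro borel_Times unit_cube_borel)
  then have "AE z in \<pi>. z \<in> unit_cube \<times> unit_cube"
    using pi_cube by (subst pi.prob_eq_1[symmetric]) (auto simp: measure_def)
  then show ?thesis by eventually_elim auto
qed

lemma AE_nu_cube: "AE x in \<nu>. x \<in> unit_cube"
  using AE_pi_cube by (subst AE_distr_iff) auto

lemma finite_first_moment_cube:
  fixes p :: "(real ^ 'd) measure"
  assumes "prob_space p" "sets p = sets borel" "AE y in p. y \<in> unit_cube"
  shows "finite_first_moment p"
  using assms(3) norm_le_unit_cube
  by (intro finite_first_moment_bounded[where c="CARD('d)"] assms) (auto elim: eventually_mono)

lemma finite_first_moment_nu: "finite_first_moment \<nu>"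
  by (intro finite_first_moment_cube nu.prob_space_axioms AE_nu_cube) simp

lemma kernel_measurable: "\<kappa> \<in> restrict_space borel unit_cube \<rightarrow>\<^sub>M subprob_algebra borel"
  using kernel_prob kernel_meas
  by (intro measurable_subprob_algebra) (auto simp: space_restrict_space prob_space_imp_subprob_space)

lemma kernel_integral_measurable:
  assumes "f \<in> borel_measurable borel"
  shows "(\<lambda>x. (\<integral>\<^sup>+y. f y \<partial>\<kappa> x) * indicator unit_cube x) \<in> borel_measurable borel"
  using measurable_compose[OF kernel_measurable nn_integral_measurable_subprob_algebra[OF assms]]
  by (subst (asm) borel_measurable_restrict_space_iff_ennreal) auto

definition "moment_set = {x \<in> unit_cube. (\<integral>\<^sup>+y. ennreal (norm y) \<partial>\<kappa> x) < \<infinity>}"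

lemma moment_set_borel: "moment_set \<in> sets borel"
proof -
  have "moment_set = unit_cube \<inter> {x. (\<integral>\<^sup>+y. ennreal (norm y) \<partial>\<kappa> x) * indicator unit_cube x < \<infinity>}"
    by (auto simp: moment_set_def)
  moreover have "{x. (\<integral>\<^sup>+y. ennreal (norm y) \<partial>\<kappa> x) * indicator unit_cube x < \<infinity>} \<in> sets borel"
    using kernel_integral_measurable[of "\<lambda>y. ennreal (norm y)"] by measurable
  ultimately show ?thesis by auto
qed

lemma finite_first_moment_kernel: "x \<in> moment_set \<Longrightarrow> finite_first_moment (\<kappa> x)"
  using kernel_prob by (auto simp: moment_set_def finite_first_moment_def)

text \<open>Where the first moment of the kernel is infinite, the real-valued \<open>W1\<close> has the junk
  value \<open>0\<close>; on the rest of the cube it is Lipschitz.\<close>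

lemma W1_kernel_measurable: "(\<lambda>x. indicator unit_cube x * W1 (\<kappa> x) \<nu>) \<in> borel_measurable borel"
proof -
  have lip: "W1 (\<kappa> x) \<nu> - W1 (\<kappa> y) \<nu> \<le> L * dist x y" if "x \<in> moment_set" "y \<in> moment_set" for x y
    using W1_triangle_first_moment[OF finite_first_moment_kernel[OF that(1)] finite_first_moment_kernel[OF that(2)]
        finite_first_moment_nu] lipschitz[of x y] that by (auto simp: moment_set_def)
  have "L-lipschitz_on moment_set (\<lambda>x. W1 (\<kappa> x) \<nu>)"
  proof (intro lipschitz_onI L)
    fix x y assume "x \<in> moment_set" "y \<in> moment_set"
    then show "dist (W1 (\<kappa> x) \<nu>) (W1 (\<kappa> y) \<nu>) \<le> L * dist x y"
      using lip[of x y] lip[of y x] by (simp add: dist_real_def abs_le_iff dist_commute)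
  qed
  then have "continuous_on moment_set (\<lambda>x. W1 (\<kappa> x) \<nu>)"
    by (rule lipschitz_on_continuous_on)
  then have "(\<lambda>x. indicator moment_set x *\<^sub>R W1 (\<kappa> x) \<nu>) \<in> borel_measurable borel"
    by (intro borel_measurable_continuous_on_indicator moment_set_borel)
  also have "(\<lambda>x. indicator moment_set x *\<^sub>R W1 (\<kappa> x) \<nu>) = (\<lambda>x. indicator unit_cube x * W1 (\<kappa> x) \<nu>)"
  proof
    fix x show "indicator moment_set x *\<^sub>R W1 (\<kappa> x) \<nu> = indicator unit_cube x * W1 (\<kappa> x) \<nu>"
      using W1_eq_0_of_infinite_first_moment[of "\<kappa> x" \<nu>] finite_first_moment_nu
      by (cases "x \<in> moment_set") (auto simp: moment_set_def less_top[symmetric])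
  qed
  finally show ?thesis .
qed

definition "cube_kernel_set = {x \<in> unit_cube. emeasure (\<kappa> x) unit_cube = 1}"

lemma cube_kernel_set_borel [measurable]: "cube_kernel_set \<in> sets borel"
proof -
  have [measurable]: "(\<lambda>x. emeasure (\<kappa> x) unit_cube * indicator unit_cube x) \<in> borel_measurable borel"
    using kernel_meas[OF unit_cube_borel] by (subst (asm) borel_measurable_restrict_space_iff_ennreal) auto
  have "cube_kernel_set = {x. emeasure (\<kappa> x) unit_cube * indicator unit_cube x = 1}"
    by (auto simp: cube_kernel_set_def indicator_def)
  also have "\<dots> \<in> sets borel" by measurable
  finally show ?thesis .
qed

text \<open>By \<open>disint\<close> and the support of \<pi>, the function \<open>?h\<close> has
  \<mu>-integral 1. As it never exceeds 1, it equals 1 almost everywhere.\<close>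

lemma AE_cube_kernel_set: "AE x in \<mu>. x \<in> cube_kernel_set"
proof -
  let ?h = "\<lambda>x. indicator unit_cube x * emeasure (\<kappa> x) unit_cube"
  have [measurable]: "?h \<in> borel_measurable borel"
    using kernel_meas[OF unit_cube_borel]
    by (subst (asm) borel_measurable_restrict_space_iff_ennreal) (auto simp: mult.commute)
  have h1: "?h x \<le> 1" for x
    using kernel_prob[of x] prob_space.emeasure_le_1[of "\<kappa> x"] by (auto simp: indicator_def)
  have "emeasure \<pi> (UNIV \<times> unit_cube) = 1"
  proof -
    have "UNIV \<times> unit_cube \<in> sets \<pi>"
      unfolding pi_sets by (intro borel_Times) auto
    moreover have "AE z in \<pi>. z \<in> UNIV \<times> unit_cube"
      using AE_pi_cube by eventually_elim auto
    ultimately show ?thesis using pi.emeasure_eq_1_AE by blast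
  qed
  then have "(\<integral>\<^sup>+x. ?h x \<partial>\<mu>) = 1"
    using disint[of UNIV unit_cube] by simp
  moreover have "(\<integral>\<^sup>+x. 1 - ?h x \<partial>\<mu>) = (\<integral>\<^sup>+x. 1 \<partial>\<mu>) - (\<integral>\<^sup>+x. ?h x \<partial>\<mu>)"
    using h1 calculation by (intro nn_integral_diff) auto
  ultimately have "(\<integral>\<^sup>+x. 1 - ?h x \<partial>\<mu>) = 0"
    using mu.emeasure_space_1 by simp
  then have "AE x in \<mu>. 1 - ?h x = 0"
    by (subst (asm) nn_integral_0_iff_AE) auto
  then show ?thesis
  proof eventually_elim
    case (elim x)
    then have "?h x = 1"
      using h1[of x] by (simp add: antisym ennreal_minus_eq_0)
    then show ?case by (cases "x \<in> unit_cube") (auto simp: cube_kernel_set_def)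
  qed
qed

lemma cube_kernelD:
  assumes "x \<in> cube_kernel_set"
  shows "x \<in> unit_cube" "prob_space (\<kappa> x)" "sets (\<kappa> x) = sets borel" "AE y in \<kappa> x. y \<in> unit_cube"
proof -
  show 1: "x \<in> unit_cube" using assms by (simp add: cube_kernel_set_def)
  show 2: "prob_space (\<kappa> x)" and 3: "sets (\<kappa> x) = sets borel" using kernel_prob[OF 1] by auto
  interpret prob_space "\<kappa> x" by fact
  show "AE y in \<kappa> x. y \<in> unit_cube"
    using assms 3 by (subst prob_eq_1[symmetric]) (auto simp: cube_kernel_set_def measure_def)
qed

end

section \<open>Convexity for mixtures over a continuum, and images with finite range\<close>

text \<open>Rounding the mixed mass functions to multiples of \<open>\<delta>\<close> leaves finitely many classes, so that
  finite convexity applies; the rounding error is controlled by the L1 distance.\<close>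

lemma W1_atomic_mixture:
  fixes G :: "'a::{second_countable_topology,metric_space} set" and v :: "'x \<Rightarrow> 'a \<Rightarrow> real"
  assumes M: "finite_measure M" and G: "finite G"
    and u: "\<And>b. b \<in> G \<Longrightarrow> u b \<ge> 0" "sum u G = 1"
    and A: "A \<in> sets M" "measure M A > 0"
    and vm: "\<And>b. b \<in> G \<Longrightarrow> (\<lambda>x. indicator A x * v x b) \<in> borel_measurable M"
    and v: "\<And>x b. x \<in> A \<Longrightarrow> b \<in> G \<Longrightarrow> v x b \<ge> 0" "\<And>x. x \<in> A \<Longrightarrow> sum (v x) G = 1"
    and r: "\<And>x. x \<in> A \<Longrightarrow> W1 (atomic_measure G u) (atomic_measure G (v x)) \<le> r"
  shows "W1 (atomic_measure G u)
     (atomic_measure G (\<lambda>b. (\<integral>x. indicator A x * v x b \<partial>M) / measure M A)) \<le> r"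
proof (rule field_le_epsilon)
  interpret finite_measure M by fact
  fix e :: real assume e: "e > 0"
  \<comment> \<open>A crude bound for the diameter of \<open>G\<close>; the summand 1 keeps it
    positive, so that \<delta> below is well defined.\<close>
  define D where "D = 1 + (\<Sum>x\<in>G. \<Sum>y\<in>G. dist x y)"
  have D0: "D > 0" unfolding D_def by (intro add_pos_nonneg sum_nonneg) auto
  have D: "dist x y \<le> D" if "x \<in> G" "y \<in> G" for x y
  proof -
    have "dist x y \<le> (\<Sum>y\<in>G. dist x y)" using that G by (intro member_le_sum) auto
    also have "\<dots> \<le> (\<Sum>x\<in>G. \<Sum>y\<in>G. dist x y)"
      using that G by (intro member_le_sum[where f="\<lambda>x. \<Sum>y\<in>G. dist x y"]) (auto intro: sum_nonneg)
    finally show ?thesis by (simp add: D_def)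
  qed
  have v1: "v x b \<le> 1" if "x \<in> A" "b \<in> G" for x b
    using member_le_sum[of b G "v x"] v(1)[OF that(1)] v(2)[OF that(1)] that G by auto
  define g where "g = real (card G)"
  define \<delta> where "\<delta> = e / (D * (g + 1))"
  have \<delta>: "\<delta> > 0" using e D0 by (simp add: \<delta>_def g_def)
  \<comment> \<open>Mass functions with equal rounded values differ by at most \<delta> at each
    point. Since the values lie in [0, 1] and the key is restricted to \<open>G\<close>, there are
    finitely many keys.\<close>
  define key where "key x = (\<lambda>b\<in>G. \<lfloor>v x b / \<delta>\<rfloor>)" for x
  have key: "key x \<in> G \<rightarrow>\<^sub>E {0..\<lfloor>1/\<delta>\<rfloor>}" if "x \<in> A" for x
    using that v v1 \<delta> by (auto simp: key_def intro!: floor_mono divide_right_mono)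
  define K where "K = key ` A"
  have K: "finite K"
    by (rule finite_subset[of _ "G \<rightarrow>\<^sub>E {0..\<lfloor>1/\<delta>\<rfloor>}"]) (use key G in \<open>auto simp: K_def intro: finite_PiE\<close>)
  have close: "\<bar>v x b - v y b\<bar> \<le> \<delta>" if "key x = key y" "b \<in> G" for x y b
  proof -
    have "\<lfloor>v x b / \<delta>\<rfloor> = \<lfloor>v y b / \<delta>\<rfloor>" using fun_cong[OF that(1), of b] that(2) by (simp add: key_def)
    then have "\<bar>v x b / \<delta> - v y b / \<delta>\<bar> \<le> 1" by linarith
    then show ?thesis using \<delta> by (simp add: diff_divide_distrib[symmetric] divide_le_eq)
  qed
  define Ak where "Ak k = {x\<in>A. key x = k}" for k
  have Ak: "Ak k \<in> sets M" if "k \<in> K" for k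
  proof -
    have ext: "k \<in> extensional G" using that by (auto simp: K_def key_def)
    have key_eq: "key x = k \<longleftrightarrow> (\<forall>b\<in>G. \<lfloor>v x b / \<delta>\<rfloor> = k b)" for x
    proof
      assume r: "\<forall>b\<in>G. \<lfloor>v x b / \<delta>\<rfloor> = k b"
      show "key x = k"
      proof (rule extensionalityI[OF _ ext])
        show "key x \<in> extensional G" by (simp add: key_def)
        show "key x b = k b" if "b \<in> G" for b using r that by (simp add: key_def)
      qed
    next
      assume "key x = k"
      then show "\<forall>b\<in>G. \<lfloor>v x b / \<delta>\<rfloor> = k b" by (auto simp: key_def)
    qed
    \<comment> \<open>Measurability is known only for \<open>v\<close> cut off outside
      \<open>A\<close>, so the class is rewritten with the cut-off inside the floor.\<close>
    have "Ak k = A \<inter> {x\<in>space M. \<forall>b\<in>G. \<lfloor>indicator A x * v x b / \<delta>\<rfloor> = k b}"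
      using sets.sets_into_space[OF A(1)] by (auto simp: Ak_def key_eq)
    moreover have "Measurable.pred M (\<lambda>x. \<forall>b\<in>G. \<lfloor>indicator A x * v x b / \<delta>\<rfloor> = k b)"
    proof (intro pred_intros_finite(3) G)
      fix b assume "b \<in> G"
      note [measurable] = vm[OF this]
      show "Measurable.pred M (\<lambda>x. \<lfloor>indicator A x * v x b / \<delta>\<rfloor> = k b)" by measurable
    qed
    then have "{x\<in>space M. \<forall>b\<in>G. \<lfloor>indicator A x * v x b / \<delta>\<rfloor> = k b} \<in> sets M"
      by (simp add: pred_def)
    ultimately show ?thesis using A(1) by auto
  qed
  define m where "m k = measure M (Ak k)" for k
  define avg where "avg k b = (\<integral>x. indicator (Ak k) x * v x b \<partial>M)" for k b
  define rep where "rep k = (SOME x. x \<in> Ak k)" for k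
  have rep: "rep k \<in> Ak k" if "k \<in> K" for k
  proof -
    have "\<exists>x. x \<in> Ak k" using that by (auto simp: K_def Ak_def)
    then show ?thesis unfolding rep_def by (rule someI_ex)
  qed
  have repA: "rep k \<in> A" if "k \<in> K" for k using rep[OF that] by (simp add: Ak_def)
  have int: "integrable M (\<lambda>x. indicator (Ak k) x * v x b)" if "k \<in> K" "b \<in> G" for k b
  proof (rule integrable_const_bound[where B=1])
    have "(\<lambda>x. indicator (Ak k) x * v x b) = (\<lambda>x. indicator (Ak k) x * (indicator A x * v x b))"
      by (auto simp: Ak_def indicator_def)
    also have "\<dots> \<in> borel_measurable M"
      by (rule borel_measurable_times[OF borel_measurable_indicator[OF Ak[OF that(1)]] vm[OF that(2)]])
    finally show "(\<lambda>x. indicator (Ak k) x * v x b) \<in> borel_measurable M" .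
    show "AE x in M. norm (indicator (Ak k) x * v x b) \<le> 1"
      using v1[OF _ that(2)] v(1)[OF _ that(2)] by (intro AE_I2) (auto simp: indicator_def Ak_def)
  qed
  have avg_close: "\<bar>avg k b - m k * v (rep k) b\<bar> \<le> m k * \<delta>" if k: "k \<in> K" "b \<in> G" for k b
  proof -
    have i: "integrable M (indicator (Ak k) :: _ \<Rightarrow> real)"
      using Ak[OF k(1)] by (auto simp: emeasure_eq_measure)
    have i2: "(\<integral>x. indicator (Ak k) x * c \<partial>M) = m k * c" for c
      using Ak[OF k(1)] sets.sets_into_space[OF Ak[OF k(1)]] by (simp add: m_def Int_absorb2)
    have "avg k b - m k * v (rep k) b = (\<integral>x. indicator (Ak k) x * v x b - indicator (Ak k) x * v (rep k) b \<partial>M)"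
      unfolding avg_def using Bochner_Integration.integral_diff[OF int[OF k] integrable_mult_left[OF i]]
      by (simp only: i2)
    also have "\<bar>\<dots>\<bar> \<le> (\<integral>x. \<bar>indicator (Ak k) x * v x b - indicator (Ak k) x * v (rep k) b\<bar> \<partial>M)"
      by (rule integral_abs_bound)
    also have "\<dots> \<le> (\<integral>x. indicator (Ak k) x * \<delta> \<partial>M)"
    proof (rule integral_mono)
      show "integrable M (\<lambda>x. \<bar>indicator (Ak k) x * v x b - indicator (Ak k) x * v (rep k) b\<bar>)"
        using int[OF k] i by (intro integrable_abs Bochner_Integration.integrable_diff) auto
      show "\<bar>indicator (Ak k) x * v x b - indicator (Ak k) x * v (rep k) b\<bar> \<le> indicator (Ak k) x * \<delta>" for x
        using close[of x "rep k" b] k rep[OF k(1)] by (auto simp: indicator_def Ak_def)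
    qed (use i in auto)
    also have "\<dots> = m k * \<delta>" by (rule i2)
    finally show ?thesis .
  qed
  have m0: "m k \<ge> 0" for k by (simp add: m_def)
  have split: "(\<integral>x. indicator A x * f x \<partial>M) = (\<Sum>k\<in>K. \<integral>x. indicator (Ak k) x * f x \<partial>M)"
    if "\<And>k. k \<in> K \<Longrightarrow> integrable M (\<lambda>x. indicator (Ak k) x * f x)" for f :: "'x \<Rightarrow> real"
  proof -
    have "indicator A x * f x = (\<Sum>k\<in>K. indicator (Ak k) x * f x)" for x
    proof (cases "x \<in> A")
      case True
      then have "(\<Sum>k\<in>K. indicator (Ak k) x * f x) = (\<Sum>k\<in>{key x}. f x)"
        using K by (intro sum.mono_neutral_cong_right) (auto simp: K_def Ak_def indicator_def)
      with True show ?thesis by simp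
    qed (simp add: Ak_def)
    then show ?thesis using that by simp
  qed
  define mA where "mA = measure M A"
  have mA: "mA > 0" using A(2) by (simp add: mA_def)
  have msum: "sum m K = mA"
    using split[of "\<lambda>_. 1"] Ak A(1) sets.sets_into_space[OF A(1)] sets.sets_into_space[OF Ak]
    by (auto simp: m_def mA_def emeasure_eq_measure Int_absorb2 intro!: sum.cong)
  have avgsum: "(\<Sum>k\<in>K. avg k b) = (\<integral>x. indicator A x * v x b \<partial>M)" if "b \<in> G" for b
    unfolding avg_def using int that by (intro split[symmetric]) auto
  define \<rho> where "\<rho> b = (\<integral>x. indicator A x * v x b \<partial>M) / mA" for b
  \<comment> \<open>In \<open>w\<close> the average over each class is replaced by the value at a
    representative. This is a finite convex combination, so \<open>W1_atomic_convex\<close> applies,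
    and it differs from \<rho> by at most \<delta> at every point.\<close>
  define w where "w b = (\<Sum>k\<in>K. m k / mA * v (rep k) b)" for b
  have c: "(\<Sum>k\<in>K. m k / mA) = 1" using msum mA by (simp add: sum_divide_distrib[symmetric])
  have w0: "w b \<ge> 0" if "b \<in> G" for b
    unfolding w_def using that v(1)[OF repA] m0 mA by (intro sum_nonneg mult_nonneg_nonneg) auto
  have ws: "sum w G = 1"
    unfolding w_def using c v(2)[OF repA]
    by (subst sum.swap) (simp add: sum_distrib_left[symmetric] del: times_divide_eq_left)
  have \<rho>0: "\<rho> b \<ge> 0" if "b \<in> G" for b
    unfolding \<rho>_def using v(1) that mA
    by (intro divide_nonneg_pos Bochner_Integration.integral_nonneg) (auto simp: indicator_def)
  have \<rho>s: "sum \<rho> G = 1"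
  proof -
    have i: "integrable M (\<lambda>x. indicator A x * v x b)" if "b \<in> G" for b
      using vm[OF that] v1[OF _ that] v(1)[OF _ that]
      by (intro integrable_const_bound[where B=1]) (auto simp: indicator_def intro!: AE_I2)
    have "(\<Sum>b\<in>G. \<integral>x. indicator A x * v x b \<partial>M) = (\<integral>x. (\<Sum>b\<in>G. indicator A x * v x b) \<partial>M)"
      using i by simp
    also have "\<dots> = (\<integral>x. indicator A x \<partial>M)"
      using v(2) by (intro Bochner_Integration.integral_cong) (auto simp: sum_distrib_left[symmetric] indicator_def)
    also have "\<dots> = mA" using A sets.sets_into_space[OF A(1)] by (simp add: mA_def Int_absorb2)
    finally show ?thesis using mA by (simp add: \<rho>_def sum_divide_distrib[symmetric])
  qed
  have L1: "W1 (atomic_measure G w) (atomic_measure G \<rho>) \<le> e"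
  proof -
    have "\<bar>w b - \<rho> b\<bar> \<le> \<delta>" if "b \<in> G" for b
    proof -
      have "w b - \<rho> b = (\<Sum>k\<in>K. m k * v (rep k) b - avg k b) / mA"
        by (simp add: w_def \<rho>_def avgsum[OF that, symmetric] sum_divide_distrib sum_subtractf diff_divide_distrib)
      also have "\<bar>\<dots>\<bar> \<le> (\<Sum>k\<in>K. m k * \<delta>) / mA"
        using mA avg_close[OF _ that]
        by (subst abs_divide) (auto intro!: divide_right_mono order.trans[OF sum_abs] sum_mono simp: abs_minus_commute)
      also have "\<dots> = \<delta>" using msum mA by (simp add: sum_distrib_right[symmetric])
      finally show ?thesis .
    qed
    then have "(\<Sum>b\<in>G. \<bar>w b - \<rho> b\<bar>) \<le> g * \<delta>"
      unfolding g_def by (rule sum_bounded_above)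
    then have "D * (\<Sum>b\<in>G. \<bar>w b - \<rho> b\<bar>) \<le> D * (g * \<delta>)"
      using D0 by (intro mult_left_mono) auto
    also have "\<dots> = e * (g / (g + 1))" using D0 by (simp add: \<delta>_def)
    also have "\<dots> \<le> e" using e by (intro mult_left_le) (auto simp: g_def)
    finally show ?thesis
      using W1_atomic_le_L1[OF G w0 \<rho>0 ws \<rho>s D] D0 by simp
  qed
  have conv: "W1 (atomic_measure G u) (atomic_measure G w) \<le> r"
    unfolding w_def by (rule W1_atomic_convex[OF G K]) (use u v repA r m0 mA c in auto)
  have "W1 (atomic_measure G u) (atomic_measure G \<rho>)
     \<le> W1 (atomic_measure G u) (atomic_measure G w) + W1 (atomic_measure G w) (atomic_measure G \<rho>)"
    using u w0 ws \<rho>0 \<rho>s by (intro W1_triangle W1e_atomic_finite G) auto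
  with L1 conv show "W1 (atomic_measure G u)
     (atomic_measure G (\<lambda>b. (\<integral>x. indicator A x * v x b \<partial>M) / measure M A)) \<le> r + e"
    unfolding \<rho>_def mA_def by linarith
qed

lemma finite_first_moment_atomic_measure:
  fixes G :: "'a::{second_countable_topology,real_normed_vector} set"
  assumes "finite G" "\<And>a. a \<in> G \<Longrightarrow> u a \<ge> 0" "sum u G = 1"
  shows "finite_first_moment (atomic_measure G u)"
  unfolding finite_first_moment_def
proof (intro conjI)
  have "(\<integral>\<^sup>+y. ennreal (norm y) \<partial>atomic_measure G u) = (\<Sum>a\<in>G. ennreal (u a) * ennreal (norm a))"
    using assms(1) by (intro nn_integral_atomic_measure) auto
  also have "\<dots> < \<infinity>" using assms(1) by (simp add: ennreal_mult_less_top)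
  finally show "(\<integral>\<^sup>+y. ennreal (norm y) \<partial>atomic_measure G u) < \<infinity>" .
qed (simp_all add: prob_space_atomic_measure assms)

lemma distr_eq_atomic_measure:
  fixes T :: "'a::topological_space \<Rightarrow> 'b::t1_space"
  assumes p: "prob_space p" "sets p = sets borel" and T[measurable]: "T \<in> borel_measurable borel"
    and G: "finite G" "AE y in p. T y \<in> G"
  shows "distr p borel T = atomic_measure G (\<lambda>b. measure p {y. T y = b})"
    and "(\<Sum>b\<in>G. measure p {y. T y = b}) = 1"
proof -
  interpret prob_space p by fact
  have s: "space p = UNIV" using sets_eq_imp_space_eq[OF p(2)] by simp
  have m[measurable]: "T \<in> p \<rightarrow>\<^sub>M borel" using T measurable_cong_sets[OF p(2) refl] by blast
  have Gb: "G \<in> sets borel" using G by (simp add: finite_imp_closed borel_closed)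
  have 1: "measure (distr p borel T) {b} = measure p {y. T y = b}" for b
    by (subst measure_distr[OF m]) (auto simp: s vimage_def)
  have 2: "measure (distr p borel T) G = 1"
  proof -
    have "measure (distr p borel T) G = prob (T -` G)"
      using measure_distr[OF m Gb] by (simp add: s)
    also have "\<dots> = 1"
      using G(2) measurable_sets[OF m Gb] by (subst prob_eq_1) (auto simp: s)
    finally show ?thesis .
  qed
  show "distr p borel T = atomic_measure G (\<lambda>b. measure p {y. T y = b})"
    using prob_space_distr[OF m] G 1 2 by (intro eq_atomic_measureI) auto
  interpret D: prob_space "distr p borel T" by (rule prob_space_distr[OF m])
  have "measure (distr p borel T) G = (\<Sum>b\<in>G. measure (distr p borel T) {b})"
    using G by (intro D.finite_measure_eq_sum_singleton) auto
  then show "(\<Sum>b\<in>G. measure p {y. T y = b}) = 1" by (simp add: 1 2)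
qed

section \<open>Error made by rounding the true measure\<close>

context lipschitz_kernel
begin

definition joint_mass :: "(real ^ 'd \<Rightarrow> real ^ 'd) \<Rightarrow> real ^ 'd \<Rightarrow> real ^ 'd \<Rightarrow> real" where
  "joint_mass T a b = measure \<pi> {z. T (fst z) = a \<and> T (snd z) = b}"

lemma joint_mass_nonneg: "0 \<le> joint_mass T a b"
  by (simp add: joint_mass_def)

lemma joint_mass_snd_marginal:
  assumes T[measurable]: "T \<in> borel_measurable borel" and fin: "finite (T ` unit_cube)"
  shows "(\<Sum>a\<in>T ` unit_cube. joint_mass T a b) = measure \<nu> {y. T y = b}"
proof -
  let ?G = "T ` unit_cube"
  have m: "{z. T (fst z) = a \<and> T (snd z) = b} \<in> sets \<pi>" for a b
  proof -
    have "{z\<in>space \<pi>. T (fst z) = a \<and> T (snd z) = b} \<in> sets \<pi>" by measurable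
    then show ?thesis by (simp add: space_pi)
  qed
  have "(\<Sum>a\<in>?G. joint_mass T a b) = measure \<pi> (\<Union>a\<in>?G. {z. T (fst z) = a \<and> T (snd z) = b})"
    unfolding joint_mass_def using fin m
    by (intro pi.finite_measure_finite_Union[symmetric]) (auto simp: disjoint_family_on_def)
  also have "\<dots> = measure \<pi> {z\<in>space \<pi>. T (snd z) = b}"
  proof (rule pi.finite_measure_eq_AE)
    show "AE z in \<pi>. (z \<in> (\<Union>a\<in>?G. {z. T (fst z) = a \<and> T (snd z) = b})) = (z \<in> {z\<in>space \<pi>. T (snd z) = b})"
      using AE_pi_cube by eventually_elim (auto simp: space_pi)
    show "(\<Union>a\<in>?G. {z. T (fst z) = a \<and> T (snd z) = b}) \<in> sets \<pi>"
      using fin m by (intro sets.finite_UN) auto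
  qed measurable
  also have "\<dots> = measure \<nu> {y. T y = b}"
    by (subst measure_distr) (auto simp: space_pi vimage_def)
  finally show ?thesis .
qed

text \<open>The constant is collected along a chain. Two points of a cell are at distance at most 2
  \<eta>, so their kernels differ by 2 L \<eta>; rounding both kernels adds 2 \<eta>; convexity
  passes the bound (2 L + 2) \<eta> to the conditional law of the rounded measure. Undoing the
  rounding at x and rounding \<nu> add \<eta> each.\<close>

lemma discretization_error:
  assumes T[measurable]: "T \<in> borel_measurable borel" and fin: "finite (T ` unit_cube)"
    and close: "\<And>x. x \<in> unit_cube \<Longrightarrow> dist x (T x) \<le> \<eta>"
  shows "\<bar>(LINT x:unit_cube|\<mu>. W1 (\<kappa> x) \<nu>) - conditional_W1 (T ` unit_cube) (T ` unit_cube) (joint_mass T)\<bar>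
           \<le> (2 * L + 4) * \<eta>"
proof -
  define G where "G = T ` unit_cube"
  have G: "finite G" using fin by (simp add: G_def)
  have inG: "T x \<in> G" if "x \<in> unit_cube" for x using that by (simp add: G_def)
  have \<eta>: "\<eta> \<ge> 0" 
    using order.trans[OF zero_le_dist close[of 0]] by (simp add: unit_cube_def)
  let ?am = "atomic_measure G"
  define v where "v x b = measure (\<kappa> x) {y. T y = b}" for x b
  \<comment> \<open>Cells contain only points whose kernel lives on the cube, so that the rounded
    kernel is carried by \<open>G\<close>. What is removed is \<mu>-null.\<close>
  define cell where "cell a = {x \<in> cube_kernel_set. T x = a}" for a
  have cellD: "x \<in> cube_kernel_set" "T x = a" "x \<in> unit_cube" "prob_space (\<kappa> x)" "sets (\<kappa> x) = sets borel"
     "AE y in \<kappa> x. y \<in> unit_cube" if "x \<in> cell a" for x a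
    using that cube_kernelD[of x] by (auto simp: cell_def)
  have cell[measurable]: "cell a \<in> sets borel" for a
  proof -
    have "cell a = cube_kernel_set \<inter> {x\<in>space borel. T x = a}" by (auto simp: cell_def)
    also have "\<dots> \<in> sets borel" by measurable
    finally show ?thesis .
  qed
  have v0: "v x b \<ge> 0" for x b by (simp add: v_def)
  have AEG: "AE y in p. T y \<in> G" if "AE y in p. y \<in> unit_cube" for p
    using that inG by auto
  have vd: "distr (\<kappa> x) borel T = ?am (v x)" "sum (v x) G = 1" if "x \<in> cell a" for x a
    using distr_eq_atomic_measure[OF cellD(4,5)[OF that] T G AEG[OF cellD(6)[OF that]]] by (auto simp: v_def[abs_def])
  have vm: "(\<lambda>x. indicator (cell a) x * v x b) \<in> borel_measurable borel" for a b
  proof -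
    have B: "{y\<in>space borel. T y = b} \<in> sets borel" by measurable
    have [measurable]: "(\<lambda>x. emeasure (\<kappa> x) {y. T y = b} * indicator unit_cube x) \<in> borel_measurable borel"
      using kernel_meas[OF B] by (subst (asm) borel_measurable_restrict_space_iff_ennreal) auto
    have "(\<lambda>x. indicator (cell a) x * v x b)
       = (\<lambda>x. indicator (cell a) x * enn2real (emeasure (\<kappa> x) {y. T y = b} * indicator unit_cube x))"
      using cellD(3)[of _ a] by (intro ext) (simp add: v_def measure_def split: split_indicator)
    also have "\<dots> \<in> borel_measurable borel" by measurable
    finally show ?thesis .
  qed
  have joint: "joint_mass T a b = (\<integral>x. indicator (cell a) x * v x b \<partial>\<mu>)" for a b
  proof -
    have A: "{y\<in>space borel. T y = c} \<in> sets borel" for c by measurable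
    have "emeasure \<pi> {z. T (fst z) = a \<and> T (snd z) = b} = emeasure \<pi> ({y. T y = a} \<times> {y. T y = b})"
      by (rule arg_cong[where f="emeasure \<pi>"]) auto
    also have "\<dots> = (\<integral>\<^sup>+ x. indicator ({y. T y = a} \<inter> unit_cube) x * emeasure (\<kappa> x) {y. T y = b} \<partial>\<mu>)"
      using A[of a] A[of b] by (intro disint) auto
    also have "\<dots> = (\<integral>\<^sup>+ x. ennreal (indicator (cell a) x * v x b) \<partial>\<mu>)"
    proof (rule nn_integral_cong_AE)
      show "AE x in \<mu>. indicator ({y. T y = a} \<inter> unit_cube) x * emeasure (\<kappa> x) {y. T y = b}
          = ennreal (indicator (cell a) x * v x b)"
        using AE_cube_kernel_set
      proof eventually_elim
        case (elim x)
        interpret prob_space "\<kappa> x" by (rule cube_kernelD(2)[OF elim])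
        show ?case using elim cube_kernelD(1)[OF elim]
          by (simp add: v_def cell_def emeasure_eq_measure split: split_indicator)
      qed
    qed
    finally show ?thesis
      using vm v0 by (subst integral_eq_nn_integral) (auto simp: joint_mass_def measure_def)
  qed
  define m where "m a = measure \<mu> (cell a)" for a
  have int: "integrable \<mu> (\<lambda>x. indicator (cell a) x * v x b)" for a b
  proof (rule mu.integrable_const_bound[where B=1])
    show "AE x in \<mu>. norm (indicator (cell a) x * v x b) \<le> 1"
      using prob_space.prob_le_1[OF cellD(4)] by (intro AE_I2) (auto simp: v_def indicator_def)
  qed (use vm in simp)
  have sum1: "(\<Sum>b\<in>G. joint_mass T a b) = m a" for a
  proof -
    have "(\<Sum>b\<in>G. joint_mass T a b) = (\<integral>x. (\<Sum>b\<in>G. indicator (cell a) x * v x b) \<partial>\<mu>)"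
      using int by (simp add: joint)
    also have "\<dots> = (\<integral>x. indicator (cell a) x \<partial>\<mu>)"
      using vd(2) by (intro Bochner_Integration.integral_cong) (auto simp: sum_distrib_left[symmetric] indicator_def)
    also have "\<dots> = m a" by (simp add: m_def)
    finally show ?thesis .
  qed
  define \<rho>2 where "\<rho>2 b = (\<Sum>a\<in>G. joint_mass T a b)" for b
  have \<rho>2': "\<rho>2 b = measure \<nu> {y. T y = b}" for b
    unfolding \<rho>2_def G_def by (rule joint_mass_snd_marginal[OF T fin])
  have \<rho>2: "distr \<nu> borel T = ?am \<rho>2" "sum \<rho>2 G = 1"
    using distr_eq_atomic_measure[OF nu.prob_space_axioms _ T G AEG[OF AE_nu_cube]] by (simp_all add: \<rho>2'[abs_def])
  \<comment> \<open>By \<open>joint\<close>, the conditional law of the rounded measure at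
    \<open>a\<close> is the \<mu>-average of \<open>v x\<close> over the cell: the form that
    \<open>W1_atomic_mixture\<close> expects.\<close>
  define R where "R a = ?am (\<lambda>b. joint_mass T a b / m a)" for a
  define w where "w a = W1 (R a) (?am \<rho>2)" for a
  have near: "\<bar>W1 (\<kappa> x) \<nu> - w a\<bar> \<le> (2 * L + 4) * \<eta>" if x: "x \<in> cell a" and a: "m a > 0" for x a
  proof -
    have c: "W1 (\<kappa> y) (?am (v y)) \<le> \<eta>" if "y \<in> cell a" for y
      unfolding vd(1)[OF that, symmetric] using cellD[OF that] close \<eta>
      by (intro W1_distr_le) auto
    have fk: "finite_first_moment (\<kappa> y)" "finite_first_moment (?am (v y))" if "y \<in> cell a" for y
      using cellD[OF that] vd(2)[OF that] v0 G
      by (auto intro: finite_first_moment_cube finite_first_moment_atomic_measure)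
    have "W1 (?am (v x)) (?am (v y)) \<le> (2 * L + 2) * \<eta>" if y: "y \<in> cell a" for y
    proof -
      have "dist x y \<le> dist x (T x) + dist y (T y)"
        using cellD(2)[OF x] cellD(2)[OF y] by (simp add: dist_triangle2)
      also have "\<dots> \<le> 2 * \<eta>" using close[OF cellD(3)[OF x]] close[OF cellD(3)[OF y]] by simp
      finally have "L * dist x y \<le> L * (2 * \<eta>)" using L by (rule mult_left_mono)
      then have "W1 (\<kappa> x) (\<kappa> y) \<le> L * (2 * \<eta>)"
        using lipschitz[OF cellD(3)[OF x] cellD(3)[OF y]] by linarith
      moreover have "W1 (?am (v x)) (?am (v y)) \<le> W1 (?am (v x)) (\<kappa> x) + W1 (\<kappa> x) (?am (v y))"
        "W1 (\<kappa> x) (?am (v y)) \<le> W1 (\<kappa> x) (\<kappa> y) + W1 (\<kappa> y) (?am (v y))"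
        using fk[OF x] fk[OF y] by (auto intro: W1_triangle_first_moment)
      ultimately show ?thesis
        using c[OF x] c[OF y] W1_commute[of "?am (v x)" "\<kappa> x"] by (simp add: algebra_simps)
    qed
    then have "W1 (?am (v x)) (?am (\<lambda>b. (\<integral>x. indicator (cell a) x * v x b \<partial>\<mu>) / measure \<mu> (cell a))) \<le> (2 * L + 2) * \<eta>"
      using v0 vd(2)[OF x] vd(2) vm a
      by (intro W1_atomic_mixture[OF mu.finite_measure_axioms G]) (auto simp: m_def)
    then have 1: "W1 (?am (v x)) (R a) \<le> (2 * L + 2) * \<eta>"
      unfolding R_def joint m_def .
    have fR: "finite_first_moment (R a)"
      unfolding R_def using G a sum1[of a] joint_mass_nonneg[of T]
      by (intro finite_first_moment_atomic_measure) (auto simp: sum_divide_distrib[symmetric])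
    have f\<rho>: "finite_first_moment (?am \<rho>2)"
      using \<rho>2(2) by (intro finite_first_moment_atomic_measure G) (auto simp: \<rho>2')
    have 2: "W1 \<nu> (?am \<rho>2) \<le> \<eta>"
      unfolding \<rho>2(1)[symmetric] using AE_nu_cube close \<eta>
      by (intro W1_distr_le nu.prob_space_axioms) auto
    note f = fk[OF x] fR f\<rho> finite_first_moment_nu
    have "W1 (\<kappa> x) (R a) \<le> W1 (\<kappa> x) (?am (v x)) + W1 (?am (v x)) (R a)"
      by (intro W1_triangle_first_moment f)
    with 1 c[OF x] have 3: "W1 (\<kappa> x) (R a) \<le> (2 * L + 3) * \<eta>" by (simp add: algebra_simps)
    have "W1 (\<kappa> x) \<nu> \<le> W1 (\<kappa> x) (R a) + (W1 (R a) (?am \<rho>2) + W1 (?am \<rho>2) \<nu>)"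
      using W1_triangle_first_moment[OF f(1,3,5)] W1_triangle_first_moment[OF f(3,4,5)] by linarith
    moreover have "W1 (R a) (?am \<rho>2) \<le> W1 (R a) (\<kappa> x) + (W1 (\<kappa> x) \<nu> + W1 \<nu> (?am \<rho>2))"
      using W1_triangle_first_moment[OF f(3,1,4)] W1_triangle_first_moment[OF f(1,5,4)] by linarith
    ultimately show ?thesis
      using 2 3 W1_commute[of "R a" "\<kappa> x"] W1_commute[of "?am \<rho>2" \<nu>]
      unfolding w_def by (simp add: algebra_simps abs_le_iff)
  qed
  let ?f = "\<lambda>x. indicator unit_cube x * W1 (\<kappa> x) \<nu>" and ?s = "\<lambda>x. \<Sum>a\<in>G. indicator (cell a) x * w a"
  have fm[measurable]: "?f \<in> borel_measurable borel" by (rule W1_kernel_measurable)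
  \<comment> \<open>On a cell without mass \<open>R a\<close> is junk, but there are finitely many
    cells, so almost no x lies in such a cell.\<close>
  have "AE x in \<mu>. \<forall>a\<in>G. m a = 0 \<longrightarrow> x \<notin> cell a"
  proof (intro AE_finite_allI[OF G])
    fix a show "AE x in \<mu>. m a = 0 \<longrightarrow> x \<notin> cell a"
      by (cases "m a = 0") (auto simp: m_def mu.prob_eq_0)
  qed
  with AE_cube_kernel_set have near_AE: "AE x in \<mu>. \<bar>?f x - ?s x\<bar> \<le> (2 * L + 4) * \<eta>"
  proof eventually_elim
    case (elim x)
    have xc: "x \<in> unit_cube" by (rule cube_kernelD(1)[OF elim(1)])
    have x: "x \<in> cell (T x)" using elim by (simp add: cell_def)
    have "m (T x) \<noteq> 0" using elim(2) inG[OF xc] x by auto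
    then have "m (T x) > 0" by (simp add: m_def zero_less_measure_iff)
    moreover have "?s x = (\<Sum>a\<in>{T x}. w a)"
      using G inG[OF xc] x by (intro sum.mono_neutral_cong_right) (auto simp: cell_def indicator_def)
    ultimately show ?case using near[OF x] xc by simp
  qed
  have s_int: "integrable \<mu> ?s"
    by (intro Bochner_Integration.integrable_sum integrable_mult_left) (auto simp: mu.emeasure_eq_measure)
  \<comment> \<open>Integrability of \<open>?f\<close> is obtained indirectly: its distance to the
    step function \<open>?s\<close> is bounded almost everywhere, and \<open>?s\<close> is
    integrable.\<close>
  have d_int: "integrable \<mu> (\<lambda>x. ?f x - ?s x)"
    using near_AE by (intro mu.integrable_const_bound[where B="(2 * L + 4) * \<eta>"]) auto
  have f_int: "integrable \<mu> ?f"
    using Bochner_Integration.integrable_add[OF d_int s_int] by simp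
  have s_val: "(\<integral>x. ?s x \<partial>\<mu>) = conditional_W1 G G (joint_mass T)"
  proof -
    have "(\<integral>x. ?s x \<partial>\<mu>) = (\<Sum>a\<in>G. m a * w a)"
      by (subst Bochner_Integration.integral_sum)
         (auto simp: m_def mu.emeasure_eq_measure)
    then show ?thesis
      by (simp add: conditional_W1_def sum1 w_def R_def \<rho>2_def[abs_def])
  qed
  have "(LINT x:unit_cube|\<mu>. W1 (\<kappa> x) \<nu>) - (\<integral>x. ?s x \<partial>\<mu>) = (\<integral>x. ?f x - ?s x \<partial>\<mu>)"
    using f_int s_int by (simp add: set_lebesgue_integral_def)
  also have "\<bar>\<dots>\<bar> \<le> (\<integral>x. \<bar>?f x - ?s x\<bar> \<partial>\<mu>)" by (rule integral_abs_bound)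
  also have "\<dots> \<le> (\<integral>x. (2 * L + 4) * \<eta> \<partial>\<mu>)"
    using near_AE d_int by (intro integral_mono_AE) auto
  also have "\<dots> = (2 * L + 4) * \<eta>" using mu.prob_space by simp
  finally show ?thesis unfolding s_val unfolding G_def .
qed

end

section \<open>From the multiscale sum to the rate\<close>

text \<open>The thresholds 3/4 here and 4/3 in the next lemma leave room for the ratios that occur:
  sqrt 2 / 2 for d = 1, and at least sqrt 8 / 2 = sqrt 2 for d \<ge> 3. Both sums then have the
  constant 4.\<close>

lemma sum_power_le_decreasing:
  fixes t :: real assumes "0 \<le> t" "t \<le> 3/4" shows "(\<Sum>j\<le>J. t ^ j) \<le> 4"
proof -
  have "(\<Sum>j\<le>J. t ^ j) = (1 - t ^ Suc J) / (1 - t)"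
    using assms sum_gp0[of t J] by simp
  also have "\<dots> \<le> 1 / (1 - t)" using assms by (intro divide_right_mono) auto
  also have "\<dots> \<le> 4" using assms by (simp add: divide_le_eq)
  finally show ?thesis .
qed

lemma sum_power_le_increasing:
  fixes t :: real assumes "t \<ge> 4/3" shows "(\<Sum>j\<le>J. t ^ j) \<le> 4 * t ^ J"
proof (induction J)
  case (Suc J)
  have "4 * t ^ J \<le> 3 * t ^ Suc J" using assms by simp
  with Suc show ?case by simp
qed simp

text \<open>The three regimes of the rate are those of the geometric sum with ratio
  \<open>2 powr (d/2 - 1)\<close>: decreasing, constant and increasing.\<close>

lemma multiscale_rate:
  fixes d :: nat assumes d: "d \<ge> 1"
  shows "\<exists>C>0. \<forall>N\<ge>1. \<exists>J. 1 / 2 ^ J \<le> C * rate d N \<and> 1 / real (grid_m d N) \<le> C * rate d N \<and>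
     (\<Sum>j\<le>J. 1 / 2 ^ j * sqrt (real (grid_m d N) ^ d * (2 ^ j) ^ d / real N)) \<le> C * rate d N"
    (is "\<exists>C>0. \<forall>N\<ge>1. \<exists>J. ?P C N J")
proof -
  have key: "\<exists>J. 1 / 2 ^ J \<le> 2 / x \<and> 1 / real (grid_m d N) \<le> 2 / x \<and> 2 ^ J \<le> real (grid_m d N) \<and>
     real (grid_m d N) \<le> 2 * x \<and> 2 ^ J \<le> 2 * x \<and> 2 / 2 ^ J \<le> 4 / real (grid_m d N) \<and> x \<ge> 1 \<and> x \<le> N \<and>
     (\<Sum>j\<le>J. 1 / 2 ^ j * sqrt (real (grid_m d N) ^ d * (2 ^ j) ^ d / real N))
       = sqrt (real (grid_m d N) ^ d) / sqrt N * (\<Sum>j\<le>J. (sqrt (2 ^ d) / 2) ^ j)"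
    if N: "N \<ge> 1" and x: "x = real N powr grid_r d" for N x
  proof -
    define m where "m = grid_m d N"
    have r: "0 < grid_r d" "grid_r d \<le> 1" using d by (auto simp: grid_r_def field_simps)
    have x1: "x \<ge> 1" using N r by (simp add: x ge_one_powr_ge_zero)
    have xN: "x \<le> N" using N r powr_mono[of "grid_r d" 1 "real N"] by (simp add: x)
    have m1: "x \<le> m" "m \<le> x + 1"
      unfolding m_def grid_m_def x[symmetric] using x1 by linarith+
    have "m \<ge> 1" using m1 x1 by linarith
    \<comment> \<open>The finest dyadic level is matched to the mesh of the grid: 2^J lies between
      m/2 and m.\<close>
    then obtain J where J: "2 ^ J \<le> m" "m < 2 ^ (J + 1)"
      using ex_power_ivl1[of 2 m] by auto
    have J1: "2 ^ J \<le> real m" using J(1) by (metis of_nat_le_iff of_nat_numeral of_nat_power)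
    have J2: "real m \<le> 2 * 2 ^ J"
    proof -
      have "m \<le> 2 * 2 ^ J" using J(2) by simp
      then have "real m \<le> real (2 * 2 ^ J)" by (rule of_nat_mono)
      then show ?thesis by simp
    qed
    have j: "1 / 2 ^ J \<le> 2 / x"
      using x1 m1 J2 by (simp add: field_simps)
    have "(\<Sum>j\<le>J. 1 / 2 ^ j * sqrt (real m ^ d * (2 ^ j) ^ d / real N))
       = sqrt (real m ^ d) / sqrt N * (\<Sum>j\<le>J. (sqrt (2 ^ d) / 2) ^ j)"
      by (simp add: sum_distrib_left real_sqrt_mult real_sqrt_divide power_divide real_sqrt_power[symmetric]
          power_mult[symmetric] mult.commute mult_ac)
    moreover have "1 / real m \<le> 2 / x" using x1 m1 by (simp add: frac_le)
    moreover have "2 / 2 ^ J \<le> 4 / real m" using J2 x1 m1 by (simp add: field_simps)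
    moreover have "real m \<le> 2 * x" "2 ^ J \<le> 2 * x" using J1 x1 m1 by linarith+
    ultimately show ?thesis using j J1 x1 xN unfolding m_def[symmetric] by blast
  qed
  consider "d = 1" | "d = 2" | "d \<ge> 3" using d by linarith
  then show ?thesis
  proof cases
    case 1
    \<comment> \<open>The witness 8 is 2 * 4: the prefactor sqrt (m / N) is at most 2 / x, and the
      geometric sum is at most 4.\<close>
    show ?thesis
    proof (intro exI[of _ "8::real"] conjI allI impI)
      fix N :: nat assume N: "N \<ge> 1"
      define x where "x = real N powr grid_r d"
      from key[OF N x_def] obtain J where J: "1 / 2 ^ J \<le> 2 / x" "1 / real (grid_m d N) \<le> 2 / x"
        "real (grid_m d N) \<le> 2 * x" "x \<ge> 1"
        "(\<Sum>j\<le>J. 1 / 2 ^ j * sqrt (real (grid_m d N) ^ d * (2 ^ j) ^ d / real N))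
          = sqrt (real (grid_m d N) ^ d) / sqrt N * (\<Sum>j\<le>J. (sqrt (2 ^ d) / 2) ^ j)" by blast
      have rate: "rate d N = 1 / x"
        using 1 by (simp add: rate_def x_def grid_r_def powr_minus_divide)
      have x3: "real N = x ^ 3"
        using N 1 by (simp add: x_def grid_r_def powr_realpow[symmetric] powr_powr)
      have "sqrt 2 \<le> 3/2" by (rule real_le_lsqrt) (auto simp: power2_eq_square)
      then have "(\<Sum>j\<le>J. (sqrt (2 ^ d) / 2) ^ j) \<le> 4"
        using 1 by (intro sum_power_le_decreasing) auto
      moreover have "sqrt (real (grid_m d N) ^ d) / sqrt N \<le> 2 / x"
      proof -
        have "real (grid_m d N) / N \<le> 2 * x / x ^ 3"
          unfolding x3 using J by (intro divide_right_mono) auto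
        also have "\<dots> \<le> (2 / x)\<^sup>2" using J by (simp add: field_simps power2_eq_square power3_eq_cube)
        finally have "sqrt (real (grid_m d N) / N) \<le> 2 / x"
          using J by (intro real_le_lsqrt) auto
        then show ?thesis using 1 by (simp add: real_sqrt_divide)
      qed
      ultimately have "sqrt (real (grid_m d N) ^ d) / sqrt N * (\<Sum>j\<le>J. (sqrt (2 ^ d) / 2) ^ j) \<le> 2 / x * 4"
        using J by (intro mult_mono sum_nonneg) auto
      with J show "\<exists>J. ?P 8 N J"
        unfolding rate by (intro exI[of _ J]) (auto intro: order.trans simp: divide_right_mono)
    qed simp
  next
    case 2
    \<comment> \<open>The ratio is 1, so the sum is the number J + 1 of levels, at most 3 l / ln 2
      because 2^J \<le> 2 (N + 1). The prefactor is at most 2 / x, and 2 * 3 = 6.\<close>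
    define C :: real where "C = 6 / ln 2"
    have l2: "ln 2 > (0::real)" "ln 2 \<le> (1::real)" using ln_le_minus_one[of "2::real"] by auto
    show ?thesis
    proof (intro exI[of _ C] conjI allI impI)
      show "C > 0" using l2 by (simp add: C_def)
      fix N :: nat assume N: "N \<ge> 1"
      define x where "x = real N powr grid_r d"
      from key[OF N x_def] obtain J where J: "1 / 2 ^ J \<le> 2 / x" "1 / real (grid_m d N) \<le> 2 / x"
        "real (grid_m d N) \<le> 2 * x" "2 ^ J \<le> 2 * x" "x \<ge> 1" "x \<le> N"
        "(\<Sum>j\<le>J. 1 / 2 ^ j * sqrt (real (grid_m d N) ^ d * (2 ^ j) ^ d / real N))
          = sqrt (real (grid_m d N) ^ d) / sqrt N * (\<Sum>j\<le>J. (sqrt (2 ^ d) / 2) ^ j)" by blast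
      define l where "l = ln (real N + 1)"
      have l: "ln 2 \<le> l" using N by (simp add: l_def)
      have rate: "rate d N = l / x"
        using 2 by (simp add: rate_def x_def grid_r_def powr_minus_divide l_def)
      have x4: "real N = (x\<^sup>2)\<^sup>2"
        using N 2 by (simp add: x_def grid_r_def powr_realpow[symmetric] powr_powr power_mult[symmetric])
      have Jl: "real (Suc J) * ln 2 \<le> 3 * l"
      proof -
        have "real J * ln 2 = ln (2 ^ J)" by (simp add: ln_realpow)
        also have "\<dots> \<le> ln (2 * (real N + 1))" using J by (subst ln_le_cancel_iff) auto
        also have "\<dots> = ln 2 + l" using ln_mult[of 2 "real N + 1"] by (simp add: l_def)
        finally show ?thesis using l by (simp add: algebra_simps)
      qed
      have "sqrt (real (grid_m d N) ^ d) / sqrt N = real (grid_m d N) / x\<^sup>2"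
        using 2 real_sqrt_unique[OF x4[symmetric]] by simp
      also have "\<dots> \<le> 2 * x / x\<^sup>2" using J by (intro divide_right_mono) auto
      also have "\<dots> = 2 / x" using J by (simp add: power2_eq_square)
      finally have "sqrt (real (grid_m d N) ^ d) / sqrt N * (\<Sum>j\<le>J. (sqrt (2 ^ d) / 2) ^ j) \<le> 2 / x * real (Suc J)"
        using 2 J by (intro mult_mono) auto
      also have "\<dots> \<le> 2 / x * (3 * l / ln 2)"
        using Jl l2 J by (intro mult_left_mono) (auto simp: field_simps)
      also have "\<dots> = C * rate d N" by (simp add: C_def rate)
      finally have s: "sqrt (real (grid_m d N) ^ d) / sqrt N * (\<Sum>j\<le>J. (sqrt (2 ^ d) / 2) ^ j) \<le> C * rate d N" .
      have "2 / x \<le> C * rate d N"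
      proof -
        have "2 * ln 2 \<le> 6 * l" using l l2 by linarith
        then have "2 \<le> 6 / ln 2 * l" using l2 by (simp add: field_simps)
        then have "2 / x \<le> (6 / ln 2 * l) / x" using J by (intro divide_right_mono) auto
        then show ?thesis by (simp add: C_def rate)
      qed
      with J s show "\<exists>J. ?P C N J"
        by (intro exI[of _ J]) (auto intro: order.trans)
    qed
  next
    case 3
    \<comment> \<open>The last level dominates: the geometric sum is at most 2 sqrt (m^d) * 4 / m.
      With sqrt N = x^d the product is 8 m^(d-1) / x^d, and m \<le> 2 x contributes the power of
      2.\<close>
    define C :: real where "C = 8 * 2 ^ (d - 1)"
    have C: "C \<ge> 8" by (simp add: C_def)
    show ?thesis
    proof (intro exI[of _ C] conjI allI impI)
      show "C > 0" using C by simp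
      fix N :: nat assume N: "N \<ge> 1"
      define x where "x = real N powr grid_r d"
      from key[OF N x_def] obtain J where J: "1 / 2 ^ J \<le> 2 / x" "1 / real (grid_m d N) \<le> 2 / x"
        "real (grid_m d N) \<le> 2 * x" "2 ^ J \<le> real (grid_m d N)" "x \<ge> 1" "2 / 2 ^ J \<le> 4 / real (grid_m d N)"
        "(\<Sum>j\<le>J. 1 / 2 ^ j * sqrt (real (grid_m d N) ^ d * (2 ^ j) ^ d / real N))
          = sqrt (real (grid_m d N) ^ d) / sqrt N * (\<Sum>j\<le>J. (sqrt (2 ^ d) / 2) ^ j)" by blast
      define m where "m = real (grid_m d N)"
      have m: "m > 0" using J(4) by (simp add: m_def) (metis less_le_trans zero_less_numeral zero_less_power of_nat_0_less_iff)
      have rate: "rate d N = 1 / x"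
        using 3 by (simp add: rate_def x_def grid_r_def powr_minus_divide)
      have xd: "sqrt (real N) = x ^ d"
        using N 3 by (simp add: x_def grid_r_def powr_realpow[symmetric] powr_powr powr_half_sqrt[symmetric])
      have "(4/3)\<^sup>2 \<le> ((2::real) ^ d) / 4"
      proof -
        have "(2::real) ^ 3 \<le> 2 ^ d" using 3 by (intro power_increasing) auto
        then show ?thesis by (simp add: power2_eq_square)
      qed
      then have "4/3 \<le> sqrt (2 ^ d / 4)" by (rule real_le_rsqrt)
      then have "4/3 \<le> sqrt (2 ^ d) / 2" by (simp add: real_sqrt_divide)
      then have "(\<Sum>j\<le>J. (sqrt (2 ^ d) / 2) ^ j) \<le> 4 * (sqrt (2 ^ d) / 2) ^ J"
        by (rule sum_power_le_increasing)
      also have "\<dots> = 2 * sqrt ((2 ^ J) ^ d) * (2 / 2 ^ J)"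
        by (simp add: power_divide real_sqrt_power[symmetric] power_mult[symmetric] mult.commute)
      also have "\<dots> \<le> 2 * sqrt (m ^ d) * (4 / m)"
        using J by (intro mult_mono) (auto simp: m_def intro!: power_mono)
      finally have "sqrt (m ^ d) / sqrt N * (\<Sum>j\<le>J. (sqrt (2 ^ d) / 2) ^ j)
          \<le> sqrt (m ^ d) / x ^ d * (2 * sqrt (m ^ d) * (4 / m))"
        unfolding xd using J m by (intro mult_left_mono) auto
      also have "\<dots> = 8 * m ^ d / m / x ^ d"
        using m by (simp add: field_simps power2_eq_square[symmetric])
      also have "\<dots> = 8 * m ^ (d - 1) / x ^ d"
        using m 3 by (cases d) auto
      also have "\<dots> \<le> 8 * (2 * x) ^ (d - 1) / x ^ d"
        using J m by (intro divide_right_mono mult_left_mono power_mono) (auto simp: m_def)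
      also have "\<dots> = C * rate d N"
        unfolding rate using J 3 by (cases d) (auto simp: C_def power_mult_distrib)
      finally have s: "sqrt (m ^ d) / sqrt N * (\<Sum>j\<le>J. (sqrt (2 ^ d) / 2) ^ j) \<le> C * rate d N" .
      have "2 / x \<le> C * rate d N" using C J by (simp add: rate divide_right_mono)
      with J s show "\<exists>J. ?P C N J"
        unfolding m_def by (intro exI[of _ J]) (auto intro: order.trans)
    qed
  qed
qed

section \<open>Geometry of the grid and of the dyadic cells\<close>

lemma grid_m_pos: "N \<ge> 1 \<Longrightarrow> grid_m d N \<ge> 1"
proof -
  assume "N \<ge> 1"
  then have "real N powr grid_r d > 0" by simp
  then have "\<lceil>real N powr grid_r d\<rceil> \<ge> 1" by linarith
  then show ?thesis unfolding grid_m_def by linarith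
qed

lemma phiN_nth:
  "phiN N (x :: real ^ 'd) $ i = (real_of_int (min \<lfloor>real (grid_m CARD('d) N) * x $ i\<rfloor> (int (grid_m CARD('d) N) - 1)) + 1/2)
     / real (grid_m CARD('d) N)"
  by (simp add: phiN_def Let_def)

lemma borel_measurable_phiN [measurable]: "phiN N \<in> borel_measurable borel"
proof (subst borel_measurable_euclidean_space, intro ballI)
  fix b :: "real ^ 'd" assume "b \<in> Basis"
  then obtain i where b: "b = axis i 1" by (auto simp: Basis_vec_def)
  have [measurable]: "(\<lambda>x::real ^ 'd. x $ i) \<in> borel_measurable borel"
    by (intro borel_measurable_continuous_onI continuous_intros)
  show "(\<lambda>x. phiN N x \<bullet> b) \<in> borel_measurable borel"
    unfolding b inner_axis phiN_nth by measurable
qed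

text \<open>Outside the cube \<open>phiN\<close> takes further values, as the index is not cut off
  from below. Countability is enough for the measurability of the empirical functional.\<close>

lemma countable_range_phiN: "countable (range (phiN N :: real ^ 'd \<Rightarrow> _))"
proof -
  let ?m = "real (grid_m CARD('d) N)"
  have "range (phiN N :: real ^ 'd \<Rightarrow> _) \<subseteq> range (\<lambda>k :: 'd \<Rightarrow> int. \<chi> i. (real_of_int (k i) + 1/2) / ?m)"
    by (auto simp: phiN_def Let_def)
  then show ?thesis by (rule countable_subset) simp
qed

lemma phiN_unit_cube:
  fixes x :: "real ^ 'd"
  assumes N: "N \<ge> 1" and x: "x \<in> unit_cube"
  shows "\<exists>k :: 'd \<Rightarrow> int. (\<forall>i. 0 \<le> k i \<and> k i < int (grid_m CARD('d) N)) \<and>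
      phiN N x = (\<chi> i. (real_of_int (k i) + 1/2) / real (grid_m CARD('d) N))"
    and "\<bar>x $ i - phiN N x $ i\<bar> \<le> 1 / real (grid_m CARD('d) N)"
proof -
  define m where "m = grid_m CARD('d) N"
  have m: "m \<ge> 1" using grid_m_pos[OF N] by (simp add: m_def)
  define k where "k i = min \<lfloor>real m * x $ i\<rfloor> (int m - 1)" for i
  have xi: "0 \<le> x $ i" "x $ i \<le> 1" for i using x by (auto simp: unit_cube_def)
  have mx: "0 \<le> real m * x $ i" "real m * x $ i \<le> real m" for i
    using xi[of i] m by (auto simp: mult_left_le)
  have "0 \<le> k i" "k i < int m" for i
    using mx[of i] m unfolding k_def by linarith+
  moreover have "phiN N x = (\<chi> i. (real_of_int (k i) + 1/2) / real m)"
    by (simp add: phiN_def Let_def k_def m_def)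
  ultimately show "\<exists>k :: 'd \<Rightarrow> int. (\<forall>i. 0 \<le> k i \<and> k i < int (grid_m CARD('d) N)) \<and>
      phiN N x = (\<chi> i. (real_of_int (k i) + 1/2) / real (grid_m CARD('d) N))"
    unfolding m_def by (intro exI[of _ k]) simp
  have "\<bar>real m * x $ i - (real_of_int (k i) + 1/2)\<bar> \<le> 1"
    using mx[of i] unfolding k_def by linarith
  moreover have "real m * x $ i - (real_of_int (k i) + 1/2) = real m * (x $ i - phiN N x $ i)"
    using m unfolding phiN_nth m_def[symmetric] k_def by (simp add: right_diff_distrib)
  ultimately have "real m * \<bar>x $ i - phiN N x $ i\<bar> \<le> 1"
    using m by (simp add: abs_mult)
  then show "\<bar>x $ i - phiN N x $ i\<bar> \<le> 1 / real (grid_m CARD('d) N)"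
    using m unfolding m_def[symmetric] by (simp add: field_simps)
qed

text \<open>Comparison with the l1 norm. The factor \<open>CARD('d)\<close> in the rounding error
  and in the diameters of the dyadic cells originates here.\<close>

lemma dist_le_card_mult:
  fixes x y :: "real ^ 'd" and c :: real
  assumes "\<And>i. \<bar>x $ i - y $ i\<bar> \<le> c"
  shows "dist x y \<le> CARD('d) * c"
proof -
  have "dist x y \<le> (\<Sum>i\<in>UNIV. \<bar>(x - y) $ i\<bar>)"
    unfolding dist_norm by (rule norm_le_l1_cart)
  also have "\<dots> \<le> (\<Sum>i\<in>(UNIV :: 'd set). c)" using assms by (intro sum_mono) simp
  finally show ?thesis by simp
qed

lemma dist_phiN_le:
  fixes x :: "real ^ 'd"
  assumes "N \<ge> 1" "x \<in> unit_cube"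
  shows "dist x (phiN N x) \<le> CARD('d) / real (grid_m CARD('d) N)"
proof -
  have "dist x (phiN N x) \<le> CARD('d) * (1 / real (grid_m CARD('d) N))"
    by (rule dist_le_card_mult[OF phiN_unit_cube(2)[OF assms]])
  then show ?thesis by simp
qed

lemma grid_points:
  assumes "N \<ge> 1"
  shows "finite (phiN N ` (unit_cube :: (real ^ 'd) set))"
    and "card (phiN N ` (unit_cube :: (real ^ 'd) set)) \<le> grid_m CARD('d) N ^ CARD('d)"
proof -
  define m where "m = grid_m CARD('d) N"
  let ?F = "UNIV \<rightarrow>\<^sub>E {0..<int m} :: ('d \<Rightarrow> int) set"
  have "phiN N x \<in> (\<lambda>k. \<chi> i. (real_of_int (k i) + 1/2) / real m) ` ?F" if x: "x \<in> unit_cube" for x :: "real ^ 'd"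
  proof -
    obtain k where "\<forall>i. 0 \<le> k i \<and> k i < int m" "phiN N x = (\<chi> i. (real_of_int (k i) + 1/2) / real m)"
      using phiN_unit_cube(1)[OF assms x] unfolding m_def by blast
    then show ?thesis by (intro image_eqI[of _ _ k]) auto
  qed
  then have sub: "phiN N ` (unit_cube :: (real ^ 'd) set) \<subseteq> (\<lambda>k. \<chi> i. (real_of_int (k i) + 1/2) / real m) ` ?F"
    by blast
  have F: "finite ?F" by (intro finite_PiE) auto
  show "finite (phiN N ` (unit_cube :: (real ^ 'd) set))"
    using sub F by (rule finite_subset[OF _ finite_imageI])
  have "card (phiN N ` (unit_cube :: (real ^ 'd) set)) \<le> card ?F"
    using surj_card_le[OF F sub] .
  also have "\<dots> = m ^ CARD('d)" by (simp add: card_PiE)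
  finally show "card (phiN N ` (unit_cube :: (real ^ 'd) set)) \<le> grid_m CARD('d) N ^ CARD('d)"
    by (simp add: m_def)
qed

text \<open>Centers stay away from the upper faces of the cube, so the half-open dyadic cubes cover
  them: one cube at level 0, and at most 2^(jd) at level j.\<close>

lemma grid_point_interior:
  fixes b :: "real ^ 'd"
  assumes "N \<ge> 1" "b \<in> phiN N ` unit_cube"
  shows "0 \<le> b $ i" "b $ i < 1"
proof -
  obtain x :: "real ^ 'd" where x: "x \<in> unit_cube" "b = phiN N x" using assms(2) by auto
  obtain k where k: "\<forall>i. 0 \<le> k i \<and> k i < int (grid_m CARD('d) N)"
    "phiN N x = (\<chi> i. (real_of_int (k i) + 1/2) / real (grid_m CARD('d) N))"
    using phiN_unit_cube(1)[OF assms(1) x(1)] by blast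
  then have ki: "0 \<le> k i" "k i < int (grid_m CARD('d) N)" by auto
  have m: "real (grid_m CARD('d) N) > 0" using grid_m_pos[OF assms(1), of "CARD('d)"] by simp
  show "0 \<le> b $ i" using ki m by (simp add: x(2) k(2))
  have "real_of_int (k i) + 1/2 < real (grid_m CARD('d) N)" using ki by linarith
  then show "b $ i < 1" using m by (simp add: x(2) k(2) divide_less_eq)
qed

text \<open>Index of the half-open dyadic cube of edge 2^(-j). These cubes only group the centers;
  they need not be unions of grid cubes, since \<open>grid_m\<close> need not be a power of
  2.\<close>

definition dyadic_cell :: "nat \<Rightarrow> real ^ 'd \<Rightarrow> 'd \<Rightarrow> int" where
  "dyadic_cell j b = (\<lambda>i. \<lfloor>2 ^ j * b $ i\<rfloor>)"

lemma dyadic_cell_0: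
  assumes "\<And>i. 0 \<le> b $ i" "\<And>i. b $ i < 1"
  shows "dyadic_cell 0 b = (\<lambda>_. 0)"
  using assms by (auto simp: dyadic_cell_def floor_eq_iff)

lemma dyadic_cell_refine:
  assumes "dyadic_cell (Suc j) a = dyadic_cell (Suc j) b"
  shows "dyadic_cell j a = dyadic_cell j b"
proof -
  have "\<lfloor>2 ^ j * c $ i\<rfloor> = \<lfloor>2 ^ Suc j * c $ i\<rfloor> div 2" for c :: "real ^ 'd" and i
    using floor_divide_real_eq_div[of 2 "2 ^ Suc j * c $ i"] by simp
  note half = this
  have "\<lfloor>2 ^ j * a $ i\<rfloor> = \<lfloor>2 ^ j * b $ i\<rfloor>" for i
    using fun_cong[OF assms, of i] unfolding half[of a i] half[of b i] by (simp only: dyadic_cell_def)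
  then show ?thesis by (simp add: dyadic_cell_def)
qed

lemma dyadic_cell_dist:
  fixes a b :: "real ^ 'd"
  assumes "dyadic_cell j a = dyadic_cell j b"
  shows "dist a b \<le> CARD('d) / 2 ^ j"
proof -
  have "\<bar>a $ i - b $ i\<bar> \<le> 1 / 2 ^ j" for i
  proof -
    have "\<lfloor>2 ^ j * a $ i\<rfloor> = \<lfloor>2 ^ j * b $ i\<rfloor>" using fun_cong[OF assms, of i] by (simp add: dyadic_cell_def)
    then have "\<bar>2 ^ j * a $ i - 2 ^ j * b $ i\<bar> \<le> 1" by linarith
    then have "2 ^ j * \<bar>a $ i - b $ i\<bar> \<le> 1"
      by (simp add: right_diff_distrib[symmetric] abs_mult)
    then show ?thesis by (simp add: field_simps)
  qed
  from dist_le_card_mult[of a b, OF this] show ?thesis by simp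
qed

lemma card_dyadic_cells_le:
  fixes G :: "(real ^ 'd) set"
  assumes "\<And>b i. b \<in> G \<Longrightarrow> 0 \<le> b $ i" "\<And>b i. b \<in> G \<Longrightarrow> b $ i < 1"
  shows "card (dyadic_cell j ` G) \<le> (2 ^ j) ^ CARD('d)"
proof -
  let ?F = "UNIV \<rightarrow>\<^sub>E {0..<2 ^ j} :: ('d \<Rightarrow> int) set"
  have "dyadic_cell j ` G \<subseteq> ?F"
    using assms by (auto simp: dyadic_cell_def floor_less_iff)
  then have "card (dyadic_cell j ` G) \<le> card ?F"
    by (intro card_mono finite_PiE) auto
  also have "\<dots> = (2 ^ j) ^ CARD('d)"
    by (simp add: card_PiE nat_power_eq)
  finally show ?thesis .
qed

section \<open>The empirical measure as a finite mass function\<close>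

lemma prob_cond_pmf:
  assumes "set_pmf p \<inter> s \<noteq> {}"
  shows "measure_pmf.prob (cond_pmf p s) A = measure_pmf.prob p (s \<inter> A) / measure_pmf.prob p s"
  using assms by (simp add: cond_pmf.rep_eq measure_pmf.emeasure_eq_measure measure_measure_pmf_not_zero)

lemma pmf_to_borel_eq_atomic_measure:
  fixes p :: "'a::t1_space pmf"
  assumes "finite G" "set_pmf p \<subseteq> G"
  shows "pmf_to_borel p = atomic_measure G (pmf p)"
proof (rule eq_atomic_measureI)
  have m: "(\<lambda>x. x) \<in> measure_pmf p \<rightarrow>\<^sub>M borel" by simp
  have fin: "F \<in> sets borel" if "finite F" for F :: "'a set"
    using that by (simp add: finite_imp_closed borel_closed)
  show "prob_space (pmf_to_borel p)"
    unfolding pmf_to_borel_def by (intro measure_pmf.prob_space_distr m)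
  show "measure (pmf_to_borel p) {a} = pmf p a" for a
    unfolding pmf_to_borel_def using fin[of "{a}"]
    by (subst measure_distr[OF m]) (auto simp: measure_pmf_single)
  have "AE x in measure_pmf p. x \<in> G" using assms by (auto simp: AE_measure_pmf_iff)
  then have "measure_pmf.prob p G = 1" by (subst measure_pmf.prob_eq_1) auto
  then show "measure (pmf_to_borel p) G = 1"
    unfolding pmf_to_borel_def using fin[OF assms(1)] by (subst measure_distr[OF m]) auto
qed (use assms in \<open>auto simp: pmf_to_borel_def\<close>)

text \<open>\<open>cond_pmf\<close> and the quotient on the right are meaningful only at atoms with
  positive mass, where they agree. At the other points both summands have weight 0.\<close>

lemma expectation_cond_W1_eq_conditional_W1:
  fixes p :: "('a::metric_space \<times> 'a) pmf"
  assumes G: "finite G" and p: "set_pmf p \<subseteq> G \<times> G"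
  shows "measure_pmf.expectation (map_pmf fst p)
       (\<lambda>a. W1 (pmf_to_borel (map_pmf snd (cond_pmf p {z. fst z = a}))) (pmf_to_borel (map_pmf snd p)))
     = conditional_W1 G G (\<lambda>a b. pmf p (a, b))"
proof -
  have restr: "measure_pmf.prob p S = (\<Sum>z\<in>S \<inter> G \<times> G. pmf p z)" for S
  proof -
    have "measure_pmf.prob p S = measure_pmf.prob p (S \<inter> G \<times> G)"
      using p by (intro measure_pmf.finite_measure_eq_AE) (auto simp: AE_measure_pmf_iff)
    also have "\<dots> = (\<Sum>z\<in>S \<inter> G \<times> G. pmf p z)" using G by (intro measure_measure_pmf_finite) auto
    finally show ?thesis .
  qed
  have row: "pmf (map_pmf fst p) a = (\<Sum>b\<in>G. pmf p (a, b))" if "a \<in> G" for a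
    unfolding pmf_map restr using that
    by (intro sum.reindex_bij_witness[of _ "\<lambda>b. (a, b)" snd]) auto
  have col: "pmf (map_pmf snd p) b = (\<Sum>a\<in>G. pmf p (a, b))" if "b \<in> G" for b
    unfolding pmf_map restr using that
    by (intro sum.reindex_bij_witness[of _ "\<lambda>a. (a, b)" fst]) auto
  have snd_p: "pmf_to_borel (map_pmf snd p) = atomic_measure G (\<lambda>b. \<Sum>a\<in>G. pmf p (a, b))"
    using p col by (subst pmf_to_borel_eq_atomic_measure[OF G]) (auto intro!: atomic_measure_cong G)
  have cond: "pmf_to_borel (map_pmf snd (cond_pmf p {z. fst z = a}))
      = atomic_measure G (\<lambda>b. pmf p (a, b) / (\<Sum>b\<in>G. pmf p (a, b)))"
    if a: "a \<in> G" "pmf (map_pmf fst p) a \<noteq> 0" for a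
  proof -
    have ne: "set_pmf p \<inter> {z. fst z = a} \<noteq> {}" using a(2) by (auto simp: set_pmf_iff[symmetric])
    have mass: "measure_pmf.prob p {z. fst z = a} = (\<Sum>b\<in>G. pmf p (a, b))"
      using row[OF a(1)] by (simp add: pmf_map vimage_def)
    have "pmf (map_pmf snd (cond_pmf p {z. fst z = a})) b = pmf p (a, b) / (\<Sum>b\<in>G. pmf p (a, b))" for b
    proof -
      have "{z. fst z = a} \<inter> snd -` {b} = {(a, b)}" by auto
      then show ?thesis
        by (simp add: pmf_map prob_cond_pmf[OF ne] mass measure_pmf_single)
    qed
    then show ?thesis
      using p set_cond_pmf[OF ne]
      by (subst pmf_to_borel_eq_atomic_measure[OF G]) (auto intro!: atomic_measure_cong G)
  qed
  have "measure_pmf.expectation (map_pmf fst p)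
       (\<lambda>a. W1 (pmf_to_borel (map_pmf snd (cond_pmf p {z. fst z = a}))) (pmf_to_borel (map_pmf snd p)))
    = (\<Sum>a\<in>G. W1 (pmf_to_borel (map_pmf snd (cond_pmf p {z. fst z = a}))) (pmf_to_borel (map_pmf snd p))
         * pmf (map_pmf fst p) a)"
    using p by (intro integral_measure_pmf_real[OF G]) auto
  also have "\<dots> = conditional_W1 G G (\<lambda>a b. pmf p (a, b))"
    unfolding conditional_W1_def
  proof (rule sum.cong[OF refl])
    fix a assume "a \<in> G"
    then show "W1 (pmf_to_borel (map_pmf snd (cond_pmf p {z. fst z = a}))) (pmf_to_borel (map_pmf snd p))
         * pmf (map_pmf fst p) a
       = (\<Sum>b\<in>G. pmf p (a, b)) * W1 (atomic_measure G (\<lambda>b. pmf p (a, b) / (\<Sum>b\<in>G. pmf p (a, b))))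
            (atomic_measure G (\<lambda>b. \<Sum>a\<in>G. pmf p (a, b)))"
      using cond[of a] by (cases "pmf (map_pmf fst p) a = 0") (auto simp: row snd_p)
  qed
  finally show ?thesis .
qed

lemma prob_emp_pi:
  assumes "N \<ge> 1"
  shows "measure_pmf.prob (emp_pi N X1 X2 w) S
    = (\<Sum>n\<in>{1..N}. indicator S (phiN N (X1 n w), phiN N (X2 n w))) / real N"
proof -
  let ?f = "\<lambda>n. (phiN N (X1 n w), phiN N (X2 n w))"
  \<comment> \<open>The empirical measure is the image of the uniform law on the sample indices,
    which counts coinciding observations with multiplicity.\<close>
  have "mset (map ?f [1..<N+1]) = image_mset ?f (mset_set {1..N})"
    using mset_upt[of 1 "N + 1"] by (simp add: atLeastLessThanSuc_atLeastAtMost)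
  then have "emp_pi N X1 X2 w = map_pmf ?f (pmf_of_set {1..N})"
    unfolding emp_pi_def using assms by (subst map_pmf_of_set) auto
  then have "measure_pmf.prob (emp_pi N X1 X2 w) S = real (card ({1..N} \<inter> ?f -` S)) / real N"
    using assms by (simp add: measure_pmf_of_set)
  also have "real (card ({1..N} \<inter> ?f -` S)) = (\<Sum>n\<in>{1..N}. indicator S (?f n))"
    by (simp add: indicator_def sum.If_cases Int_def)
  finally show ?thesis .
qed

lemma set_emp_pi:
  assumes "N \<ge> 1"
  shows "set_pmf (emp_pi N X1 X2 w) = (\<lambda>n. (phiN N (X1 n w), phiN N (X2 n w))) ` {1..N}"
  unfolding emp_pi_def using assms by (subst set_pmf_of_multiset) (auto simp: image_iff simp del: upt_Suc mset_upt mset_map)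

text \<open>The functional depends on the sample only through the list of rounded observations.
  These lists form a countable set, on which every function is measurable, so nothing about the
  regularity of \<open>W1\<close> enters.\<close>

lemma emp_AW_int_measurable:
  fixes X1 X2 :: "nat \<Rightarrow> 'w \<Rightarrow> real ^ 'd"
  assumes X: "\<And>n. n \<in> {1..N} \<Longrightarrow> X1 n \<in> borel_measurable M" "\<And>n. n \<in> {1..N} \<Longrightarrow> X2 n \<in> borel_measurable M"
  shows "emp_AW_int N X1 X2 \<in> borel_measurable M"
proof -
  define Z where "Z w = map (\<lambda>n. (phiN N (X1 n w), phiN N (X2 n w))) [1..<N+1]" for w
  define F where "F l = (let p = pmf_of_multiset (mset l) in measure_pmf.expectation (map_pmf fst p)
       (\<lambda>a. W1 (pmf_to_borel (map_pmf snd (cond_pmf p {z. fst z = a}))) (pmf_to_borel (map_pmf snd p))))"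
    for l :: "((real ^ 'd) \<times> (real ^ 'd)) list"
  let ?R = "range (phiN N :: real ^ 'd \<Rightarrow> real ^ 'd)"
  let ?L = "lists (?R \<times> ?R)"
  have cnt: "countable ?L" using countable_range_phiN by (intro countable_lists countable_SIGMA)
  have eq: "emp_AW_int N X1 X2 = (\<lambda>w. F (Z w))"
    by (simp add: emp_AW_int_def emp_pi_def F_def Z_def fun_eq_iff)
  have "Z \<in> M \<rightarrow>\<^sub>M count_space ?L"
  proof (rule measurable_count_space_eq_countable[OF cnt, THEN iffD2], intro conjI ballI)
    show "Z \<in> space M \<rightarrow> ?L" by (auto simp: Z_def)
    fix l assume "l \<in> ?L"
    show "Z -` {l} \<inter> space M \<in> sets M"
    proof (cases "length l = N")
      case True
      \<comment> \<open>The list starts with observation 1, so position \<open>i\<close> holds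
        observation \<open>Suc i\<close>.\<close>
      then have "Z w = l \<longleftrightarrow> (\<forall>i<N. (phiN N (X1 (Suc i) w), phiN N (X2 (Suc i) w)) = l ! i)" for w
        by (auto simp: list_eq_iff_nth_eq Z_def simp del: upt_Suc)
      then have "Z -` {l} \<inter> space M = {w\<in>space M. \<forall>i\<in>{..<N}.
          phiN N (X1 (Suc i) w) = fst (l ! i) \<and> phiN N (X2 (Suc i) w) = snd (l ! i)}"
        by (auto simp: prod_eq_iff)
      also have "\<dots> \<in> sets M"
      proof (intro sets.sets_Collect_finite_All sets.sets_Collect_conj)
        fix i assume i: "i \<in> {..<N}"
        then have [measurable]: "X1 (Suc i) \<in> borel_measurable M" "X2 (Suc i) \<in> borel_measurable M"
          by (auto intro: X)
        show "{w\<in>space M. phiN N (X1 (Suc i) w) = fst (l ! i)} \<in> sets M"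
          "{w\<in>space M. phiN N (X2 (Suc i) w) = snd (l ! i)} \<in> sets M" by measurable
      qed auto
      finally show ?thesis .
    next
      case False
      then have "Z -` {l} \<inter> space M = {}" by (auto simp: Z_def simp del: upt_Suc)
      then show ?thesis by simp
    qed
  qed
  then have "(\<lambda>w. F (Z w)) \<in> borel_measurable M"
    by (rule measurable_compose) simp
  then show ?thesis by (simp add: eq)
qed

lemma sum_sqrt_le_sqrt_card:
  assumes "\<And>s. s \<in> S \<Longrightarrow> 0 \<le> p s"
  shows "(\<Sum>s\<in>S. sqrt (p s)) \<le> sqrt (real (card S) * (\<Sum>s\<in>S. p s))"
proof (rule real_le_rsqrt)
  have "(\<Sum>s\<in>S. sqrt (p s))\<^sup>2 \<le> (\<Sum>s\<in>S. (sqrt (p s))\<^sup>2) * card S"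
    by (rule sum_squared_le_sum_of_squares)
  also have "(\<Sum>s\<in>S. (sqrt (p s))\<^sup>2) = (\<Sum>s\<in>S. p s)" using assms by (intro sum.cong) auto
  finally show "(\<Sum>s\<in>S. sqrt (p s))\<^sup>2 \<le> real (card S) * (\<Sum>s\<in>S. p s)" by (simp add: mult.commute)
qed

section \<open>Reduction to deviations of cell frequencies\<close>

context lipschitz_kernel
begin

text \<open>The index pairs the exact grid point of the first coordinate with the dyadic cell of the
  second. Requiring a center coming from the cube makes the event a finite disjoint union over grid
  points, so that joint masses add up to its probability.\<close>

definition cell_event :: "nat \<Rightarrow> nat \<Rightarrow> (real ^ 'd) \<times> ('d \<Rightarrow> int) \<Rightarrow> ((real ^ 'd) \<times> (real ^ 'd)) set" where
  "cell_event N j s = {z. phiN N (fst z) = fst s \<and> phiN N (snd z) \<in> phiN N ` unit_cube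
      \<and> dyadic_cell j (phiN N (snd z)) = snd s}"

definition grid_cells :: "nat \<Rightarrow> nat \<Rightarrow> ((real ^ 'd) \<times> ('d \<Rightarrow> int)) set" where
  "grid_cells N j = phiN N ` unit_cube \<times> dyadic_cell j ` phiN N ` unit_cube"

lemma finite_grid_cells: "N \<ge> 1 \<Longrightarrow> finite (grid_cells N j)"
  by (simp add: grid_cells_def grid_points(1))

lemma card_grid_cells_le: 
  assumes "N \<ge> 1"
  shows "card (grid_cells N j) \<le> grid_m CARD('d) N ^ CARD('d) * (2 ^ j) ^ CARD('d)"
  unfolding grid_cells_def card_cartesian_product
  by (intro mult_le_mono grid_points(2)[OF assms] card_dyadic_cells_le grid_point_interior[OF assms])

lemma phiN_event_sets:
  assumes N: "N \<ge> 1" and B: "B \<subseteq> phiN N ` unit_cube"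
  shows "{z. phiN N (fst z) = a \<and> phiN N (snd z) \<in> B} \<in> sets \<pi>"
proof -
  have "finite B" using B grid_points(1)[OF N] finite_subset by blast
  then have [measurable]: "B \<in> sets borel" by (simp add: finite_imp_closed borel_closed)
  have "{z\<in>space \<pi>. phiN N (fst z) = a \<and> phiN N (snd z) \<in> B} \<in> sets \<pi>" by measurable
  then show ?thesis by (simp add: space_pi)
qed

lemma cell_event_eq:
  "cell_event N j (a, Q) = {z. phiN N (fst z) = a \<and> phiN N (snd z) \<in> {b \<in> phiN N ` unit_cube. dyadic_cell j b = Q}}"
  by (auto simp: cell_event_def)

lemma cell_event_sets: "N \<ge> 1 \<Longrightarrow> cell_event N j s \<in> sets \<pi>"
  by (cases s) (simp only: cell_event_eq, intro phiN_event_sets, auto)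

lemma sum_joint_mass_cell:
  assumes N: "N \<ge> 1"
  shows "(\<Sum>b\<in>{b \<in> phiN N ` unit_cube. dyadic_cell j b = Q}. joint_mass (phiN N) a b) = measure \<pi> (cell_event N j (a, Q))"
proof -
  let ?B = "{b \<in> phiN N ` unit_cube. dyadic_cell j b = Q}"
  have fin: "finite ?B" by (rule finite_subset[OF _ grid_points(1)[OF N]]) auto
  have "(\<Sum>b\<in>?B. joint_mass (phiN N) a b) = measure \<pi> (\<Union>b\<in>?B. {z. phiN N (fst z) = a \<and> phiN N (snd z) = b})"
    unfolding joint_mass_def using fin phiN_event_sets[OF N, of "{_}" a]
    by (intro pi.finite_measure_finite_Union[symmetric]) (auto simp: disjoint_family_on_def)
  also have "(\<Union>b\<in>?B. {z. phiN N (fst z) = a \<and> phiN N (snd z) = b}) = cell_event N j (a, Q)"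
    unfolding cell_event_eq by auto
  finally show ?thesis .
qed

text \<open>At a fixed level, a point determines the index of the only event that can contain it.
  This keeps the difference constant of the final statistic bounded.\<close>

lemma sum_cell_event_indicator_le:
  assumes N: "N \<ge> 1"
  shows "(\<Sum>s\<in>grid_cells N j. indicator (cell_event N j s) z :: real) \<le> 1"
proof -
  let ?s = "(phiN N (fst z), dyadic_cell j (phiN N (snd z)))"
  have "(\<Sum>s\<in>grid_cells N j. indicator (cell_event N j s) z :: real) \<le> (\<Sum>s\<in>grid_cells N j. if s = ?s then 1 else 0)"
    by (intro sum_mono) (auto simp: cell_event_def indicator_def)
  also have "\<dots> \<le> 1" using finite_grid_cells[OF N] by (simp add: sum.delta)
  finally show ?thesis .
qed

lemma sum_cell_event_measure_le:
  assumes N: "N \<ge> 1"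
  shows "(\<Sum>s\<in>grid_cells N j. measure \<pi> (cell_event N j s)) \<le> 1"
proof -
  have "(\<Sum>s\<in>grid_cells N j. measure \<pi> (cell_event N j s)) = measure \<pi> (\<Union>s\<in>grid_cells N j. cell_event N j s)"
    using finite_grid_cells[OF N] cell_event_sets[OF N]
    by (intro pi.finite_measure_finite_Union[symmetric]) (auto simp: disjoint_family_on_def cell_event_def prod_eq_iff)
  then show ?thesis by simp
qed

text \<open>A deterministic estimate for every sample in the cube: the rounding error of \<pi>, the
  diameter of the finest cells, and a weighted sum of frequency deviations, which is the only random
  term.\<close>

lemma empirical_deviation_le:
  assumes N: "N \<ge> 1" and X: "\<And>n. n \<in> {1..N} \<Longrightarrow> X1 n w \<in> unit_cube" "\<And>n. n \<in> {1..N} \<Longrightarrow> X2 n w \<in> unit_cube"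
  shows "\<bar>emp_AW_int N X1 X2 w - (LINT x:unit_cube|\<mu>. W1 (\<kappa> x) \<nu>)\<bar>
     \<le> (2 * L + 4) * (CARD('d) / real (grid_m CARD('d) N)) + 2 * (CARD('d) / 2 ^ J)
       + (\<Sum>j\<le>J. 6 * CARD('d) / 2 ^ j * (\<Sum>s\<in>grid_cells N j.
           \<bar>(\<Sum>n\<in>{1..N}. indicator (cell_event N j s) (X1 n w, X2 n w)) / real N - measure \<pi> (cell_event N j s)\<bar>))"
proof -
  define G where "G = phiN N ` (unit_cube :: (real ^ 'd) set)"
  define p where "p = emp_pi N X1 X2 w"
  let ?\<rho> = "joint_mass (phiN N)" and ?e = "\<lambda>a b. pmf p (a, b)"
  let ?dev = "\<lambda>j s. \<bar>(\<Sum>n\<in>{1..N}. indicator (cell_event N j s) (X1 n w, X2 n w)) / real N - measure \<pi> (cell_event N j s)\<bar>"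
  have G: "finite G" unfolding G_def by (rule grid_points(1)[OF N])
  have p: "set_pmf p \<subseteq> G \<times> G" using X by (auto simp: p_def set_emp_pi[OF N] G_def)
  have "emp_AW_int N X1 X2 w = conditional_W1 G G ?e"
    unfolding emp_AW_int_def Let_def p_def[symmetric] by (rule expectation_cond_W1_eq_conditional_W1[OF G p])
  moreover have "\<bar>(LINT x:unit_cube|\<mu>. W1 (\<kappa> x) \<nu>) - conditional_W1 G G ?\<rho>\<bar>
      \<le> (2 * L + 4) * (CARD('d) / real (grid_m CARD('d) N))"
    unfolding G_def by (intro discretization_error borel_measurable_phiN grid_points(1) dist_phiN_le N)
  moreover have "\<bar>conditional_W1 G G ?e - conditional_W1 G G ?\<rho>\<bar> \<le> 2 * (CARD('d) / 2 ^ J)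
      + (\<Sum>j\<le>J. 6 * CARD('d) / 2 ^ j * (\<Sum>s\<in>grid_cells N j. ?dev j s))"
  proof -
    define \<Delta> where "\<Delta> j = (\<Sum>a\<in>G. class_deviation (dyadic_cell j) G (\<lambda>b. ?e a b - ?\<rho> a b))" for j
    have e1: "(\<Sum>a\<in>G. sum (?e a) G) = 1"
      using sum_pmf_eq_1[OF finite_cartesian_product[OF G G] p] by (simp add: sum.cartesian_product case_prod_unfold)
    have \<rho>1: "(\<Sum>a\<in>G. sum (?\<rho> a) G) = 1"
    proof -
      have "(\<Sum>b\<in>G. \<Sum>a\<in>G. ?\<rho> a b) = (\<Sum>b\<in>G. measure \<nu> {y. phiN N y = b})"
        unfolding G_def by (intro sum.cong refl joint_mass_snd_marginal borel_measurable_phiN grid_points(1)[OF N])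
      also have "\<dots> = 1"
      proof (rule distr_eq_atomic_measure(2)[OF nu.prob_space_axioms _ borel_measurable_phiN G])
        show "AE y in \<nu>. phiN N y \<in> G" using AE_nu_cube by eventually_elim (simp add: G_def)
      qed simp
      finally show ?thesis by (subst sum.swap)
    qed
    have \<Delta>_eq: "\<Delta> j = (\<Sum>s\<in>grid_cells N j. ?dev j s)" for j
    proof -
      have "(\<Sum>b\<in>{b\<in>G. dyadic_cell j b = Q}. ?e a b)
          = (\<Sum>n\<in>{1..N}. indicator (cell_event N j (a, Q)) (X1 n w, X2 n w)) / real N" for a Q
      proof -
        let ?B = "{b\<in>G. dyadic_cell j b = Q}"
        have "(\<Sum>b\<in>?B. ?e a b) = (\<Sum>z\<in>{a} \<times> ?B. pmf p z)"
          by (rule sum.reindex_bij_witness[of _ snd "\<lambda>b. (a, b)"]) auto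
        also have "\<dots> = measure_pmf.prob p ({a} \<times> ?B)"
          using G by (intro measure_measure_pmf_finite[symmetric]) auto
        also have "\<dots> = (\<Sum>n\<in>{1..N}. indicator (cell_event N j (a, Q)) (X1 n w, X2 n w)) / real N"
          unfolding p_def prob_emp_pi[OF N] cell_event_eq G_def
          by (intro arg_cong2[where f="(/)"] sum.cong) (auto simp: indicator_def)
        finally show ?thesis .
      qed
      then have "\<Delta> j = (\<Sum>a\<in>G. \<Sum>Q\<in>dyadic_cell j ` G. ?dev j (a, Q))"
        using sum_joint_mass_cell[OF N, where j=j] unfolding \<Delta>_def class_deviation_def sum_subtractf G_def by simp
      then show ?thesis by (simp add: sum.cartesian_product grid_cells_def G_def case_prod_unfold)
    qed
    have "\<bar>conditional_W1 G G ?e - conditional_W1 G G ?\<rho>\<bar>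
      \<le> 2 * (CARD('d) / 2 ^ J) + CARD('d) / 2 ^ 0 * \<Delta> 0 + 3 * (\<Sum>j<J. CARD('d) / 2 ^ j * \<Delta> (Suc j))"
      unfolding \<Delta>_def
    proof (rule conditional_W1_stability[OF G G _ e1 _ \<rho>1])
      fix x y :: "real ^ 'd" assume "x \<in> G" "y \<in> G"
      then show "dyadic_cell 0 x = dyadic_cell 0 y"
        using grid_point_interior[OF N, of x] grid_point_interior[OF N, of y] by (simp add: dyadic_cell_0 G_def)
    qed (auto intro: dyadic_cell_refine dyadic_cell_dist joint_mass_nonneg)
    also have "\<dots> \<le> 2 * (CARD('d) / 2 ^ J) + (\<Sum>j\<le>J. 6 * CARD('d) / 2 ^ j * \<Delta> j)"
    proof -
      have "\<Delta> 0 \<ge> 0" unfolding \<Delta>_eq by (intro sum_nonneg) simp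
      then have "CARD('d) / 2 ^ 0 * \<Delta> 0 \<le> 6 * CARD('d) / 2 ^ 0 * \<Delta> 0"
        by (intro mult_right_mono) auto
      \<comment> \<open>Stability pairs the diameter of level j with the deviation of level j + 1.
        Shifting the index doubles the constant 3 to 6; level 0, with constant 1, is
        absorbed.\<close>
      moreover have "3 * (\<Sum>j<J. CARD('d) / 2 ^ j * \<Delta> (Suc j)) = (\<Sum>j<J. 6 * CARD('d) / 2 ^ Suc j * \<Delta> (Suc j))"
        by (simp add: sum_distrib_left mult.assoc)
      ultimately show ?thesis unfolding sum.atMost_shift by linarith
    qed
    finally show ?thesis unfolding \<Delta>_eq .
  qed
  ultimately show ?thesis by linarith
qed

end

section \<open>Choice of the constants and the exceptional event\<close>

theorem mainTheorem12:
  fixes M :: "'w measure"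
    and \<pi> :: "((real ^ 'd) \<times> (real ^ 'd)) measure"
    and X1 X2 :: "nat \<Rightarrow> 'w \<Rightarrow> real ^ 'd"
    and \<kappa> :: "real ^ 'd \<Rightarrow> (real ^ 'd) measure"
  assumes P: "prob_space M"
    and pi_prob: "prob_space \<pi>" and pi_sets: "sets \<pi> = sets borel"
    and pi_cube: "emeasure \<pi> (unit_cube \<times> unit_cube) = 1"
    and iid_indep: "prob_space.indep_vars M (\<lambda>_. borel) (\<lambda>n w. (X1 n w, X2 n w)) {1..}"
    and iid_law: "\<And>n. n \<ge> 1 \<Longrightarrow> distr M borel (\<lambda>w. (X1 n w, X2 n w)) = \<pi>"
    and kernel_prob: "\<And>x. x \<in> unit_cube \<Longrightarrow> prob_space (\<kappa> x) \<and> sets (\<kappa> x) = sets borel"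
    and kernel_meas: "\<And>B. B \<in> sets borel \<Longrightarrow>
           (\<lambda>x. emeasure (\<kappa> x) B) \<in> borel_measurable (restrict_space borel unit_cube)"
    and disint: "\<And>A B. A \<in> sets borel \<Longrightarrow> B \<in> sets borel \<Longrightarrow>
           emeasure \<pi> (A \<times> B) =
             (\<integral>\<^sup>+ x. indicator (A \<inter> unit_cube) x * emeasure (\<kappa> x) B \<partial>(distr \<pi> borel fst))"
    and lipschitz: "\<exists>L. \<forall>x\<in>unit_cube. \<forall>y\<in>unit_cube. W1 (\<kappa> x) (\<kappa> y) \<le> L * dist x y"
  shows "\<exists>c>0. \<exists>C>0. \<forall>N\<ge>1. \<forall>\<epsilon>>0.
     {w \<in> space M. \<bar>emp_AW_int N X1 X2 w
          - (LINT x:unit_cube|distr \<pi> borel fst. W1 (\<kappa> x) (distr \<pi> borel snd))\<bar>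
        \<ge> 2 * C * rate CARD('d) N + \<epsilon>} \<in> sets M
     \<and> measure M {w \<in> space M. \<bar>emp_AW_int N X1 X2 w
          - (LINT x:unit_cube|distr \<pi> borel fst. W1 (\<kappa> x) (distr \<pi> borel snd))\<bar>
        \<ge> 2 * C * rate CARD('d) N + \<epsilon>}
       \<le> 4 * exp (- c * real N * \<epsilon>\<^sup>2)"
proof -
  interpret prob_space M by fact
  obtain L0 where L0: "\<forall>x\<in>unit_cube. \<forall>y\<in>unit_cube. W1 (\<kappa> x) (\<kappa> y) \<le> L0 * dist x y"
    using lipschitz by blast
  define L where "L = max 0 L0"
  have L: "W1 (\<kappa> x) (\<kappa> y) \<le> L * dist x y" if "x \<in> unit_cube" "y \<in> unit_cube" for x y
  proof -
    have "L0 * dist x y \<le> L * dist x y" unfolding L_def by (intro mult_right_mono) auto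
    with L0 that show ?thesis by (meson order.trans)
  qed
  interpret K: lipschitz_kernel \<pi> \<kappa> L
    by (rule lipschitz_kernel.intro[OF pi_prob pi_sets pi_cube kernel_prob kernel_meas disint L]) (simp_all add: L_def)
  define d where "d = real CARD('d)"
  have d: "d \<ge> 1" by (simp add: d_def Suc_le_eq)
  have L_nonneg: "L \<ge> 0" by (simp add: L_def)
  have card_d: "CARD('d) \<ge> 1" by (simp add: Suc_le_eq)
  obtain C0 where C0: "C0 > 0" and C0_rate: "\<forall>N\<ge>1. \<exists>J. 1 / 2 ^ J \<le> C0 * rate CARD('d) N \<and>
     1 / real (grid_m CARD('d) N) \<le> C0 * rate CARD('d) N \<and>
     (\<Sum>j\<le>J. 1 / 2 ^ j * sqrt (real (grid_m CARD('d) N) ^ CARD('d) * (2 ^ j) ^ CARD('d) / real N)) \<le> C0 * rate CARD('d) N"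
    using multiscale_rate[of "CARD('d)"] card_d by blast
  \<comment> \<open>With R = C0 * rate, 2 C * rate = (2 L + 12) d R has three parts: (2 L + 4) d R
    for rounding, 2 d R for the finest cells and 6 d R for the mean of the statistic. In
    \<open>c\<close>, 12 d is the bound \<beta> on the weight through one point, namely 6 d times
    the sum of 2^(-j).\<close>
  define C where "C = (L + 6) * d * C0"
  define c where "c = 1 / (2 * (12 * d)\<^sup>2)"
  have Cpos: "C > 0" and cpos: "c > 0" using L_nonneg d C0 by (simp_all add: C_def c_def)
  define I where "I = (LINT x:unit_cube|distr \<pi> borel fst. W1 (\<kappa> x) (distr \<pi> borel snd))"
  define Y where "Y n w = (X1 n w, X2 n w)" for n w
  have Y_rv: "Y n \<in> borel_measurable M" if "n \<ge> 1" for n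
    using iid_indep that by (auto simp: indep_vars_def Y_def[abs_def])
  have X_rv: "X1 n \<in> borel_measurable M" "X2 n \<in> borel_measurable M" if "n \<ge> 1" for n
    using measurable_compose[OF Y_rv[OF that] borel_measurable_fst_prod]
      measurable_compose[OF Y_rv[OF that] borel_measurable_snd_prod] by (simp_all add: Y_def)
  have X_cube: "AE w in M. X1 n w \<in> unit_cube \<and> X2 n w \<in> unit_cube" if "n \<ge> 1" for n
  proof -
    have "distr M borel (Y n) = \<pi>" using iid_law[OF that] by (simp add: Y_def[abs_def])
    then have "AE z in distr M borel (Y n). fst z \<in> unit_cube \<and> snd z \<in> unit_cube"
      using K.AE_pi_cube by (simp only:)
    from AE_distrD[OF Y_rv[OF that] this] show ?thesis by (simp add: Y_def)
  qed
  define E where "E N \<epsilon> = {w \<in> space M. \<bar>emp_AW_int N X1 X2 w - I\<bar> \<ge> 2 * C * rate CARD('d) N + \<epsilon>}" for N \<epsilon>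
  have main: "E N \<epsilon> \<in> events \<and>
     prob (E N \<epsilon>) \<le> 4 * exp (- c * real N * \<epsilon>\<^sup>2)"
    if N: "N \<ge> 1" and \<epsilon>: "\<epsilon> > 0" for N :: nat and \<epsilon> :: real
  proof
    define R where "R = C0 * rate CARD('d) N"
    obtain J where J: "1 / 2 ^ J \<le> R" "1 / real (grid_m CARD('d) N) \<le> R"
     "(\<Sum>j\<le>J. 1 / 2 ^ j * sqrt (real (grid_m CARD('d) N) ^ CARD('d) * (2 ^ j) ^ CARD('d) / real N)) \<le> R"
      using C0_rate N unfolding R_def by blast
    \<comment> \<open>All levels are merged into one family of events, so that a single application
      of the concentration bound covers the whole multiscale sum.\<close>
    define S where "S = (SIGMA j:{..J}. K.grid_cells N j)"
    define b where "b k = 6 * d / 2 ^ fst k" for k :: "nat \<times> (real ^ 'd) \<times> ('d \<Rightarrow> int)"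
    define B where "B k = K.cell_event N (fst k) (snd k)" for k
    have sumS: "(\<Sum>k\<in>S. f (fst k) (snd k)) = (\<Sum>j\<le>J. \<Sum>s\<in>K.grid_cells N j. f j s)" for f :: "_ \<Rightarrow> _ \<Rightarrow> real"
      unfolding S_def using K.finite_grid_cells[OF N] by (subst sum.Sigma) (auto simp: case_prod_unfold)
    define V where "V w = (\<Sum>k\<in>S. b k * \<bar>(\<Sum>n\<in>{1..N}. indicator (B k) (Y n w)) / N - measure \<pi> (B k)\<bar>)" for w
    define t where "t = (\<Sum>k\<in>S. b k * sqrt (measure \<pi> (B k) / N)) + \<epsilon>"
    have "emp_AW_int N X1 X2 \<in> borel_measurable M"
      using X_rv by (intro emp_AW_int_measurable) auto
    then show "E N \<epsilon> \<in> events"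
      unfolding E_def by measurable
    have indep: "indep_vars (\<lambda>_. borel) Y {1..N}"
      using indep_vars_subset[OF iid_indep, of "{1..N}"] by (simp add: Y_def[abs_def])
    have \<beta>: "(\<Sum>k\<in>S. b k * indicator (B k) y) \<le> 12 * d" for y
    proof -
      have "(\<Sum>k\<in>S. b k * indicator (B k) y) = (\<Sum>j\<le>J. 6 * d / 2 ^ j * (\<Sum>s\<in>K.grid_cells N j. indicator (K.cell_event N j s) y))"
        unfolding b_def B_def sum_distrib_left by (rule sumS)
      also have "\<dots> \<le> (\<Sum>j\<le>J. 6 * d / 2 ^ j * 1)"
        using d K.sum_cell_event_indicator_le[OF N] by (intro sum_mono mult_left_mono) auto
      also have "\<dots> = 6 * d * (\<Sum>j\<le>J. (1/2) ^ j)" by (simp add: sum_distrib_left power_divide)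
      also have "(\<Sum>j\<le>J. (1/2::real) ^ j) = 2 - (1/2) ^ J" by (induction J) (simp_all add: field_simps)
      also have "6 * d * (2 - (1/2) ^ J) \<le> 12 * d" using d by (simp add: right_diff_distrib)
      finally show ?thesis .
    qed
    have S_fin: "finite S" unfolding S_def using K.finite_grid_cells[OF N] by auto
    have law: "distr M borel (Y n) = \<pi>" if "n \<in> {1..N}" for n
      using iid_law[of n] that by (simp add: Y_def[abs_def])
    have b0: "b k \<ge> 0" for k using d by (simp add: b_def)
    have B_sets: "B k \<in> sets \<pi>" for k unfolding B_def by (rule K.cell_event_sets[OF N])
    have d12: "12 * d > 0" using d by simp
    note tail = iid_empirical_deviation_tail[OF indep law N S_fin b0 B_sets \<beta> d12 \<epsilon>, folded V_def t_def]
    have mean: "t \<le> 6 * d * R + \<epsilon>"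
    proof -
      have "(\<Sum>k\<in>S. b k * sqrt (measure \<pi> (B k) / N))
          = (\<Sum>j\<le>J. 6 * d / 2 ^ j * (\<Sum>s\<in>K.grid_cells N j. sqrt (measure \<pi> (K.cell_event N j s) / N)))"
        unfolding b_def B_def sum_distrib_left by (rule sumS)
      also have "\<dots> \<le> (\<Sum>j\<le>J. 6 * d / 2 ^ j * sqrt (real (grid_m CARD('d) N) ^ CARD('d) * (2 ^ j) ^ CARD('d) / real N))"
      \<comment> \<open>Cauchy-Schwarz at one level: the events have total probability at most 1,
        and their number is at most m^d 2^(jd).\<close>
      proof (intro sum_mono mult_left_mono)
        fix j
        have "(\<Sum>s\<in>K.grid_cells N j. sqrt (measure \<pi> (K.cell_event N j s) / N))
            \<le> sqrt (real (card (K.grid_cells N j)) * (\<Sum>s\<in>K.grid_cells N j. measure \<pi> (K.cell_event N j s) / N))"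
          by (rule sum_sqrt_le_sqrt_card) simp
        also have "\<dots> = sqrt (real (card (K.grid_cells N j)) * (\<Sum>s\<in>K.grid_cells N j. measure \<pi> (K.cell_event N j s)) / N)"
          by (simp add: sum_divide_distrib[symmetric])
        also have "\<dots> \<le> sqrt (real (grid_m CARD('d) N ^ CARD('d) * (2 ^ j) ^ CARD('d)) * 1 / N)"
          using K.card_grid_cells_le[OF N, of j] K.sum_cell_event_measure_le[OF N, of j]
          by (intro real_sqrt_le_mono divide_right_mono mult_mono of_nat_mono) (auto intro: sum_nonneg)
        finally show "(\<Sum>s\<in>K.grid_cells N j. sqrt (measure \<pi> (K.cell_event N j s) / N))
            \<le> sqrt (real (grid_m CARD('d) N) ^ CARD('d) * (2 ^ j) ^ CARD('d) / real N)" by simp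
      qed (use d in auto)
      also have "\<dots> = 6 * d * (\<Sum>j\<le>J. 1 / 2 ^ j * sqrt (real (grid_m CARD('d) N) ^ CARD('d) * (2 ^ j) ^ CARD('d) / real N))"
        by (simp add: sum_distrib_left)
      also have "\<dots> \<le> 6 * d * R" using J(3) d by (intro mult_left_mono) auto
      finally show ?thesis by (simp add: t_def)
    qed
    have "AE w in M. \<forall>n\<in>{1..N}. X1 n w \<in> unit_cube \<and> X2 n w \<in> unit_cube"
      using X_cube by (intro AE_finite_allI) auto
    \<comment> \<open>The deterministic estimate requires samples in the cube, which is guaranteed
      only almost surely; hence an inclusion of events up to a null set.\<close>
    then have "AE w in M. w \<in> E N \<epsilon> \<longrightarrow> w \<in> {w\<in>space M. V w \<ge> t}"
    proof eventually_elim
      case (elim w)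
      show ?case
      proof
        assume w: "w \<in> E N \<epsilon>"
        have "V w = (\<Sum>j\<le>J. \<Sum>s\<in>K.grid_cells N j. 6 * d / 2 ^ j *
            \<bar>(\<Sum>n\<in>{1..N}. indicator (K.cell_event N j s) (Y n w)) / N - measure \<pi> (K.cell_event N j s)\<bar>)"
          unfolding V_def b_def B_def by (rule sumS)
        then have V: "V w = (\<Sum>j\<le>J. 6 * CARD('d) / 2 ^ j * (\<Sum>s\<in>K.grid_cells N j.
            \<bar>(\<Sum>n\<in>{1..N}. indicator (K.cell_event N j s) (X1 n w, X2 n w)) / real N - measure \<pi> (K.cell_event N j s)\<bar>))"
          by (simp add: sum_distrib_left d_def Y_def)
        have "\<bar>emp_AW_int N X1 X2 w - I\<bar> \<le> (2 * L + 4) * (d / real (grid_m CARD('d) N)) + 2 * (d / 2 ^ J) + V w"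
          unfolding V I_def d_def using elim by (intro K.empirical_deviation_le N) auto
        also have "\<dots> \<le> (2 * L + 4) * (d * R) + 2 * (d * R) + V w"
        proof -
          have "d / real (grid_m CARD('d) N) \<le> d * R" "d / 2 ^ J \<le> d * R"
            using mult_left_mono[OF J(2), of d] mult_left_mono[OF J(1), of d] d by auto
          then show ?thesis using L_nonneg by (intro add_mono mult_left_mono) auto
        qed
        finally have "2 * C * rate CARD('d) N + \<epsilon> \<le> (2 * L + 6) * (d * R) + V w"
          using w by (simp add: E_def algebra_simps)
        moreover have "2 * C * rate CARD('d) N = (2 * L + 6) * (d * R) + 6 * d * R"
          by (simp add: C_def R_def algebra_simps)
        ultimately show "w \<in> {w\<in>space M. V w \<ge> t}"
          using mean w by (simp add: E_def)
      qed
    qed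
    \<comment> \<open>The two-sided deviation of the functional is already dominated by
      \<open>V\<close>, so one upper tail settles both signs.\<close>
    then have "prob (E N \<epsilon>) \<le> prob {w\<in>space M. V w \<ge> t}"
      using tail(1) by (intro finite_measure_mono_AE) auto
    also have "\<dots> \<le> exp (- c * real N * \<epsilon>\<^sup>2)"
      using tail(2) by (simp add: c_def)
    also have "\<dots> \<le> 4 * exp (- c * real N * \<epsilon>\<^sup>2)" by simp
    finally show "prob (E N \<epsilon>)
        \<le> 4 * exp (- c * real N * \<epsilon>\<^sup>2)" .
  qed
  show ?thesis
    using cpos Cpos main unfolding E_def I_def by (intro exI[of _ c] exI[of _ C] conjI allI impI) auto
qed

end
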